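(* Let $(\mathcal P_t)_{t\ge0}$ be a decohering QMS. Let $t\mapsto p(t)$ be a twice continuously differentiable increasing real function in a neighbourhood of $0$ with $p(0)=q\ge1$, and let $t\mapsto Y(t)\in\mathcal B(\mathcal H)$ be twice continuously differentiable with $Y(t)$ positive definite in a neighbourhood of $0$; set $Y=Y(0)$. Then $\frac{d}{dt}\|Y(t)\|_{(q,p(t)),\mathcal N}\Big|_{t=0}=\frac{p'(0)}{q\|Y\|^{q-1}_{q,\sigma_{\mathrm{Tr}}}}\Big(\mathrm{Ent}_{q,\mathcal N}(Y)+\frac{q}{p'(0)}\mathrm{Tr}\big[(\Gamma^{1/q}(Y))^{q-1}\Gamma^{1/q}(Y'(0))\big]\Big)$.
   Context: $\mathcal H$ finite-dimensional of dimension $d_{\mathcal H}$; $\|Y\|_p=(\mathrm{Tr}|Y|^p)^{1/p}$. QMS $\mathcal P_t$ (unital completely positive maps), decohering = has a full-rank invariant state; $\mathcal N$ its decoherence-free algebra ($X$ with $\mathcal P_t(X^*X)=\mathcal P_t(X)^*\mathcal P_t(X)$, $\mathcal P_t(XX^* )=\mathcal P_t(X)\mathcal P_t(X)^*$ for all $t$), $E_{\mathcal N}$ the unique conditional expectation onto $\mathcal N$ with $\mathcal P_t(X-E_{\mathcal N}[X])\to0$, $E_{\mathcal N*}$ its predual, $\sigma_{\mathrm{Tr}}=E_{\mathcal N*}(\mathbb I/d_{\mathcal H})$. $\Gamma^s(X)=\sigma_{\mathrm{Tr}}^{s/2}X\sigma_{\mathrm{Tr}}^{s/2}$, $\|X\|_{p,\sigma_{\mathrm{Tr}}}=\|\Gamma^{1/p}(X)\|_p$.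 Amalgamated norms: for $1\le a\le b\le\infty$, $1/r=1/a-1/b$: $\|X\|_{(a,b),\mathcal N}=\inf\{\|A\|_{2r,\sigma_{\mathrm{Tr}}}\|B\|_{2r,\sigma_{\mathrm{Tr}}}\|Y\|_{b,\sigma_{\mathrm{Tr}}}:A,B\in\mathcal N,X=AYB\}$ and $\|X\|_{(b,a),\mathcal N}=\sup_{A,B\in\mathcal N}\|AXB\|_{a,\sigma_{\mathrm{Tr}}}/(\|A\|_{2r,\sigma_{\mathrm{Tr}}}\|B\|_{2r,\sigma_{\mathrm{Tr}}})$. For $Y>0$, $Z=\Gamma^{1/q}(Y)$: $\mathrm{Ent}_{q,\mathcal N}(Y)=\frac1q\mathrm{Tr}[Z^q(\ln Z^q-\ln\sigma_{\mathrm{Tr}}-\ln E_{\mathcal N}[\sigma_{\mathrm{Tr}}^{-1/2}Z^q\sigma_{\mathrm{Tr}}^{-1/2}])]$. *)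

theory Defs
  imports "HOL-Analysis.Analysis"
begin

text \<open>Operators on a finite-dimensional Hilbert space H = complex^'n, d_H = CARD('n).
  Matrices are elements of complex^'n^'n.\<close>

type_synonym 'n cmat = "complex^'n^'n"

definition adj :: "'n::finite cmat \<Rightarrow> 'n cmat" where
  "adj X = (\<chi> i j. cnj (X $ j $ i))"

definition smat :: "complex \<Rightarrow> 'n::finite cmat \<Rightarrow> 'n cmat" where
  "smat c X = (\<chi> i j. c * X $ i $ j)"

definition cinner :: "complex^'n::finite \<Rightarrow> complex^'n \<Rightarrow> complex" where
  "cinner v w = (\<Sum>i\<in>UNIV. cnj (v $ i) * w $ i)"

definition nonneg_c :: "complex \<Rightarrow> bool" where
  "nonneg_c z \<longleftrightarrow> Im z = 0 \<and> 0 \<le> Re z"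

definition psd :: "'n::finite cmat \<Rightarrow> bool" where
  "psd A \<longleftrightarrow> (\<forall>v. nonneg_c (cinner v (A *v v)))"

definition pos_def :: "'n::finite cmat \<Rightarrow> bool" where
  "pos_def A \<longleftrightarrow> (\<forall>v. v \<noteq> 0 \<longrightarrow> Im (cinner v (A *v v)) = 0 \<and> 0 < Re (cinner v (A *v v)))"

definition unitary :: "'n::finite cmat \<Rightarrow> bool" where
  "unitary U \<longleftrightarrow> U ** adj U = mat 1 \<and> adj U ** U = mat 1"

definition diag_mat :: "('n::finite \<Rightarrow> complex) \<Rightarrow> 'n cmat" where
  "diag_mat d = (\<chi> i j. if i = j then d i else 0)"

definition mfun :: "(real \<Rightarrow> real) \<Rightarrow> 'n::finite cmat \<Rightarrow> 'n cmat" where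
  "mfun f A = (SOME B. \<exists>U lam. unitary U \<and>
      A = U ** diag_mat (\<lambda>i. complex_of_real (lam i)) ** adj U \<and>
      B = U ** diag_mat (\<lambda>i. complex_of_real (f (lam i))) ** adj U)"

text \<open>Schatten p-norm, p in [1,\<infinity>]; |Y|^p = (Y^* Y)^(p/2); p = \<infinity> is the operator norm.\<close>
definition schatten :: "ereal \<Rightarrow> 'n::finite cmat \<Rightarrow> real" where
  "schatten p Y = (if p = \<infinity> then onorm (\<lambda>v. Y *v v)
     else (Re (trace (mfun (\<lambda>x. x powr (real_of_ereal p / 2)) (adj Y ** Y)))) powr (1 / real_of_ereal p))"

definition clinear_map :: "('n::finite cmat \<Rightarrow> 'n cmat) \<Rightarrow> bool" where
  "clinear_map \<Phi> \<longleftrightarrow> (\<forall>c X Y. \<Phi> (smat c X + Y) = smat c (\<Phi> X) + \<Phi> Y)"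

definition block_psd :: "nat \<Rightarrow> (nat \<Rightarrow> nat \<Rightarrow> 'n::finite cmat) \<Rightarrow> bool" where
  "block_psd k X \<longleftrightarrow> (\<forall>v :: nat \<Rightarrow> complex^'n.
      nonneg_c (\<Sum>i<k. \<Sum>j<k. cinner (v i) (X i j *v v j)))"

definition completely_positive :: "('n::finite cmat \<Rightarrow> 'n cmat) \<Rightarrow> bool" where
  "completely_positive \<Phi> \<longleftrightarrow>
     (\<forall>k X. block_psd k X \<longrightarrow> block_psd k (\<lambda>i j. \<Phi> (X i j)))"

definition qms :: "(real \<Rightarrow> 'n::finite cmat \<Rightarrow> 'n cmat) \<Rightarrow> bool" where
  "qms P \<longleftrightarrow>
     (\<forall>t\<ge>0. clinear_map (P t) \<and> completely_positive (P t) \<and> P t (mat 1) = mat 1) \<and>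
     P 0 = id \<and>
     (\<forall>s\<ge>0. \<forall>t\<ge>0. P (s + t) = P s \<circ> P t) \<and>
     (\<forall>X. ((\<lambda>t. P t X) \<longlongrightarrow> X) (at_right 0))"

definition decohering :: "(real \<Rightarrow> 'n::finite cmat \<Rightarrow> 'n cmat) \<Rightarrow> bool" where
  "decohering P \<longleftrightarrow> qms P \<and>
     (\<exists>\<rho>. pos_def \<rho> \<and> trace \<rho> = 1 \<and> (\<forall>t\<ge>0. \<forall>X. trace (\<rho> ** P t X) = trace (\<rho> ** X)))"

definition dfa :: "(real \<Rightarrow> 'n::finite cmat \<Rightarrow> 'n cmat) \<Rightarrow> 'n cmat set" where
  "dfa P = {X. \<forall>t\<ge>0. P t (adj X ** X) = adj (P t X) ** P t X \<and>
                     P t (X ** adj X) = P t X ** adj (P t X)}"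

definition cond_exp_onto :: "'n::finite cmat set \<Rightarrow> ('n cmat \<Rightarrow> 'n cmat) \<Rightarrow> bool" where
  "cond_exp_onto N E \<longleftrightarrow> clinear_map E \<and> (\<forall>X. E X \<in> N) \<and> (\<forall>X\<in>N. E X = X) \<and>
     (\<forall>X. psd X \<longrightarrow> psd (E X)) \<and>
     (\<forall>A\<in>N. \<forall>B\<in>N. \<forall>X. E (A ** X ** B) = A ** E X ** B)"

definition condexpN :: "(real \<Rightarrow> 'n::finite cmat \<Rightarrow> 'n cmat) \<Rightarrow> 'n cmat \<Rightarrow> 'n cmat" where
  "condexpN P = (THE E. cond_exp_onto (dfa P) E \<and>
       (\<forall>X. ((\<lambda>t. P t (X - E X)) \<longlongrightarrow> 0) at_top))"

definition predual :: "('n::finite cmat \<Rightarrow> 'n cmat) \<Rightarrow> 'n cmat \<Rightarrow> 'n cmat" where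
  "predual \<Phi> \<rho> = (THE \<sigma>. \<forall>X. trace (\<sigma> ** X) = trace (\<rho> ** \<Phi> X))"

definition sigmaTr :: "(real \<Rightarrow> 'n::finite cmat \<Rightarrow> 'n cmat) \<Rightarrow> 'n cmat" where
  "sigmaTr P = predual (condexpN P) (smat (1 / of_nat CARD('n)) (mat 1))"

definition mpow :: "'n::finite cmat \<Rightarrow> real \<Rightarrow> 'n cmat" where
  "mpow A s = mfun (\<lambda>x. x powr s) A"

definition GammaS :: "(real \<Rightarrow> 'n::finite cmat \<Rightarrow> 'n cmat) \<Rightarrow> real \<Rightarrow> 'n cmat \<Rightarrow> 'n cmat" where
  "GammaS P s X = mpow (sigmaTr P) (s / 2) ** X ** mpow (sigmaTr P) (s / 2)"

definition wnorm :: "(real \<Rightarrow> 'n::finite cmat \<Rightarrow> 'n cmat) \<Rightarrow> ereal \<Rightarrow> 'n cmat \<Rightarrow> real" where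
  "wnorm P p X = schatten p (GammaS P (if p = \<infinity> then 0 else 1 / real_of_ereal p) X)"

text \<open>2r where 1/r = 1/a - 1/b (a \<le> b); r = \<infinity> when a = b.\<close>
definition two_r :: "real \<Rightarrow> real \<Rightarrow> ereal" where
  "two_r a b = (if a = b then \<infinity> else ereal (2 / (1 / a - 1 / b)))"

definition amal_norm :: "(real \<Rightarrow> 'n::finite cmat \<Rightarrow> 'n cmat) \<Rightarrow> real \<Rightarrow> real \<Rightarrow> 'n cmat \<Rightarrow> real" where
  "amal_norm P x y X =
    (if x \<le> y then
       Inf {wnorm P (two_r x y) A * wnorm P (two_r x y) B * wnorm P (ereal y) Z
             | A B Z. A \<in> dfa P \<and> B \<in> dfa P \<and> X = A ** Z ** B}
     else
       Sup {wnorm P (ereal y) (A ** X ** B) / (wnorm P (two_r y x) A * wnorm P (two_r y x) B)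
             | A B. A \<in> dfa P \<and> B \<in> dfa P})"

definition EntN :: "(real \<Rightarrow> 'n::finite cmat \<Rightarrow> 'n cmat) \<Rightarrow> real \<Rightarrow> 'n cmat \<Rightarrow> complex" where
  "EntN P q Y =
    (let \<sigma> = sigmaTr P; Zq = mpow (GammaS P (1 / q) Y) q in
     complex_of_real (1 / q) *
       trace (Zq ** (mfun ln Zq - mfun ln \<sigma>
                     - mfun ln (condexpN P (mpow \<sigma> (-1/2) ** Zq ** mpow \<sigma> (-1/2))))))"

definition C2_on :: "real set \<Rightarrow> (real \<Rightarrow> 'a::real_normed_vector) \<Rightarrow> (real \<Rightarrow> 'a) \<Rightarrow> (real \<Rightarrow> 'a) \<Rightarrow> bool" where
  "C2_on S f f' f'' \<longleftrightarrow> (\<forall>t\<in>S. (f has_vector_derivative f' t) (at t) \<and>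
      (f' has_vector_derivative f'' t) (at t)) \<and> continuous_on S f''"

end

theory Submission
  imports Defs
begin

text \<open>
  An idempotent limit point E of the semigroup is a conditional expectation onto the
  decoherence-free algebra N: by the Kadison-Schwarz inequality and the faithful invariant state,
  the range of E, N and the multiplicative domain coincide, and the semigroup vanishes
  asymptotically on the kernel of E. The state sigma = E_*(1/d) commutes with N.

  Put s = (1/p - 1/q)/2. For p > q the amalgamated norm of Y is the infimum, and for p < q the
  supremum, of the p-norms of a^s Y b^s over positive a, b in N with Tr(sigma a) = Tr(sigma b) = 1.
  Adding a small multiple of the identity to a and b moves these norms in the harmless direction,
  so that a and b may be assumed to have spectrum in a fixed compact subset of the positive
  half-line. There the norm has a first-order expansion in t that is uniform in a and b: in joint
  eigenbases, the second-order remainder of a trace function is a positively weighted sum of scalar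
  Taylor remainders. The coefficient depends on a only through Tr(Z^q ln a) with
  Z = Gamma^(1/q)(Y), which by the Gibbs inequality is maximal at
  a = E(sigma^(-1/2) Z^q sigma^(-1/2)) / Tr(Z^q). Inserting this optimal weight produces the entropy.
\<close>

section \<open>Matrix algebra\<close>

text \<open>The optimization over factors in N is the obstacle: near-optimal weights vary with t in
  an uncontrolled way, and \<open>ln a\<close> is unbounded on the set of all densities. Truncation
  is cheap. A weight above \<open>\<delta>\<close> of trace \<open>1 + \<delta>\<close> raises the
  Gibbs maximum by at most \<open>G * ln (1 + \<delta>)\<close>, where G is Tr(Z^q), and
  \<open>\<delta>\<close> is fixed once the error e is given. One bound then serves both signs of t.
  The coefficient of Tr(Z^q ln a) in the expansion is nonpositive, so the Gibbs inequality bounds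
  the first-order coefficient from below; multiplied by t, this bounds the infimum from below for t
  > 0 and the supremum from above for t < 0. The opposite bounds come from the single weight a = b =
  a0, which is not truncated. For q = 1 and t < 0 the exponent p(t) lies below 1, where the Schatten
  functional is not a norm. Hence no triangle or Hoelder inequality for it is used: comparisons rest
  on the monotonicity of Tr(A^u) for every u > 0.\<close>

lemma mat_mult_nth: "((A::complex^'n^'m) ** (B::complex^'k^'n)) $ i $ j = (\<Sum>k\<in>UNIV. A$i$k * B$k$j)"
  by (simp add: matrix_matrix_mult_def)

lemma adj_nth [simp]: "adj X $ i $ j = cnj (X $ j $ i)"
  by (simp add: adj_def)

lemma smat_nth [simp]: "smat c X $ i $ j = c * X $ i $ j"
  by (simp add: smat_def)

lemma diag_mat_nth: "diag_mat d $ i $ j = (if i = j then d i else 0)"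
  by (simp add: diag_mat_def)

lemma mat_1_nth: "(mat 1 :: complex^'n^'n) $ i $ j = (if i = j then 1 else 0)"
  by (simp add: mat_def)

lemma adj_adj [simp]: "adj (adj X) = X"
  by (simp add: vec_eq_iff)

lemma adj_mult: "adj (A ** B) = adj B ** adj A"
  by (simp add: vec_eq_iff mat_mult_nth mult.commute)

lemma adj_add: "adj (A + B) = adj A + adj B"
  and adj_diff: "adj (A - B) = adj A - adj B"
  and adj_smat: "adj (smat c A) = smat (cnj c) (adj A)"
  and adj_scaleR: "adj (r *\<^sub>R A) = r *\<^sub>R adj A"
  by (simp_all add: vec_eq_iff)

lemma adj_one [simp]: "adj (mat 1) = mat 1"
  by (simp add: vec_eq_iff mat_1_nth)

lemma adj_zero [simp]: "adj 0 = 0"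
  by (simp add: vec_eq_iff)

lemma adj_eq_iff: "adj A = adj B \<longleftrightarrow> A = B"
  by (metis adj_adj)

lemma adj_diag_mat: "adj (diag_mat d) = diag_mat (\<lambda>i. cnj (d i))"
  by (simp add: vec_eq_iff diag_mat_nth)

lemma mat_diff_distrib:
  "(A::complex^'n^'n) ** (B - C) = A ** B - A ** C"
  "(A - B) ** (C::complex^'n^'n) = A ** C - B ** C"
  by (simp_all add: vec_eq_iff mat_mult_nth sum_subtractf algebra_simps)

lemma mat_add_distrib:
  "(A::complex^'n^'n) ** (B + C) = A ** B + A ** C"
  "(A + B) ** (C::complex^'n^'n) = A ** C + B ** C"
  by (simp_all add: vec_eq_iff mat_mult_nth sum.distrib algebra_simps)

lemma mat_uminus_mult:
  "(A::complex^'n^'n) ** (- B) = - (A ** B)"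
  "(- A) ** (B::complex^'n^'n) = - (A ** B)"
  by (simp_all add: vec_eq_iff mat_mult_nth sum_negf)

lemma mat_smat_mult:
  "(A::complex^'n^'n) ** smat c B = smat c (A ** B)"
  "smat c A ** (B::complex^'n^'n) = smat c (A ** B)"
  by (simp_all add: vec_eq_iff mat_mult_nth sum_distrib_left algebra_simps)

lemma mat_scaleR_mult:
  "(A::complex^'n^'n) ** (r *\<^sub>R B) = r *\<^sub>R (A ** B)"
  "(r *\<^sub>R A) ** (B::complex^'n^'n) = r *\<^sub>R (A ** B)"
  by (simp_all add: vec_eq_iff mat_mult_nth scaleR_sum_right)

lemma mat_zero_mult [simp]:
  "(A::complex^'n^'n) ** 0 = 0"
  "0 ** (B::complex^'n^'n) = 0"
  by (simp_all add: vec_eq_iff mat_mult_nth)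

lemmas mat_simps = mat_diff_distrib mat_add_distrib mat_uminus_mult mat_smat_mult
  mat_scaleR_mult matrix_mul_assoc

lemma smat_of_real: "smat (complex_of_real r) X = r *\<^sub>R X"
  by (simp add: vec_eq_iff) (metis scaleR_conv_of_real)

lemma smat_1 [simp]: "smat 1 X = X"
  and smat_0 [simp]: "smat 0 X = 0"
  and smat_smat: "smat c (smat d X) = smat (c * d) X"
  by (simp_all add: vec_eq_iff)

lemma trace_smat: "trace (smat c X) = c * trace X"
  by (simp add: trace_def sum_distrib_left)

lemma trace_scaleR: "trace (r *\<^sub>R X) = complex_of_real r * trace (X::complex^'n^'n)"
  by (metis smat_of_real trace_smat)

lemma trace_cyc: "trace (A ** B) = trace (B ** (A::complex^'n^'n))"
  by (rule trace_mul_sym)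

lemma trace_adj: "trace (adj A) = cnj (trace A)"
  by (simp add: trace_def)

lemma diag_mat_mult: "diag_mat c ** diag_mat d = diag_mat (\<lambda>i. c i * d i)"
proof -
  have "(\<Sum>k\<in>UNIV. (if i = k then c i else 0) * (if k = j then d k else 0)) = (if i = j then c i * d i else 0)" for i j
  proof -
    have "(\<Sum>k\<in>UNIV. (if i = k then c i else 0) * (if k = j then d k else 0))
      = (\<Sum>k\<in>UNIV. if k = i then (if i = j then c i * d i else 0) else 0)"
      by (rule sum.cong) auto
    then show ?thesis by simp
  qed
  then show ?thesis by (simp add: vec_eq_iff mat_mult_nth diag_mat_nth)
qed

lemma diag_mat_mult_left_nth: "(diag_mat d ** A) $ i $ j = d i * A $ i $ j"
proof -
  have "(\<Sum>k\<in>UNIV. (if i = k then d i else 0) * A$k$j) = (\<Sum>k\<in>UNIV. if k = i then d i * A$i$j else 0)"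
    by (rule sum.cong) auto
  then show ?thesis by (simp add: mat_mult_nth diag_mat_nth)
qed

lemma diag_mat_mult_right_nth: "(A ** diag_mat d) $ i $ j = A $ i $ j * d j"
proof -
  have "(\<Sum>k\<in>UNIV. A$i$k * (if k = j then d k else 0)) = (\<Sum>k\<in>UNIV. if k = j then A$i$j * d j else 0)"
    by (rule sum.cong) auto
  then show ?thesis by (simp add: mat_mult_nth diag_mat_nth)
qed

lemma diag_mat_one: "diag_mat (\<lambda>i. 1) = mat 1"
  by (simp add: vec_eq_iff mat_1_nth diag_mat_nth)

lemma trace_diag_mat: "trace (diag_mat d) = (\<Sum>i\<in>UNIV. d i)"
  by (simp add: trace_def diag_mat_nth)

lemma trace_mult_adj: "trace (A ** adj A) = complex_of_real (\<Sum>i\<in>UNIV. \<Sum>j\<in>UNIV. (cmod (A$i$j))\<^sup>2)"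
  by (simp add: trace_def mat_mult_nth complex_norm_square del: of_real_power)

lemma norm_mat_sq: "(norm (A::complex^'n^'n))\<^sup>2 = (\<Sum>i\<in>UNIV. \<Sum>j\<in>UNIV. (cmod (A$i$j))\<^sup>2)"
  by (simp add: norm_vec_def L2_set_def sum_nonneg)

lemma trace_mult_adj_norm: "trace (A ** adj A) = complex_of_real ((norm A)\<^sup>2)"
  by (simp add: trace_mult_adj norm_mat_sq)

lemma trace_adj_mult_norm: "trace (adj A ** A) = complex_of_real ((norm A)\<^sup>2)"
  by (metis trace_mult_adj_norm trace_cyc)

section \<open>The complex inner product\<close>

lemma cinner_add_left: "cinner (u + v) w = cinner u w + cinner v w"
  and cinner_add_right: "cinner u (v + w) = cinner u v + cinner u w"
  and cinner_diff_left: "cinner (u - v) w = cinner u w - cinner v w"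
  and cinner_diff_right: "cinner u (v - w) = cinner u v - cinner u w"
  and cinner_smult_left: "cinner (c *s u) w = cnj c * cinner u w"
  and cinner_smult_right: "cinner u (c *s w) = c * cinner u w"
  and cinner_minus_left: "cinner (- u) w = - cinner u w"
  and cinner_minus_right: "cinner u (- w) = - cinner u w"
  and cinner_zero_left [simp]: "cinner 0 w = 0"
  and cinner_zero_right [simp]: "cinner u 0 = 0"
  by (simp_all add: cinner_def sum.distrib sum_subtractf sum_distrib_left algebra_simps sum_negf)

lemma cinner_scaleR_left: "cinner (r *\<^sub>R u) w = of_real r * cinner u w"
  and cinner_scaleR_right: "cinner u (r *\<^sub>R w) = of_real r * cinner u w"
  by (simp_all add: cinner_def sum_distrib_left scaleR_conv_of_real[where 'a=complex] algebra_simps)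

lemmas cinner_simps = cinner_add_left cinner_add_right cinner_diff_left cinner_diff_right
  cinner_smult_left cinner_smult_right cinner_minus_left cinner_minus_right
  cinner_scaleR_left cinner_scaleR_right

lemma cnj_cinner: "cnj (cinner v w) = cinner w v"
  by (simp add: cinner_def mult.commute)

lemma cinner_self: "cinner v v = complex_of_real ((norm v)\<^sup>2)"
proof -
  have "(norm v)\<^sup>2 = (\<Sum>i\<in>UNIV. (cmod (v$i))\<^sup>2)"
    by (simp add: norm_vec_def L2_set_def sum_nonneg)
  then show ?thesis
    by (simp add: cinner_def complex_norm_square mult.commute del: of_real_power)
qed

lemma Re_cinner: "Re (cinner v w) = v \<bullet> w"
  by (simp add: cinner_def inner_vec_def inner_complex_def)

lemma cinner_mult_right: "cinner v (A *v w) = cinner (adj A *v v) w"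
proof -
  have "cinner v (A *v w) = (\<Sum>i\<in>UNIV. \<Sum>j\<in>UNIV. cnj (v$i) * (A$i$j * w$j))"
    by (simp add: cinner_def matrix_vector_mult_def sum_distrib_left)
  also have "\<dots> = (\<Sum>j\<in>UNIV. \<Sum>i\<in>UNIV. cnj (v$i) * (A$i$j * w$j))"
    by (rule sum.swap)
  also have "\<dots> = cinner (adj A *v v) w"
    by (simp add: cinner_def matrix_vector_mult_def sum_distrib_right sum_distrib_left mult_ac)
  finally show ?thesis .
qed

lemma mult_vec_simps:
  "(A + B) *v v = A *v v + B *v (v::complex^'n)"
  "(A - B) *v v = A *v v - B *v v"
  "smat c A *v v = c *s (A *v v)"
  "(r *\<^sub>R A) *v v = r *\<^sub>R (A *v v)"
  "A *v (v + w) = A *v v + A *v w"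
  "A *v (v - w) = A *v v - A *v w"
  "A *v (c *s v) = c *s (A *v v)"
  "A *v (r *\<^sub>R v) = r *\<^sub>R (A *v v)"
  "(- A) *v v = - (A *v v)"
  "A *v (- v) = - (A *v v)"
  by (simp_all add: vec_eq_iff matrix_vector_mult_def sum.distrib sum_subtractf algebra_simps
      sum_distrib_left scaleR_sum_right sum_negf)

lemma cinner_left_eq_0: "(\<And>v. cinner v w = 0) \<Longrightarrow> w = 0"
  by (metis cinner_self norm_eq_zero of_real_eq_0_iff zero_eq_power2)

text \<open>Polarization over the complex numbers: \<open>u + w\<close> and
  \<open>u + \<i> *s w\<close> give the sum and the difference of the two cross terms. The form
  therefore determines an arbitrary matrix, Hermitian or not.\<close>

lemma quadratic_form_eq_0:
  assumes "\<And>v. cinner v (A *v v) = 0"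
  shows "A = 0"
proof -
  have "cinner u (A *v w) = 0" for u w
  proof -
    have 1: "cinner u (A *v w) + cinner w (A *v u) = 0"
      using assms[of "u + w"] assms[of u] assms[of w] by (simp add: mult_vec_simps cinner_simps add.commute)
    have 2: "\<i> * cinner u (A *v w) - \<i> * cinner w (A *v u) = 0"
      using assms[of "u + \<i> *s w"] assms[of u] assms[of w] assms[of "\<i> *s w"]
      by (simp add: mult_vec_simps cinner_simps)
    from 2 have "\<i> * (cinner u (A *v w) - cinner w (A *v u)) = 0"
      by (simp add: algebra_simps)
    then have "cinner u (A *v w) = cinner w (A *v u)" by simp
    with 1 show ?thesis by simp
  qed
  then have "A *v w = 0" for w by (rule cinner_left_eq_0)
  then show ?thesis by (simp add: matrix_eq)
qed

lemma cmod_cinner_le: "cmod (cinner v w) \<le> norm v * norm w"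
proof (cases "cinner v w = 0")
  case False
  \<comment> \<open>A unimodular phase that makes the product real, which reduces the claim to the
    real Cauchy-Schwarz inequality.\<close>
  define c where "c = cnj (sgn (cinner v w))"
  have c: "cmod c = 1" using False by (simp add: c_def norm_sgn)
  have "c * cinner v w = of_real (cmod (cinner v w))"
  proof -
    have "cnj (cinner v w) * cinner v w = of_real ((cmod (cinner v w))\<^sup>2)"
      by (metis complex_norm_square mult.commute)
    then show ?thesis using False
      by (simp add: c_def sgn_eq power2_eq_square)
  qed
  then have "cmod (cinner v w) = Re (cinner v (c *s w))" by (simp add: cinner_simps)
  also have "\<dots> \<le> norm v * norm (c *s w)"
    unfolding Re_cinner by (rule norm_cauchy_schwarz)
  also have "norm (c *s w) = norm w"
    by (simp add: norm_vec_def c norm_mult)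
  finally show ?thesis .
qed simp

section \<open>The spectral theorem\<close>

definition herm :: "'n::finite cmat \<Rightarrow> bool" where
  "herm A \<longleftrightarrow> adj A = A"

lemma herm_cinner: "herm A \<Longrightarrow> cinner v (A *v w) = cinner (A *v v) w"
  by (metis cinner_mult_right herm_def)

definition csubspace :: "(complex^'n::finite) set \<Rightarrow> bool" where
  "csubspace S \<longleftrightarrow> 0 \<in> S \<and> (\<forall>x\<in>S. \<forall>y\<in>S. x + y \<in> S) \<and> (\<forall>c. \<forall>x\<in>S. c *s x \<in> S)"

lemma csubspace_subspace:
  assumes "csubspace S" shows "subspace S"
proof -
  have "r *\<^sub>R x \<in> S" if "x \<in> S" for r x
  proof -
    have "r *\<^sub>R x = complex_of_real r *s x"
      by (simp add: vec_eq_iff) (metis scaleR_conv_of_real)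
    then show ?thesis using that assms unfolding csubspace_def by simp
  qed
  then show ?thesis using assms by (auto simp: csubspace_def subspace_def)
qed

text \<open>The eigenvector is a maximizer of the Rayleigh quotient on the unit sphere of
  \<open>S\<close>. Invariance of \<open>S\<close> puts the residual
  \<open>A *v v - l *\<^sub>R v\<close> into \<open>S\<close>, and the first-order condition then
  says that it is orthogonal to itself.\<close>

lemma hermitian_eigenvector_in_subspace:
  fixes A :: "complex^'n::finite^'n"
  assumes A: "herm A" and S: "csubspace S" and ne: "\<exists>x\<in>S. x \<noteq> 0" and inv: "\<forall>x\<in>S. A *v x \<in> S"
  shows "\<exists>v\<in>S. v \<noteq> 0 \<and> (\<exists>l::real. A *v v = l *\<^sub>R v)"
proof -
  have sub: "subspace S" using S by (rule csubspace_subspace)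
  let ?K = "S \<inter> sphere 0 1"
  have cpt: "compact ?K"
    using closed_subspace[OF sub] by (simp add: closed_Int_compact)
  obtain x where x: "x \<in> S" "x \<noteq> 0" using ne by blast
  have "(1 / norm x) *\<^sub>R x \<in> ?K"
    using x subspace_scale[OF sub x(1)] by simp
  then have ne': "?K \<noteq> {}" by blast
  have cont: "continuous_on ?K (\<lambda>v. v \<bullet> (A *v v))"
    by (intro continuous_intros linear_continuous_on bounded_linear.linear matrix_vector_mul_bounded_linear)
  obtain v where v: "v \<in> ?K" and max: "\<forall>w\<in>?K. w \<bullet> (A *v w) \<le> v \<bullet> (A *v v)"
    using continuous_attains_sup[OF cpt ne' cont] by blast
  define l where "l = v \<bullet> (A *v v)"
  have vS: "v \<in> S" and vn: "norm v = 1" using v by auto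
  have Q: "w \<bullet> (A *v w) \<le> l * (norm w)\<^sup>2" if "w \<in> S" for w
  proof (cases "w = 0")
    case False
    let ?u = "(1 / norm w) *\<^sub>R w"
    have "?u \<in> ?K" using False that subspace_scale[OF sub that] by simp
    then have "?u \<bullet> (A *v ?u) \<le> l" using max l_def by blast
    then show ?thesis using False
      by (simp add: mult_vec_simps field_simps power2_eq_square)
  qed simp
  have sym: "x \<bullet> (A *v y) = (A *v x) \<bullet> y" for x y
    using herm_cinner[OF A, of x y] Re_cinner by metis
  have orth: "w \<bullet> (A *v v - l *\<^sub>R v) = 0" if w: "w \<in> S" for w
  proof -
    define b where "b = w \<bullet> (A *v v - l *\<^sub>R v)"
    define c where "c = l * (norm w)\<^sup>2 - w \<bullet> (A *v w)"
    have c: "c \<ge> 0" using Q[OF w] by (simp add: c_def)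
    \<comment> \<open>Maximality along the line through \<open>v\<close> in direction
      \<open>w\<close>. The left side is linear in \<open>t\<close> and the right side quadratic,
      which forces \<open>b = 0\<close>.\<close>
    have main: "2 * t * b \<le> t\<^sup>2 * c" for t
    proof -
      have "v + t *\<^sub>R w \<in> S" using vS w sub by (simp add: subspace_add subspace_scale)
      then have "(v + t *\<^sub>R w) \<bullet> (A *v (v + t *\<^sub>R w)) \<le> l * ((v + t *\<^sub>R w) \<bullet> (v + t *\<^sub>R w))"
        using Q by (simp add: power2_norm_eq_inner)
      moreover have "v \<bullet> v = 1" using vn by (simp add: norm_eq_sqrt_inner)
      moreover have "v \<bullet> (A *v w) = w \<bullet> (A *v v)" by (metis sym inner_commute)
      ultimately show ?thesis
        by (simp add: mult_vec_simps inner_simps b_def c_def power2_norm_eq_inner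
            l_def[symmetric] inner_commute[of w v] power2_eq_square[of t] algebra_simps)
    qed
    show ?thesis
    proof (rule ccontr)
      assume "w \<bullet> (A *v v - l *\<^sub>R v) \<noteq> 0"
      then have b: "b \<noteq> 0" by (simp add: b_def)
      \<comment> \<open>The step \<open>t = d * b\<close> violates the inequality as soon as
        \<open>d * c < 2\<close>; the summand 1 covers \<open>c = 0\<close>.\<close>
      define d where "d = 1 / (c + 1)"
      have d: "d > 0" "d * c < 1" using c by (auto simp: d_def)
      have "d * b\<^sup>2 * 2 \<le> d * b\<^sup>2 * (d * c)"
        using main[of "d * b"] by (simp add: power2_eq_square algebra_simps)
      then have "2 \<le> d * c" using b d by simp
      then show False using d by simp
    qed
  qed
  have "A *v v - l *\<^sub>R v \<in> S" using inv vS sub by (simp add: subspace_diff subspace_scale)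
  from orth[OF this] have "A *v v = l *\<^sub>R v" by simp
  moreover have "v \<noteq> 0" using vn by auto
  ultimately show ?thesis using vS by blast
qed

text \<open>\<open>B\<close> maps each eigenspace of \<open>A\<close> into itself, so an eigenvector
  of \<open>B\<close> can be sought inside an eigenspace of \<open>A\<close>.\<close>

lemma commuting_hermitian_joint_eigenvector:
  fixes A B :: "complex^'n::finite^'n"
  assumes A: "herm A" and B: "herm B" and AB: "A ** B = B ** A"
    and S: "csubspace S" and ne: "\<exists>x\<in>S. x \<noteq> 0"
    and invA: "\<forall>x\<in>S. A *v x \<in> S" and invB: "\<forall>x\<in>S. B *v x \<in> S"
  shows "\<exists>v\<in>S. v \<noteq> 0 \<and> (\<exists>l m::real. A *v v = l *\<^sub>R v \<and> B *v v = m *\<^sub>R v)"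
proof -
  obtain v l where v: "v \<in> S" "v \<noteq> 0" "A *v v = l *\<^sub>R v"
    using hermitian_eigenvector_in_subspace[OF A S ne invA] by blast
  let ?T = "{x\<in>S. A *v x = l *\<^sub>R x}"
  have T: "csubspace ?T"
    using S unfolding csubspace_def
    by (auto simp: mult_vec_simps scaleR_add_right vec_eq_iff algebra_simps)
  have "\<forall>x\<in>?T. B *v x \<in> ?T"
    using invB AB by (auto simp: matrix_vector_mul_assoc mult_vec_simps) (simp add: matrix_vector_mul_assoc[symmetric] mult_vec_simps)
  from hermitian_eigenvector_in_subspace[OF B T _ this] v show ?thesis by blast
qed

text \<open>The conjugated vectors \<open>u i\<close> with \<open>i\<close> in \<open>I\<close>,
  completed by zero rows, form a square matrix. Its row \<open>k\<close> is zero, so it has no right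
  inverse, hence no left inverse, hence a nontrivial kernel.\<close>

lemma nonzero_orthogonal_vector_exists:
  fixes u :: "'n::finite \<Rightarrow> complex^'n"
  assumes "k \<notin> I"
  shows "\<exists>x. x \<noteq> 0 \<and> (\<forall>i\<in>I. cinner (u i) x = 0)"
proof (rule ccontr)
  assume no: "\<not> ?thesis"
  define M :: "complex^'n^'n" where "M = (\<chi> i j. if i \<in> I then cnj (u i $ j) else 0)"
  have M: "(M *v x) $ i = (if i \<in> I then cinner (u i) x else 0)" for x i
    by (simp add: M_def matrix_vector_mult_def cinner_def)
  have "\<forall>x. M *v x = 0 \<longrightarrow> x = 0"
    using no M by (metis zero_index)
  then obtain B where "B ** M = mat 1" using matrix_left_invertible_ker[of M] by blast
  then have "M ** B = mat 1" using matrix_left_right_inverse[of B M] by blast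
  then have "(M ** B) $ k $ k = 1" by (simp add: mat_1_nth)
  then show False using assms by (simp add: mat_mult_nth M_def)
qed

text \<open>The induction runs over the index set, not over the dimension: the vectors stay indexed
  by \<open>'n\<close>, and \<open>I = UNIV\<close> delivers a square unitary. Each new vector is
  taken from the orthogonal complement of the previous ones, which both matrices leave
  invariant.\<close>

lemma joint_eigenbasis:
  fixes A B :: "complex^'n::finite^'n"
  assumes A: "herm A" and B: "herm B" and AB: "A ** B = B ** A"
  shows "\<exists>(u::'n \<Rightarrow> complex^'n) l m. (\<forall>i\<in>I. \<forall>j\<in>I. cinner (u i) (u j) = (if i = j then 1 else 0)) \<and>
     (\<forall>i\<in>I. A *v u i = (l i::real) *\<^sub>R u i \<and> B *v u i = (m i::real) *\<^sub>R u i)"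
proof -
  have "finite I" by simp
  then show ?thesis
  proof (induction I rule: finite_induct)
    case empty
    then show ?case by simp
  next
    case (insert k I)
    then obtain u l m where on: "\<forall>i\<in>I. \<forall>j\<in>I. cinner (u i) (u j) = (if i = j then 1 else 0)"
      and ev: "\<forall>i\<in>I. A *v u i = (l i::real) *\<^sub>R u i \<and> B *v u i = (m i::real) *\<^sub>R u i"
      by blast
    let ?S = "{x. \<forall>i\<in>I. cinner (u i) x = 0}"
    have S: "csubspace ?S" by (auto simp: csubspace_def cinner_simps)
    have ne: "\<exists>x\<in>?S. x \<noteq> 0" using nonzero_orthogonal_vector_exists[OF insert.hyps(2), of u] by auto
    have invA: "\<forall>x\<in>?S. A *v x \<in> ?S"
      using ev by (auto simp: herm_cinner[OF A] cinner_simps)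
    have invB: "\<forall>x\<in>?S. B *v x \<in> ?S"
      using ev by (auto simp: herm_cinner[OF B] cinner_simps)
    obtain v0 l0 m0 where v0: "v0 \<in> ?S" "v0 \<noteq> 0" "A *v v0 = l0 *\<^sub>R v0" "B *v v0 = m0 *\<^sub>R v0"
      using commuting_hermitian_joint_eigenvector[OF A B AB S ne invA invB] by blast
    define v where "v = (1 / norm v0) *\<^sub>R v0"
    have v: "\<forall>i\<in>I. cinner (u i) v = 0" "cinner v v = 1" "A *v v = l0 *\<^sub>R v" "B *v v = m0 *\<^sub>R v"
      using v0 by (auto simp: v_def cinner_simps mult_vec_simps cinner_self power2_eq_square)
    have v': "\<forall>i\<in>I. cinner v (u i) = 0" using v(1) by (metis cnj_cinner complex_cnj_zero)
    show ?case
      using on ev v v' insert.hyps(2)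
      by (intro exI[of _ "u(k := v)"] exI[of _ "l(k := l0)"] exI[of _ "m(k := m0)"]) auto
  qed
qed

definition diagonalizes :: "'n::finite cmat \<Rightarrow> ('n \<Rightarrow> real) \<Rightarrow> 'n cmat \<Rightarrow> bool" where
  "diagonalizes U l A \<longleftrightarrow> unitary U \<and> A = U ** diag_mat (\<lambda>i. complex_of_real (l i)) ** adj U"

theorem joint_spectral_theorem:
  fixes A B :: "complex^'n::finite^'n"
  assumes A: "herm A" and B: "herm B" and AB: "A ** B = B ** A"
  obtains U l m where "diagonalizes U l A" "diagonalizes U m B"
proof -
  obtain u :: "'n \<Rightarrow> complex^'n" and l m where on: "\<forall>i j. cinner (u i) (u j) = (if i = j then 1 else 0)"
    and ev: "\<forall>i. A *v u i = (l i::real) *\<^sub>R u i \<and> B *v u i = (m i::real) *\<^sub>R u i"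
    using joint_eigenbasis[OF assms, of UNIV] by auto
  define U :: "complex^'n^'n" where "U = (\<chi> i j. u j $ i)"
  have 1: "adj U ** U = mat 1"
    using on by (simp add: vec_eq_iff mat_mult_nth U_def mat_1_nth cinner_def)
  then have 2: "U ** adj U = mat 1" using matrix_left_right_inverse by blast
  have col: "(M ** U) $ i $ j = (M *v u j) $ i" for M i j
    by (simp add: mat_mult_nth matrix_vector_mult_def U_def)
  have "M = U ** diag_mat (\<lambda>i. complex_of_real (k i)) ** adj U" if "\<forall>i. M *v u i = (k i::real) *\<^sub>R u i" for M k
  proof -
    have "M ** U = U ** diag_mat (\<lambda>i. complex_of_real (k i))"
      using that by (simp add: vec_eq_iff col diag_mat_mult_right_nth)
        (simp add: U_def scaleR_conv_of_real[where 'a=complex] mult.commute)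
    then show ?thesis by (metis 2 matrix_mul_assoc matrix_mul_rid)
  qed
  then show ?thesis using that[of U l m] ev 1 2 by (simp add: diagonalizes_def unitary_def)
qed

corollary spectral_theorem:
  assumes "herm A"
  obtains U l where "diagonalizes U l A"
  using joint_spectral_theorem[OF assms assms refl] by blast

section \<open>Functional calculus\<close>

lemma unitary_simps:
  assumes "unitary U"
  shows "U ** adj U = mat 1" "adj U ** U = mat 1" "X ** U ** adj U = X" "X ** adj U ** U = X"
  using assms by (simp_all add: unitary_def matrix_mul_assoc[symmetric])

text \<open>Between the two eigenbases, \<open>X\<close> has nonzero entries only where
  \<open>a i = b j\<close>, and there the values of \<open>f\<close> agree.\<close>

lemma diagonalizes_intertwine:
  assumes A: "diagonalizes U a A" and B: "diagonalizes V b B" and AX: "A ** X = X ** B"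
  shows "(U ** diag_mat (\<lambda>i. complex_of_real (f (a i))) ** adj U) ** X
    = X ** (V ** diag_mat (\<lambda>i. complex_of_real (f (b i))) ** adj V)"
proof -
  have U: "unitary U" and V: "unitary V" using A B by (auto simp: diagonalizes_def)
  note uv = unitary_simps[OF U] unitary_simps[OF V]
  define W where "W = adj U ** X ** V"
  have "adj U ** (A ** X) ** V = adj U ** (X ** B) ** V" by (simp add: AX)
  then have "diag_mat (\<lambda>i. complex_of_real (a i)) ** W = W ** diag_mat (\<lambda>i. complex_of_real (b i))"
    using A B by (simp add: diagonalizes_def W_def matrix_mul_assoc uv)
  then have "complex_of_real (a i) * W$i$j = W$i$j * complex_of_real (b j)" for i j
    by (metis diag_mat_mult_left_nth diag_mat_mult_right_nth)
  then have "W$i$j = 0 \<or> a i = b j" for i j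
    by (metis mult.commute mult_cancel_right of_real_eq_iff)
  then have "complex_of_real (f (a i)) * W$i$j = W$i$j * complex_of_real (f (b j))" for i j
    by (metis mult.commute mult_zero_left)
  then have eq: "diag_mat (\<lambda>i. complex_of_real (f (a i))) ** W = W ** diag_mat (\<lambda>i. complex_of_real (f (b i)))"
    by (simp add: vec_eq_iff diag_mat_mult_left_nth diag_mat_mult_right_nth)
  have "U ** (diag_mat (\<lambda>i. complex_of_real (f (a i))) ** W) ** adj V =
    U ** (W ** diag_mat (\<lambda>i. complex_of_real (f (b i)))) ** adj V" by (simp add: eq)
  then show ?thesis
    by (simp add: W_def matrix_mul_assoc uv)
qed

text \<open>\<open>mfun\<close> picks some diagonalization by choice; intertwining by the identity
  shows that every diagonalization gives the same matrix.\<close>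

lemma mfun_eq:
  assumes "diagonalizes U l A"
  shows "mfun f A = U ** diag_mat (\<lambda>i. complex_of_real (f (l i))) ** adj U"
proof -
  let ?P = "\<lambda>B. \<exists>U lam. unitary U \<and> A = U ** diag_mat (\<lambda>i. complex_of_real (lam i)) ** adj U \<and>
      B = U ** diag_mat (\<lambda>i. complex_of_real (f (lam i))) ** adj U"
  have "?P (mfun f A)"
    unfolding mfun_def by (rule someI_ex) (use assms in \<open>auto simp: diagonalizes_def\<close>)
  then obtain V m where V: "diagonalizes V m A"
    and B: "mfun f A = V ** diag_mat (\<lambda>i. complex_of_real (f (m i))) ** adj V"
    by (auto simp: diagonalizes_def)
  show ?thesis
    using diagonalizes_intertwine[OF V assms, of "mat 1" f] by (simp add: B)
qed

lemma diagonalizes_mfun: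
  assumes "diagonalizes U l A" shows "diagonalizes U (\<lambda>i. f (l i)) (mfun f A)"
  using assms mfun_eq[OF assms, of f] by (simp add: diagonalizes_def)

lemma diagonalizes_herm: "diagonalizes U l A \<Longrightarrow> herm A"
  by (simp add: diagonalizes_def herm_def adj_mult adj_diag_mat matrix_mul_assoc)

lemma herm_mfun [simp]: "herm A \<Longrightarrow> herm (mfun f A)"
  by (rule spectral_theorem[of A]) (auto intro: diagonalizes_herm diagonalizes_mfun)

lemma adj_herm: "herm A \<Longrightarrow> adj A = A"
  by (simp add: herm_def)

lemma mfun_intertwine:
  assumes "herm A" "herm B" "A ** X = X ** B"
  shows "mfun f A ** X = X ** mfun f B"
proof -
  obtain U a V b where "diagonalizes U a A" "diagonalizes V b B"
    using spectral_theorem[OF assms(1)] spectral_theorem[OF assms(2)] by metis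
  with diagonalizes_intertwine[OF this assms(3), of f] show ?thesis by (simp add: mfun_eq)
qed

lemma mfun_mfun:
  assumes "herm A" shows "mfun f (mfun g A) = mfun (\<lambda>x. f (g x)) A"
proof -
  obtain U a where U: "diagonalizes U a A" using spectral_theorem[OF assms] by blast
  show ?thesis
    using mfun_eq[OF diagonalizes_mfun[OF U, of g], of f] mfun_eq[OF U, of "\<lambda>x. f (g x)"] by simp
qed

lemma mfun_ident [simp]: "herm A \<Longrightarrow> mfun (\<lambda>x. x) A = A"
  by (rule spectral_theorem[of A]) (auto simp: mfun_eq diagonalizes_def)

lemma mfun_mult:
  assumes "herm A" shows "mfun f A ** mfun g A = mfun (\<lambda>x. f x * g x) A"
proof -
  obtain U a where U: "diagonalizes U a A" using spectral_theorem[OF assms] by blast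
  then have "unitary U" by (simp add: diagonalizes_def)
  then show ?thesis unfolding mfun_eq[OF U]
    by (simp add: matrix_mul_assoc unitary_simps)
      (simp add: matrix_mul_assoc[symmetric] diag_mat_mult)
qed

lemma diag_mat_arith:
  "diag_mat c + diag_mat d = diag_mat (\<lambda>i. c i + d i)"
  "diag_mat c - diag_mat d = diag_mat (\<lambda>i. c i - d i)"
  "r *\<^sub>R diag_mat c = diag_mat (\<lambda>i. complex_of_real r * c i)"
  by (auto simp: vec_eq_iff diag_mat_nth scaleR_conv_of_real[where 'a=complex])

lemma mfun_add:
  assumes "herm A" shows "mfun (\<lambda>x. f x + g x) A = mfun f A + mfun g A"
proof -
  obtain U a where U: "diagonalizes U a A" using spectral_theorem[OF assms] by blast
  show ?thesis unfolding mfun_eq[OF U]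
    by (simp add: mat_add_distrib[symmetric] diag_mat_arith)
qed

lemma mfun_diff:
  assumes "herm A" shows "mfun (\<lambda>x. f x - g x) A = mfun f A - mfun g A"
proof -
  obtain U a where U: "diagonalizes U a A" using spectral_theorem[OF assms] by blast
  show ?thesis unfolding mfun_eq[OF U]
    by (simp add: mat_diff_distrib[symmetric] diag_mat_arith)
qed

lemma mfun_scaleR:
  assumes "herm A" shows "mfun (\<lambda>x. r * f x) A = r *\<^sub>R mfun f A"
proof -
  obtain U a where U: "diagonalizes U a A" using spectral_theorem[OF assms] by blast
  have "r *\<^sub>R (U ** D ** adj U) = U ** (r *\<^sub>R D) ** adj U" for D
    by (simp add: mat_scaleR_mult)
  then show ?thesis unfolding mfun_eq[OF U] by (simp add: diag_mat_arith)
qed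

lemma mfun_const:
  fixes A :: "complex^'a::finite^'a"
  assumes "herm A" shows "mfun (\<lambda>x. c) A = c *\<^sub>R mat 1"
proof -
  obtain U a where U: "diagonalizes U a A" using spectral_theorem[OF assms] by blast
  then have u: "unitary U" by (simp add: diagonalizes_def)
  have "diag_mat (\<lambda>i. complex_of_real c) = c *\<^sub>R (mat 1 :: complex^'a^'a)"
    by (simp add: diag_mat_one[symmetric] diag_mat_arith)
  then show ?thesis
    using mfun_eq[OF U, of "\<lambda>_. c"] by (simp only:) (simp add: mat_scaleR_mult unitary_simps[OF u])
qed

lemma mfun_cong:
  assumes "diagonalizes U l A" "\<And>i. f (l i) = g (l i)"
  shows "mfun f A = mfun g A"
  unfolding mfun_eq[OF assms(1)] using assms(2) by simp

lemma trace_mfun: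
  assumes "diagonalizes U l A" shows "trace (mfun f A) = complex_of_real (\<Sum>i\<in>UNIV. f (l i))"
proof -
  have "trace (mfun f A) = trace (adj U ** (U ** diag_mat (\<lambda>i. complex_of_real (f (l i)))))"
    unfolding mfun_eq[OF assms] by (rule trace_cyc)
  also have "\<dots> = trace (diag_mat (\<lambda>i. complex_of_real (f (l i))))"
    using assms by (simp add: diagonalizes_def matrix_mul_assoc unitary_simps)
  finally show ?thesis by (simp add: trace_diag_mat)
qed

lemma norm_mfun:
  assumes "diagonalizes U l A" shows "(norm (mfun f A))\<^sup>2 = (\<Sum>i\<in>UNIV. (f (l i))\<^sup>2)"
proof -
  have h: "herm A" using assms by (rule diagonalizes_herm)
  have "complex_of_real ((norm (mfun f A))\<^sup>2) = trace (mfun f A ** adj (mfun f A))"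
    by (simp add: trace_mult_adj_norm)
  also have "\<dots> = trace (mfun (\<lambda>x. (f x)\<^sup>2) A)"
    by (simp add: adj_herm h mfun_mult power2_eq_square)
  also have "\<dots> = complex_of_real (\<Sum>i\<in>UNIV. (f (l i))\<^sup>2)"
    by (rule trace_mfun[OF assms])
  finally show ?thesis by (simp only: of_real_eq_iff)
qed

text \<open>Each matrix is expanded in its own eigenbasis. The weights are nonnegative and do not
  depend on \<open>f\<close> and \<open>g\<close>, so inequalities under the trace reduce to scalar
  inequalities at pairs of eigenvalues, even if \<open>A\<close> and \<open>B\<close> do not
  commute.\<close>

lemma klein_expansion:
  assumes A: "diagonalizes U a A" and B: "diagonalizes V b B"
  shows "trace (mfun f A ** X ** mfun g B ** adj X)
    = complex_of_real (\<Sum>i\<in>UNIV. \<Sum>j\<in>UNIV. (cmod ((adj U ** X ** V) $ i $ j))\<^sup>2 * (f (a i) * g (b j)))"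
proof -
  define W where "W = adj U ** X ** V"
  let ?f = "diag_mat (\<lambda>i. complex_of_real (f (a i)))" and ?g = "diag_mat (\<lambda>i. complex_of_real (g (b i)))"
  have "mfun f A ** X ** mfun g B ** adj X = U ** (?f ** adj U ** X ** (V ** ?g ** adj V) ** adj X)"
    by (simp add: mfun_eq[OF A] mfun_eq[OF B] matrix_mul_assoc)
  then have "trace (mfun f A ** X ** mfun g B ** adj X) = trace ((?f ** adj U ** X ** (V ** ?g ** adj V) ** adj X) ** U)"
    by (metis trace_cyc)
  also have "\<dots> = trace ((?f ** W) ** (?g ** adj W))"
    by (simp add: W_def adj_mult matrix_mul_assoc)
  also have "\<dots> = (\<Sum>i\<in>UNIV. \<Sum>j\<in>UNIV. of_real (f (a i)) * W$i$j * (of_real (g (b j)) * cnj (W$i$j)))"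
    by (simp add: trace_def mat_mult_nth[of "?f ** W"] diag_mat_mult_left_nth)
  also have "\<dots> = (\<Sum>i\<in>UNIV. \<Sum>j\<in>UNIV. (W$i$j * cnj (W$i$j)) * of_real (f (a i) * g (b j)))"
    by (simp add: mult_ac)
  finally show ?thesis
    by (simp add: W_def complex_norm_square[symmetric])
qed

section \<open>Positive matrices\<close>

lemma herm_simps:
  "herm A \<Longrightarrow> herm B \<Longrightarrow> herm (A + B)"
  "herm A \<Longrightarrow> herm B \<Longrightarrow> herm (A - B)"
  "herm A \<Longrightarrow> herm (r *\<^sub>R A)"
  "herm (mat 1)" "herm 0" "herm (adj X ** X)" "herm (X ** adj X)"
  "herm A \<Longrightarrow> herm (adj X ** A ** X)" "herm A \<Longrightarrow> herm (X ** A ** adj X)"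
  by (simp_all add: herm_def adj_add adj_diff adj_scaleR adj_mult matrix_mul_assoc)

lemma herm_if_real_form:
  assumes "\<And>v. Im (cinner v (A *v v)) = 0"
  shows "herm A"
proof -
  have "cinner v ((adj A - A) *v v) = 0" for v
  proof -
    have "cinner v (adj A *v v) = cnj (cinner v (A *v v))"
      by (simp add: cinner_mult_right cnj_cinner)
    also have "\<dots> = cinner v (A *v v)" using assms[of v] by (simp add: complex_eq_iff)
    finally show ?thesis by (simp add: mult_vec_simps cinner_simps)
  qed
  then have "adj A - A = 0" by (rule quadratic_form_eq_0)
  then show ?thesis by (simp add: herm_def)
qed

lemma psd_herm: "psd A \<Longrightarrow> herm A"
  by (rule herm_if_real_form) (simp add: psd_def nonneg_c_def)

lemma pos_def_psd: "pos_def A \<Longrightarrow> psd A"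
  unfolding pos_def_def psd_def nonneg_c_def
  by (metis cinner_zero_left less_eq_real_def zero_complex.simps)

lemma pos_def_herm: "pos_def A \<Longrightarrow> herm A"
  by (simp add: psd_herm pos_def_psd)

lemma psd_iff: "herm A \<Longrightarrow> psd A \<longleftrightarrow> (\<forall>v. 0 \<le> Re (cinner v (A *v v)))"
  unfolding psd_def nonneg_c_def
  by (metis cnj_cinner complex_cnj_cancel_iff herm_cinner cnj.simps(2) equal_neg_zero)

lemma cinner_diagonalizes:
  assumes "diagonalizes U l A"
  shows "cinner v (A *v v) = complex_of_real (\<Sum>i\<in>UNIV. l i * (cmod ((adj U *v v) $ i))\<^sup>2)"
proof -
  define w where "w = adj U *v v"
  have dw: "(diag_mat (\<lambda>i. complex_of_real (l i)) *v w) $ i = complex_of_real (l i) * w $ i" for i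
  proof -
    have "(diag_mat (\<lambda>i. complex_of_real (l i)) *v w) $ i = (\<Sum>j\<in>UNIV. if j = i then complex_of_real (l i) * w $ i else 0)"
      unfolding matrix_vector_mult_def vec_lambda_beta by (rule sum.cong) (auto simp: diag_mat_nth)
    then show ?thesis by simp
  qed
  have "A *v v = U *v (diag_mat (\<lambda>i. complex_of_real (l i)) *v w)"
    using assms by (simp add: diagonalizes_def w_def matrix_vector_mul_assoc matrix_mul_assoc)
  then have "cinner v (A *v v) = cinner w (diag_mat (\<lambda>i. complex_of_real (l i)) *v w)"
    by (simp add: cinner_mult_right[of v U] w_def)
  also have "\<dots> = (\<Sum>i\<in>UNIV. complex_of_real (l i) * (w $ i * cnj (w $ i)))"
    unfolding cinner_def dw by (simp add: mult_ac)
  also have "\<dots> = complex_of_real (\<Sum>i\<in>UNIV. l i * (cmod (w $ i))\<^sup>2)"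
    by (simp add: complex_norm_square[symmetric])
  finally show ?thesis by (simp add: w_def)
qed

lemma unitary_axis_eigenvector:
  assumes "unitary U"
  shows "adj U *v (U *v axis i 1) = axis i 1" "U *v axis i 1 \<noteq> 0"
proof -
  show 1: "adj U *v (U *v axis i 1) = axis i 1"
    by (simp add: matrix_vector_mul_assoc unitary_simps[OF assms])
  show "U *v axis i 1 \<noteq> 0"
    using 1 by (metis axis_eq_0_iff matrix_vector_mult_0_right zero_neq_one)
qed

lemma eigenvalue_eq_form:
  assumes d: "diagonalizes U l A"
  shows "cinner (U *v axis i 1) (A *v (U *v axis i 1)) = complex_of_real (l i)"
proof -
  have u: "unitary U" using d by (simp add: diagonalizes_def)
  have "(\<Sum>j\<in>UNIV. l j * (cmod (axis i 1 $ j))\<^sup>2) = (\<Sum>j\<in>UNIV. if j = i then l i else 0)"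
    by (rule sum.cong) (auto simp: axis_def)
  then show ?thesis
    by (simp add: cinner_diagonalizes[OF d] unitary_axis_eigenvector[OF u] del: of_real_sum)
qed

lemma psd_diagonalizes:
  assumes d: "diagonalizes U l A"
  shows "psd A \<longleftrightarrow> (\<forall>i. 0 \<le> l i)"
proof -
  have u: "unitary U" using d by (simp add: diagonalizes_def)
  note ax = eigenvalue_eq_form[OF d]
  show ?thesis
  proof
    assume "psd A"
    then have "nonneg_c (complex_of_real (l i))" for i using ax unfolding psd_def by metis
    then show "\<forall>i. 0 \<le> l i" by (simp add: nonneg_c_def)
  next
    assume "\<forall>i. 0 \<le> l i"
    then show "psd A"
      unfolding psd_def cinner_diagonalizes[OF d] nonneg_c_def by (simp add: sum_nonneg)
  qed
qed

lemma pos_def_diagonalizes: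
  assumes d: "diagonalizes U l A"
  shows "pos_def A \<longleftrightarrow> (\<forall>i. 0 < l i)"
proof -
  have u: "unitary U" using d by (simp add: diagonalizes_def)
  note ax = eigenvalue_eq_form[OF d]
  show ?thesis
  proof
    assume "pos_def A"
    then have "0 < Re (complex_of_real (l i))" for i
      using ax unitary_axis_eigenvector(2)[OF u] unfolding pos_def_def by metis
    then show "\<forall>i. 0 < l i" by simp
  next
    assume l: "\<forall>i. 0 < l i"
    have "0 < (\<Sum>i\<in>UNIV. l i * (cmod ((adj U *v v) $ i))\<^sup>2)" if "v \<noteq> 0" for v
    proof -
      have "adj U *v v \<noteq> 0" using that unitary_simps(1)[OF u]
        by (metis matrix_vector_mul_assoc matrix_vector_mul_lid matrix_vector_mult_0_right)
      then obtain i where "(adj U *v v) $ i \<noteq> 0" by (auto simp: vec_eq_iff)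
      then show ?thesis using l by (intro sum_pos2[of _ i]) (auto simp: less_imp_le)
    qed
    then show "pos_def A"
      unfolding pos_def_def cinner_diagonalizes[OF d] by simp
  qed
qed

lemma psd_add: "psd A \<Longrightarrow> psd B \<Longrightarrow> psd (A + B)"
  by (simp add: psd_def nonneg_c_def mult_vec_simps cinner_simps)

lemma psd_scaleR: "psd A \<Longrightarrow> 0 \<le> r \<Longrightarrow> psd (r *\<^sub>R A)"
  by (simp add: psd_def nonneg_c_def mult_vec_simps cinner_simps)

lemma psd_one: "psd (mat 1)"
  by (simp add: psd_def nonneg_c_def cinner_self)

lemma psd_conj: "psd A \<Longrightarrow> psd (adj X ** A ** X)"
  unfolding psd_def
  by (simp add: matrix_vector_mul_assoc[symmetric] cinner_mult_right[of _ "adj X"])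

lemma psd_conj': "psd A \<Longrightarrow> psd (X ** A ** adj X)"
  using psd_conj[of A "adj X"] by simp

lemma psd_adj_mult: "psd (adj X ** X)"
  using psd_conj[OF psd_one, of X] by simp

lemma psd_mult_adj: "psd (X ** adj X)"
  using psd_conj'[OF psd_one, of X] by simp

lemma pos_def_conj:
  assumes "pos_def A" "invertible X"
  shows "pos_def (adj X ** A ** X)"
proof -
  have "X *v v \<noteq> 0" if "v \<noteq> 0" for v
    using that assms(2) by (metis invertible_def matrix_vector_mul_assoc matrix_vector_mul_lid matrix_vector_mult_0_right)
  then show ?thesis using assms(1) unfolding pos_def_def
    by (simp add: matrix_vector_mul_assoc[symmetric] cinner_mult_right[of _ "adj X"])
qed

lemma diagonalizes_shift:
  assumes "diagonalizes U l A"
  shows "diagonalizes U (\<lambda>i. l i - m) (A - m *\<^sub>R mat 1)" "diagonalizes U (\<lambda>i. m - l i) (m *\<^sub>R mat 1 - A)"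
proof -
  have h: "herm A" using assms by (rule diagonalizes_herm)
  have "mfun (\<lambda>x. x - m) A = A - m *\<^sub>R mat 1" "mfun (\<lambda>x. m - x) A = m *\<^sub>R mat 1 - A"
    using h by (simp_all add: mfun_diff mfun_const)
  then show "diagonalizes U (\<lambda>i. l i - m) (A - m *\<^sub>R mat 1)" "diagonalizes U (\<lambda>i. m - l i) (m *\<^sub>R mat 1 - A)"
    using diagonalizes_mfun[OF assms, of "\<lambda>x. x - m"] diagonalizes_mfun[OF assms, of "\<lambda>x. m - x"] by simp_all
qed

lemma psd_lower_bound: "diagonalizes U l A \<Longrightarrow> psd (A - m *\<^sub>R mat 1) \<longleftrightarrow> (\<forall>i. m \<le> l i)"
  using psd_diagonalizes[OF diagonalizes_shift(1)] by simp

lemma psd_upper_bound: "diagonalizes U l A \<Longrightarrow> psd (m *\<^sub>R mat 1 - A) \<longleftrightarrow> (\<forall>i. l i \<le> m)"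
  using psd_diagonalizes[OF diagonalizes_shift(2)] by simp

lemma pos_def_lower_bound:
  assumes "pos_def A" obtains c where "c > 0" "psd (A - c *\<^sub>R mat 1)"
proof -
  obtain U l where d: "diagonalizes U l A" using spectral_theorem[OF pos_def_herm[OF assms]] by blast
  have pos: "\<forall>i. 0 < l i" using assms pos_def_diagonalizes[OF d] by simp
  define c where "c = Min (range l)"
  have "c \<in> range l" unfolding c_def by (rule Min_in) auto
  then have "c > 0" using pos by auto
  moreover have "\<forall>i. c \<le> l i" by (simp add: c_def)
  ultimately show ?thesis using that psd_lower_bound[OF d] by blast
qed

lemma herm_upper_bound:
  assumes "herm A" obtains c where "c > 0" "psd (c *\<^sub>R mat 1 - A)"
proof -
  obtain U l where d: "diagonalizes U l A" using spectral_theorem[OF assms] by blast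
  define c where "c = max 1 (Max (range l))"
  have "\<forall>i. l i \<le> c" by (auto simp: c_def le_max_iff_disj)
  moreover have "c > 0" by (simp add: c_def)
  ultimately show ?thesis using that psd_upper_bound[OF d] by blast
qed

lemma klein_expansion_one:
  assumes A: "diagonalizes U a A" and B: "diagonalizes V b B"
  shows "trace (mfun f A ** mfun g B)
    = complex_of_real (\<Sum>i\<in>UNIV. \<Sum>j\<in>UNIV. (cmod ((adj U ** V) $ i $ j))\<^sup>2 * (f (a i) * g (b j)))"
  using klein_expansion[OF assms, of f "mat 1" g] by simp

text \<open>The case \<open>X = mat 1\<close>. Taking one of the two functions constant writes the
  trace of a single matrix with the same weights, so that mixed and single traces can be compared
  term by term.\<close>

lemma klein_weights:
  assumes U: "diagonalizes U a A" and V: "diagonalizes V b B"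
  obtains w where "\<And>i j. w i j \<ge> 0"
    "\<And>f g. Re (trace (mfun f A ** mfun g B)) = (\<Sum>i\<in>UNIV. \<Sum>j\<in>UNIV. w i j * (f (a i) * g (b j)))"
    "\<And>f. Re (trace (mfun f A)) = (\<Sum>i\<in>UNIV. \<Sum>j\<in>UNIV. w i j * f (a i))"
    "\<And>f. Re (trace (mfun f B)) = (\<Sum>i\<in>UNIV. \<Sum>j\<in>UNIV. w i j * f (b j))"
proof -
  have hA: "herm A" and hB: "herm B" using U V by (auto intro: diagonalizes_herm)
  define w where "w i j = (cmod ((adj U ** V) $ i $ j))\<^sup>2" for i j
  have K: "Re (trace (mfun f A ** mfun g B)) = (\<Sum>i\<in>UNIV. \<Sum>j\<in>UNIV. w i j * (f (a i) * g (b j)))" for f g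
    using klein_expansion_one[OF U V, of f g] by (simp add: w_def)
  show ?thesis
  proof (rule that[of w])
    show "w i j \<ge> 0" for i j by (simp add: w_def)
    show "Re (trace (mfun f A)) = (\<Sum>i\<in>UNIV. \<Sum>j\<in>UNIV. w i j * f (a i))" for f
      using K[of f "\<lambda>_. 1"] hB by (simp add: mfun_const)
    show "Re (trace (mfun f B)) = (\<Sum>i\<in>UNIV. \<Sum>j\<in>UNIV. w i j * f (b j))" for f
      using K[of "\<lambda>_. 1" f] hA by (simp add: mfun_const)
  qed (rule K)
qed

lemma trace_psd_mult:
  assumes "psd A" "psd B"
  shows "0 \<le> Re (trace (A ** B))" "Im (trace (A ** B)) = 0"
proof -
  obtain U a where U: "diagonalizes U a A" using spectral_theorem[OF psd_herm[OF assms(1)]] by blast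
  obtain V b where V: "diagonalizes V b B" using spectral_theorem[OF psd_herm[OF assms(2)]] by blast
  have "a i \<ge> 0" "b i \<ge> 0" for i using assms psd_diagonalizes[OF U] psd_diagonalizes[OF V] by auto
  moreover have "trace (A ** B) = complex_of_real (\<Sum>i\<in>UNIV. \<Sum>j\<in>UNIV. (cmod ((adj U ** V) $ i $ j))\<^sup>2 * (a i * b j))"
    using klein_expansion_one[OF U V, of "\<lambda>x. x" "\<lambda>x. x"] assms by (simp add: psd_herm)
  ultimately show "0 \<le> Re (trace (A ** B))" "Im (trace (A ** B)) = 0"
    by (simp_all add: sum_nonneg)
qed

lemma Im_trace_herm_mult:
  assumes "herm A" "herm B" shows "Im (trace (A ** B)) = 0"
proof -
  have "cnj (trace (A ** B)) = trace (A ** B)"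
    using assms by (metis adj_mult herm_def trace_adj trace_cyc)
  then show ?thesis by (simp add: complex_eq_iff)
qed

lemma trace_mult_mono:
  assumes "psd A" "psd (C - B)"
  shows "Re (trace (A ** B)) \<le> Re (trace (A ** C))"
  using trace_psd_mult(1)[OF assms] by (simp add: mat_simps trace_sub)

lemma trace_mult_mono':
  assumes "psd A" "psd (C - B)"
  shows "Re (trace (B ** A)) \<le> Re (trace (C ** A))"
  using trace_mult_mono[OF assms] by (simp add: trace_cyc)

lemma trace_psd_nonneg: "psd A \<Longrightarrow> 0 \<le> Re (trace A)"
  using trace_psd_mult(1)[OF psd_one, of A] by simp

lemma psd_trace_0:
  assumes "psd A" "Re (trace A) \<le> 0" shows "A = 0"
proof -
  obtain U a where U: "diagonalizes U a A" using spectral_theorem[OF psd_herm[OF assms(1)]] by blast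
  have nn: "a i \<ge> 0" for i using assms psd_diagonalizes[OF U] by auto
  have "trace A = complex_of_real (\<Sum>i\<in>UNIV. a i)"
    using trace_mfun[OF U, of "\<lambda>x. x"] psd_herm[OF assms(1)] by simp
  then have "(\<Sum>i\<in>UNIV. a i) \<le> 0" using assms by simp
  then have "(\<Sum>i\<in>UNIV. a i) = 0" using nn by (simp add: sum_nonneg antisym)
  then have "a i = 0" for i using nn sum_nonneg_eq_0_iff[of UNIV a] by simp
  then have "mfun (\<lambda>x. x) A = mfun (\<lambda>x. 0) A" by (intro mfun_cong[OF U]) simp
  then show ?thesis using psd_herm[OF assms(1)] by (simp add: mfun_const)
qed

text \<open>Faithfulness of a full-rank state: \<open>R\<close> dominates a positive multiple of the
  identity.\<close>

lemma pos_def_trace_mult_0: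
  assumes "pos_def R" "psd A" "Re (trace (R ** A)) \<le> 0" shows "A = 0"
proof -
  obtain c where c: "c > 0" "psd (R - c *\<^sub>R mat 1)" using pos_def_lower_bound[OF assms(1)] .
  have "c * Re (trace A) \<le> Re (trace (R ** A))"
    using trace_mult_mono'[OF assms(2) c(2)] by (simp add: mat_scaleR_mult trace_scaleR)
  then have "Re (trace A) \<le> 0" using assms(3) c(1) by (smt (verit) mult_pos_pos)
  then show ?thesis using psd_trace_0 assms(2) by blast
qed

lemma pos_def_one: "pos_def (mat 1)"
  by (simp add: pos_def_def cinner_self)

lemma pos_def_add_psd: "pos_def A \<Longrightarrow> psd B \<Longrightarrow> pos_def (A + B)"
  unfolding pos_def_def psd_def nonneg_c_def
  by (simp add: mult_vec_simps cinner_simps add_pos_nonneg)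

lemma pos_def_scaleR: "pos_def A \<Longrightarrow> 0 < r \<Longrightarrow> pos_def (r *\<^sub>R A)"
  by (simp add: pos_def_def mult_vec_simps cinner_simps)

lemma pos_def_invertible:
  assumes "pos_def A" shows "invertible A"
proof -
  have "\<forall>x. A *v x = 0 \<longrightarrow> x = 0" using assms unfolding pos_def_def
    by (metis cinner_zero_right less_irrefl zero_complex.simps(1))
  then obtain B where "B ** A = mat 1" using matrix_left_invertible_ker[of A] by blast
  then show ?thesis using invertible_def matrix_left_right_inverse by blast
qed

lemma pos_def_mfun:
  assumes "pos_def A" "\<And>x. x > 0 \<Longrightarrow> f x > 0" shows "pos_def (mfun f A)"
proof -
  obtain U a where U: "diagonalizes U a A" using spectral_theorem[OF pos_def_herm[OF assms(1)]] by blast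
  then show ?thesis
    using pos_def_diagonalizes[OF U] pos_def_diagonalizes[OF diagonalizes_mfun[OF U, of f]] assms by simp
qed

lemma mfun_cong_pos_def:
  assumes "pos_def A" "\<And>x. x > 0 \<Longrightarrow> f x = g x" shows "mfun f A = mfun g A"
proof -
  obtain U a where U: "diagonalizes U a A" using spectral_theorem[OF pos_def_herm[OF assms(1)]] by blast
  then show ?thesis using pos_def_diagonalizes[OF U] assms by (intro mfun_cong[OF U]) simp
qed

lemma mfun_cong_psd:
  assumes "psd A" "\<And>x. x \<ge> 0 \<Longrightarrow> f x = g x" shows "mfun f A = mfun g A"
proof -
  obtain U a where U: "diagonalizes U a A" using spectral_theorem[OF psd_herm[OF assms(1)]] by blast
  then show ?thesis using psd_diagonalizes[OF U] assms by (intro mfun_cong[OF U]) simp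
qed

lemma psd_mfun:
  assumes "psd A" "\<And>x. x \<ge> 0 \<Longrightarrow> f x \<ge> 0" shows "psd (mfun f A)"
proof -
  obtain U a where U: "diagonalizes U a A" using spectral_theorem[OF psd_herm[OF assms(1)]] by blast
  then show ?thesis
    using psd_diagonalizes[OF U] psd_diagonalizes[OF diagonalizes_mfun[OF U, of f]] assms by simp
qed

section \<open>Trace inequalities\<close>

text \<open>Young's inequality for \<open>x = b / a\<close>, multiplied by
  \<open>u * a powr u\<close>. At \<open>a = 0\<close> the left side is 0, because
  \<open>0 powr r = 0\<close> for every \<open>r\<close>.\<close>

lemma powr_convex_tangent:
  fixes a b u :: real
  assumes "u \<ge> 1" "a \<ge> 0" "b \<ge> 0"
  shows "a powr u + u * a powr (u - 1) * (b - a) \<le> b powr u"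
proof (cases "a = 0")
  case False
  then have a: "a > 0" using assms by simp
  define x where "x = b / a"
  have x: "x \<ge> 0" using assms a by (simp add: x_def)
  have "x \<le> (1/u) * x powr u + (1 - 1/u)"
  proof (cases "x = 0")
    case False
    then have "(x powr u) powr (1/u) * 1 powr (1 - 1/u) \<le> (1/u) * x powr u + (1 - 1/u) * 1"
      using assms by (intro Youngs_inequality_0) auto
    then show ?thesis using assms x by (simp add: powr_powr)
  qed (use assms in simp)
  then have "u * x \<le> u * ((1/u) * x powr u + (1 - 1/u))" using assms by (intro mult_left_mono) auto
  also have "\<dots> = x powr u + u - 1" using assms by (simp add: algebra_simps)
  finally have "u * x \<le> x powr u + u - 1" .
  then have "a powr u * (u * x) \<le> a powr u * (x powr u + u - 1)" by (rule mult_left_mono) simp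
  moreover have "a powr u * x powr u = b powr u" using a assms by (simp add: x_def powr_divide)
  moreover have "b = a * x" using a by (simp add: x_def)
  moreover have "a powr u = a powr (u - 1) * a" using a by (simp add: powr_diff)
  ultimately show ?thesis by (simp add: algebra_simps)
qed (use assms in simp)

lemma powr_concave_tangent:
  fixes a b u :: real
  assumes "0 < u" "u \<le> 1" "a \<ge> 0" "b > 0"
  shows "a powr u \<le> b powr u + u * b powr (u - 1) * (a - b)"
proof -
  define x where "x = a / b"
  have x: "x \<ge> 0" using assms by (simp add: x_def)
  have "x powr u * 1 powr (1 - u) \<le> u * x + (1 - u) * 1"
  proof (cases "x = 0")
    case False
    then show ?thesis using assms x by (intro Youngs_inequality_0) auto
  qed (use assms in simp)
  then have "b powr u * x powr u \<le> b powr u * (u * x + (1 - u))" by (intro mult_left_mono) auto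
  moreover have "b powr u * x powr u = a powr u" using assms by (simp add: x_def powr_divide)
  moreover have "a = b * x" using assms by (simp add: x_def)
  moreover have "b powr u = b powr (u - 1) * b" using assms by (simp add: powr_diff)
  ultimately show ?thesis by (simp add: algebra_simps)
qed

text \<open>Powers with \<open>u > 1\<close> are not operator monotone, but their traces are
  monotone. A tangent slope evaluated at one of the matrices is positive and is paired with the
  positive difference \<open>B - A\<close>; convexity (slope at \<open>A\<close>) or concavity
  (slope at \<open>B\<close>) bounds this pairing by the difference of the traces.\<close>

lemma trace_powr_mono:
  assumes A: "psd A" and AB: "psd (B - A)" and u: "u > 0"
  shows "Re (trace (mfun (\<lambda>x. x powr u) A)) \<le> Re (trace (mfun (\<lambda>x. x powr u) B))"
proof -
  have B: "psd B" using psd_add[OF A AB] by simp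
  have hA: "herm A" and hB: "herm B" using A B by (simp_all add: psd_herm)
  obtain U a where U: "diagonalizes U a A" using spectral_theorem[OF hA] by blast
  obtain V b where V: "diagonalizes V b B" using spectral_theorem[OF hB] by blast
  have nn: "a i \<ge> 0" "b i \<ge> 0" for i using A B psd_diagonalizes[OF U] psd_diagonalizes[OF V] by auto
  obtain w where w: "\<And>i j. w i j \<ge> 0"
    and K: "\<And>f g. Re (trace (mfun f A ** mfun g B)) = (\<Sum>i\<in>UNIV. \<Sum>j\<in>UNIV. w i j * (f (a i) * g (b j)))"
    and KA: "\<And>f. Re (trace (mfun f A)) = (\<Sum>i\<in>UNIV. \<Sum>j\<in>UNIV. w i j * f (a i))"
    and KB: "\<And>f. Re (trace (mfun f B)) = (\<Sum>i\<in>UNIV. \<Sum>j\<in>UNIV. w i j * f (b j))"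
    using klein_weights[OF U V] by blast
  let ?p = "\<lambda>x. x powr u"
  show ?thesis
  proof (cases "u \<ge> 1")
    case True
    define g where "g x = u * x powr (u - 1)" for x
    have "0 \<le> Re (trace (mfun g A ** (B - A)))"
      using True by (intro trace_psd_mult(1)[OF _ AB] psd_mfun[OF A]) (simp add: g_def)
    also have "\<dots> = Re (trace (mfun g A ** B)) - Re (trace (mfun g A ** A))"
      by (simp add: mat_simps trace_sub)
    also have "Re (trace (mfun g A ** A)) = Re (trace (mfun (\<lambda>x. g x * x) A))"
      using mfun_mult[OF hA, of g "\<lambda>x. x"] hA by simp
    also have "Re (trace (mfun g A ** B)) - \<dots> = (\<Sum>i\<in>UNIV. \<Sum>j\<in>UNIV. w i j * (g (a i) * (b j - a i)))"
      using K[of g "\<lambda>x. x"] hB KA[of "\<lambda>x. g x * x"] by (simp add: sum_subtractf algebra_simps)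
    also have "\<dots> \<le> (\<Sum>i\<in>UNIV. \<Sum>j\<in>UNIV. w i j * (b j powr u - a i powr u))"
    proof (intro sum_mono mult_left_mono w)
      fix i j
      show "g (a i) * (b j - a i) \<le> b j powr u - a i powr u"
        using powr_convex_tangent[OF True nn(1)[of i] nn(2)[of j]] by (simp add: g_def)
    qed
    also have "\<dots> = Re (trace (mfun ?p B)) - Re (trace (mfun ?p A))"
      by (simp add: KA KB sum_subtractf algebra_simps)
    finally show ?thesis by simp
  next
    case False
    text \<open>At an eigenvalue 0 of B the slope of the power function is infinite; any slope
      that dominates the chords to the finitely many eigenvalues of A serves instead.\<close>
    define L where "L = Max (insert 0 (range (\<lambda>i. a i powr u / a i)))"
    have L: "L \<ge> 0" "a i powr u / a i \<le> L" for i unfolding L_def by (rule Max_ge; simp)+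
    define g where "g x = (if x > 0 then u * x powr (u - 1) else L)" for x
    have "0 \<le> Re (trace (mfun g B ** (B - A)))"
      using u L by (intro trace_psd_mult(1)[OF _ AB] psd_mfun[OF B]) (simp add: g_def)
    also have "\<dots> = Re (trace (mfun g B ** B)) - Re (trace (A ** mfun g B))"
      by (simp add: mat_simps trace_sub) (simp add: trace_cyc)
    also have "Re (trace (mfun g B ** B)) = Re (trace (mfun (\<lambda>x. g x * x) B))"
      using mfun_mult[OF hB, of g "\<lambda>x. x"] hB by simp
    also have "\<dots> - Re (trace (A ** mfun g B)) = (\<Sum>i\<in>UNIV. \<Sum>j\<in>UNIV. w i j * (g (b j) * (b j - a i)))"
      using K[of "\<lambda>x. x" g] hA KB[of "\<lambda>x. g x * x"] by (simp add: sum_subtractf algebra_simps)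
    also have "\<dots> \<le> (\<Sum>i\<in>UNIV. \<Sum>j\<in>UNIV. w i j * (b j powr u - a i powr u))"
    proof (intro sum_mono mult_left_mono w)
      fix i j
      show "g (b j) * (b j - a i) \<le> b j powr u - a i powr u"
      proof (cases "b j > 0")
        case True
        then show ?thesis
          using powr_concave_tangent[OF u _ nn(1)[of i] True] False by (simp add: g_def algebra_simps)
      next
        case b: False
        then have bj: "b j = 0" using nn[of j] by simp
        have "a i powr u \<le> L * a i"
          using L(2)[of i] nn(1)[of i] by (cases "a i = 0") (auto simp: field_simps)
        then show ?thesis using bj u by (simp add: g_def)
      qed
    qed
    also have "\<dots> = Re (trace (mfun ?p B)) - Re (trace (mfun ?p A))"
      by (simp add: KA KB sum_subtractf algebra_simps)
    finally show ?thesis by simp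
  qed
qed

text \<open>The Klein weights turn the remainder into a sum of scalar remainders at pairs of
  eigenvalues, and turn the squared norm of \<open>B - A\<close> into the sum of the squared
  eigenvalue differences with the same weights. No derivative of a matrix function is taken.\<close>

lemma trace_mfun_taylor:
  assumes hA: "herm A" and hB: "herm B"
    and "psd (A - m *\<^sub>R mat 1)" "psd (M *\<^sub>R mat 1 - A)" "psd (B - m *\<^sub>R mat 1)" "psd (M *\<^sub>R mat 1 - B)"
    and f: "\<And>x y. x \<in> {m..M} \<Longrightarrow> y \<in> {m..M} \<Longrightarrow> \<bar>f y - f x - f' x * (y - x)\<bar> \<le> K * (y - x)\<^sup>2"
  shows "\<bar>Re (trace (mfun f B)) - Re (trace (mfun f A)) - Re (trace (mfun f' A ** (B - A)))\<bar> \<le> K * (norm (B - A))\<^sup>2"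
proof -
  obtain U a where U: "diagonalizes U a A" using spectral_theorem[OF hA] by blast
  obtain V b where V: "diagonalizes V b B" using spectral_theorem[OF hB] by blast
  have ab: "a i \<in> {m..M}" "b i \<in> {m..M}" for i
    using assms(3-6) psd_lower_bound[OF U] psd_upper_bound[OF U] psd_lower_bound[OF V] psd_upper_bound[OF V] by auto
  obtain w where w: "\<And>i j. w i j \<ge> 0"
    and K: "\<And>f g. Re (trace (mfun f A ** mfun g B)) = (\<Sum>i\<in>UNIV. \<Sum>j\<in>UNIV. w i j * (f (a i) * g (b j)))"
    and KA: "\<And>f. Re (trace (mfun f A)) = (\<Sum>i\<in>UNIV. \<Sum>j\<in>UNIV. w i j * f (a i))"
    and KB: "\<And>f. Re (trace (mfun f B)) = (\<Sum>i\<in>UNIV. \<Sum>j\<in>UNIV. w i j * f (b j))"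
    using klein_weights[OF U V] by blast
  have "Re (trace (mfun f' A ** (B - A))) = Re (trace (mfun f' A ** B)) - Re (trace (mfun (\<lambda>x. f' x * x) A))"
    using mfun_mult[OF hA, of f' "\<lambda>x. x"] hA by (simp add: mat_simps trace_sub)
  also have "\<dots> = (\<Sum>i\<in>UNIV. \<Sum>j\<in>UNIV. w i j * (f' (a i) * (b j - a i)))"
    using K[of f' "\<lambda>x. x"] hB by (simp add: KA sum_subtractf algebra_simps)
  finally have 1: "Re (trace (mfun f B)) - Re (trace (mfun f A)) - Re (trace (mfun f' A ** (B - A)))
    = (\<Sum>i\<in>UNIV. \<Sum>j\<in>UNIV. w i j * (f (b j) - f (a i) - f' (a i) * (b j - a i)))"
    by (simp add: KA KB sum_subtractf sum.distrib algebra_simps)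
  have "complex_of_real ((norm (B - A))\<^sup>2) = trace ((B - A) ** (B - A))"
    using trace_adj_mult_norm[of "B - A"] hA hB by (simp add: adj_herm herm_simps)
  then have "(norm (B - A))\<^sup>2 = Re (trace ((B - A) ** (B - A)))" by (metis Re_complex_of_real)
  also have "\<dots> = Re (trace (B ** B)) - 2 * Re (trace (A ** B)) + Re (trace (A ** A))"
    by (simp add: mat_simps trace_sub) (simp add: trace_cyc[of B A])
  also have "\<dots> = Re (trace (mfun (\<lambda>x. x * x) B)) - 2 * Re (trace (mfun (\<lambda>x. x) A ** mfun (\<lambda>x. x) B)) + Re (trace (mfun (\<lambda>x. x * x) A))"
    using hA hB by (simp add: mfun_mult[symmetric])
  also have "\<dots> = (\<Sum>i\<in>UNIV. \<Sum>j\<in>UNIV. w i j * (b j - a i)\<^sup>2)"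
    unfolding K KA KB
    by (simp add: sum_subtractf sum.distrib algebra_simps power2_eq_square sum_distrib_left)
  finally have 2: "(norm (B - A))\<^sup>2 = (\<Sum>i\<in>UNIV. \<Sum>j\<in>UNIV. w i j * (b j - a i)\<^sup>2)" .
  have "\<bar>\<Sum>i\<in>UNIV. \<Sum>j\<in>UNIV. w i j * (f (b j) - f (a i) - f' (a i) * (b j - a i))\<bar>
     \<le> (\<Sum>i\<in>UNIV. \<Sum>j\<in>UNIV. w i j * (K * (b j - a i)\<^sup>2))"
  proof (intro order_trans[OF sum_abs] sum_mono)
    fix i j
    show "\<bar>w i j * (f (b j) - f (a i) - f' (a i) * (b j - a i))\<bar> \<le> w i j * (K * (b j - a i)\<^sup>2)"
      using f[OF ab(1)[of i] ab(2)[of j]] w by (simp add: abs_mult mult_left_mono)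
  qed
  also have "\<dots> = K * (norm (B - A))\<^sup>2"
    unfolding 2 by (simp add: sum_distrib_left algebra_simps)
  finally show ?thesis unfolding 1 .
qed

text \<open>The expansion with \<open>X = R\<close>, where \<open>R ** R\<close> is the reference
  density, combined with the scalar bound \<open>ln x \<le> x - 1\<close> at the ratio of an
  eigenvalue of \<open>A\<close> to \<open>k\<close> times an eigenvalue of \<open>Y\<close>. The
  free scale \<open>k\<close> allows \<open>A\<close> and \<open>k *\<^sub>R Y\<close> to be given
  equal weighted traces.\<close>

lemma gibbs_inequality:
  assumes Y: "pos_def Y" and A: "pos_def A" and R: "herm R" and RY: "R ** Y = Y ** R"
    and k: "k > 0"
  shows "Re (trace (R ** R ** Y ** mfun ln A)) \<le> Re (trace (R ** R ** Y ** mfun ln Y))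
    + Re (trace (R ** R ** A)) / k - Re (trace (R ** R ** Y)) + ln k * Re (trace (R ** R ** Y))"
proof -
  have hA: "herm A" and hY: "herm Y" using A Y by (simp_all add: pos_def_herm)
  obtain U y where U: "diagonalizes U y Y" using spectral_theorem[OF hY] by blast
  obtain V a where V: "diagonalizes V a A" using spectral_theorem[OF hA] by blast
  have pos: "y i > 0" "a i > 0" for i using A Y pos_def_diagonalizes[OF U] pos_def_diagonalizes[OF V] by auto
  define w where "w i j = (cmod ((adj U ** R ** V) $ i $ j))\<^sup>2" for i j
  have w: "w i j \<ge> 0" for i j by (simp add: w_def)
  have K: "Re (trace (R ** R ** mfun f Y ** mfun g A)) = (\<Sum>i\<in>UNIV. \<Sum>j\<in>UNIV. w i j * (f (y i) * g (a j)))" for f g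
  proof -
    have c: "R ** mfun f Y = mfun f Y ** R" using mfun_intertwine[OF hY hY RY[symmetric], of f] by simp
    have "trace (R ** R ** mfun f Y ** mfun g A) = trace (R ** (R ** mfun f Y ** mfun g A))"
      by (simp add: matrix_mul_assoc)
    also have "\<dots> = trace ((R ** mfun f Y ** mfun g A) ** R)" by (rule trace_cyc)
    also have "\<dots> = trace (mfun f Y ** R ** mfun g A ** adj R)" by (simp add: c adj_herm[OF R])
    finally show ?thesis using klein_expansion[OF U V, of f R g] by (simp add: w_def)
  qed
  have 1: "Re (trace (R ** R ** Y ** mfun ln A)) = (\<Sum>i\<in>UNIV. \<Sum>j\<in>UNIV. w i j * (y i * ln (a j)))"
    using K[of "\<lambda>x. x" ln] hY by simp
  have 2: "Re (trace (R ** R ** Y ** mfun ln Y)) = (\<Sum>i\<in>UNIV. \<Sum>j\<in>UNIV. w i j * (y i * ln (y i)))"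
    using K[of "\<lambda>x. x * ln x" "\<lambda>_. 1"] hY hA mfun_mult[OF hY, of "\<lambda>x. x" ln]
    by (simp add: mfun_const matrix_mul_assoc[symmetric])
  have 3: "Re (trace (R ** R ** A)) = (\<Sum>i\<in>UNIV. \<Sum>j\<in>UNIV. w i j * a j)"
    using K[of "\<lambda>_. 1" "\<lambda>x. x"] hY hA by (simp add: mfun_const)
  have 4: "Re (trace (R ** R ** Y)) = (\<Sum>i\<in>UNIV. \<Sum>j\<in>UNIV. w i j * y i)"
    using K[of "\<lambda>x. x" "\<lambda>_. 1"] hY hA by (simp add: mfun_const)
  have "y i * ln (a j) \<le> y i * ln (y i) + a j / k - y i + ln k * y i" for i j
  proof -
    have "ln (a j / (k * y i)) \<le> a j / (k * y i) - 1"
      using pos[of i] pos(2)[of j] k by (intro ln_le_minus_one) simp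
    then have "ln (a j) - ln k - ln (y i) \<le> a j / (k * y i) - 1"
      using pos[of i] pos(2)[of j] k by (simp add: ln_div ln_mult)
    then have "y i * (ln (a j) - ln k - ln (y i)) \<le> y i * (a j / (k * y i) - 1)"
      using pos[of i] by simp
    also have "\<dots> = a j / k - y i" using pos(1)[of i] k by (simp add: field_simps)
    finally show ?thesis by (simp add: algebra_simps)
  qed
  then have "(\<Sum>i\<in>UNIV. \<Sum>j\<in>UNIV. w i j * (y i * ln (a j)))
     \<le> (\<Sum>i\<in>UNIV. \<Sum>j\<in>UNIV. w i j * (y i * ln (y i) + a j / k - y i + ln k * y i))"
    by (intro sum_mono mult_left_mono w)
  also have "\<dots> = (\<Sum>i\<in>UNIV. \<Sum>j\<in>UNIV. w i j * (y i * ln (y i))) + (\<Sum>i\<in>UNIV. \<Sum>j\<in>UNIV. w i j * a j) / k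
     - (\<Sum>i\<in>UNIV. \<Sum>j\<in>UNIV. w i j * y i) + ln k * (\<Sum>i\<in>UNIV. \<Sum>j\<in>UNIV. w i j * y i)"
    by (simp add: sum.distrib sum_subtractf sum_distrib_left sum_divide_distrib algebra_simps)
  finally show ?thesis unfolding 1 2 3 4 .
qed

text \<open>The factorization \<open>f x = x * g x\<close> holds also at 0, because
  \<open>f 0 = 0\<close>. One factor \<open>W\<close> can then be moved around the trace through the
  intertwining relation for \<open>g\<close>.\<close>

lemma trace_mfun_commute:
  assumes "f 0 = 0"
  shows "trace (mfun f (adj W ** W)) = trace (mfun f (W ** adj W))"
proof -
  define g where "g x = f x / x" for x
  have f: "f = (\<lambda>x. x * g x)" using assms by (auto simp: g_def)
  have h: "herm (adj W ** W)" "herm (W ** adj W)" by (simp_all add: herm_simps)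
  have i: "mfun g (W ** adj W) ** W = W ** mfun g (adj W ** W)"
    by (rule mfun_intertwine[OF h(2,1)]) (simp add: matrix_mul_assoc)
  have "mfun f (adj W ** W) = adj W ** W ** mfun g (adj W ** W)"
    using mfun_mult[OF h(1), of "\<lambda>x. x" g] h by (simp add: f)
  then have "trace (mfun f (adj W ** W)) = trace (adj W ** (mfun g (W ** adj W) ** W))"
    by (simp add: i matrix_mul_assoc)
  also have "\<dots> = trace ((mfun g (W ** adj W) ** W) ** adj W)" by (rule trace_cyc)
  also have "\<dots> = trace (mfun g (W ** adj W) ** (W ** adj W))" by (simp add: matrix_mul_assoc)
  also have "\<dots> = trace (mfun f (W ** adj W))"
    using mfun_mult[OF h(2), of g "\<lambda>x. x"] h by (simp add: f mult.commute)
  finally show ?thesis .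
qed

section \<open>Unital completely positive maps\<close>

lemma clinear_map_simps:
  assumes "clinear_map \<Phi>"
  shows "\<Phi> (X + Y) = \<Phi> X + \<Phi> Y" "\<Phi> 0 = 0" "\<Phi> (smat c X) = smat c (\<Phi> X)"
    "\<Phi> (X - Y) = \<Phi> X - \<Phi> Y" "\<Phi> (r *\<^sub>R X) = r *\<^sub>R \<Phi> X"
proof -
  note l = assms[unfolded clinear_map_def, rule_format]
  show add: "\<Phi> (X + Y) = \<Phi> X + \<Phi> Y" for X Y using l[of 1 X Y] by simp
  show z: "\<Phi> 0 = 0" using add[of 0 0] by simp
  show s: "\<Phi> (smat c X) = smat c (\<Phi> X)" for c X using l[of c X 0] z by simp
  show "\<Phi> (X - Y) = \<Phi> X - \<Phi> Y" using add[of "X - Y" Y] by simp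
  show "\<Phi> (r *\<^sub>R X) = r *\<^sub>R \<Phi> X" using s[of "of_real r" X] by (simp add: smat_of_real)
qed

lemma clinear_map_bounded_linear: "clinear_map \<Phi> \<Longrightarrow> bounded_linear \<Phi>"
  using clinear_map_simps(1,5)[of \<Phi>] by (intro linear_conv_bounded_linear[THEN iffD1] linearI)

definition ucp :: "('n::finite cmat \<Rightarrow> 'n cmat) \<Rightarrow> bool" where
  "ucp \<Phi> \<longleftrightarrow> clinear_map \<Phi> \<and> completely_positive \<Phi> \<and> \<Phi> (mat 1) = mat 1"

lemma ucp_psd:
  assumes "ucp \<Phi>" "psd X" shows "psd (\<Phi> X)"
proof -
  have "block_psd 1 (\<lambda>i j. X)" using assms(2) by (simp add: block_psd_def psd_def)
  then have "block_psd 1 (\<lambda>i j. \<Phi> X)" using assms(1) by (simp add: ucp_def completely_positive_def)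
  then show ?thesis unfolding block_psd_def psd_def
    by (auto dest: spec[where x="\<lambda>_. v" for v])
qed

text \<open>The block matrix with rows \<open>adj X ** X\<close>, \<open>adj X\<close> and
  \<open>X\<close>, \<open>mat 1\<close> is the Gram matrix of the row \<open>X\<close>,
  \<open>mat 1\<close>, hence positive. Its image under the map yields both compatibility with
  adjoints and the Schwarz inequality.\<close>

lemma ucp_two_positive:
  assumes "ucp \<Phi>"
  shows "nonneg_c (cinner v (\<Phi> (adj X ** X) *v v) + cinner v (\<Phi> (adj X) *v w)
    + cinner w (\<Phi> X *v v) + cinner w w)"
proof -
  define B where "B i j = (if i = 0 then if j = 0 then adj X ** X else adj X else if j = 0 then X else mat 1)" for i j :: nat
  have "block_psd 2 B"
    unfolding block_psd_def
  proof
    fix v :: "nat \<Rightarrow> complex^'a"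
    have "(\<Sum>i<2. \<Sum>j<2. cinner (v i) (B i j *v v j)) = cinner (X *v v 0 + v 1) (X *v v 0 + v 1)"
      by (simp add: numeral_2_eq_2 B_def cinner_simps matrix_vector_mul_assoc[symmetric] cinner_mult_right[of _ "adj X"])
    then show "nonneg_c (\<Sum>i<2. \<Sum>j<2. cinner (v i) (B i j *v v j))"
      by (simp add: cinner_self nonneg_c_def)
  qed
  then have "block_psd 2 (\<lambda>i j. \<Phi> (B i j))" using assms by (simp add: ucp_def completely_positive_def)
  then have "nonneg_c (\<Sum>i<2. \<Sum>j<2. cinner ((\<lambda>i::nat. if i = 0 then v else w) i) (\<Phi> (B i j) *v (if j = 0 then v else w)))"
    unfolding block_psd_def by (rule spec)
  then show ?thesis using assms by (simp add: numeral_2_eq_2 B_def ucp_def algebra_simps)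
qed

lemma ucp_adj:
  assumes "ucp \<Phi>" shows "\<Phi> (adj X) = adj (\<Phi> X)"
proof -
  have real: "Im (cinner v (\<Phi> (adj X ** X) *v v)) = 0" for v
    using ucp_two_positive[OF assms, of v X 0] by (simp add: nonneg_c_def)
  have im: "Im (cinner v (\<Phi> (adj X) *v w) + cinner w (\<Phi> X *v v)) = 0" for v w
    using ucp_two_positive[OF assms, of v X w] real[of v] by (simp add: nonneg_c_def cinner_self)
  have eq: "cinner v (\<Phi> (adj X) *v w) = cinner v (adj (\<Phi> X) *v w)" for v w
  proof -
    have c: "cinner v (adj (\<Phi> X) *v w) = cnj (cinner w (\<Phi> X *v v))"
      by (simp add: cinner_mult_right cnj_cinner)
    have 1: "Im (cinner v (\<Phi> (adj X) *v w)) = - Im (cinner w (\<Phi> X *v v))" using im[of v w] by simp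
    \<comment> \<open>Replacing \<open>v\<close> by \<open>\<i> *s v\<close> exchanges real and
      imaginary parts.\<close>
    have 2: "Re (cinner v (\<Phi> (adj X) *v w)) = Re (cinner w (\<Phi> X *v v))"
      using im[of "\<i> *s v" w] by (simp add: cinner_simps mult_vec_simps)
    show ?thesis unfolding c using 1 2 by (simp add: complex_eq_iff)
  qed
  have "(\<Phi> (adj X) - adj (\<Phi> X)) *v w = 0" for w
    by (rule cinner_left_eq_0) (simp add: mult_vec_simps cinner_simps eq)
  then have "\<Phi> (adj X) - adj (\<Phi> X) = 0" by (simp add: matrix_eq)
  then show ?thesis by simp
qed

text \<open>The two-block form at the second vector \<open>- (\<Phi> X *v v)\<close>, which
  completes the square.\<close>

lemma kadison_schwarz:
  assumes "ucp \<Phi>" shows "psd (\<Phi> (adj X ** X) - adj (\<Phi> X) ** \<Phi> X)"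
  unfolding psd_def
proof
  fix v
  have "nonneg_c (cinner v (\<Phi> (adj X ** X) *v v) + cinner v (\<Phi> (adj X) *v (- (\<Phi> X *v v)))
    + cinner (- (\<Phi> X *v v)) (\<Phi> X *v v) + cinner (- (\<Phi> X *v v)) (- (\<Phi> X *v v)))"
    by (rule ucp_two_positive[OF assms])
  then show "nonneg_c (cinner v ((\<Phi> (adj X ** X) - adj (\<Phi> X) ** \<Phi> X) *v v))"
    by (simp add: mult_vec_simps cinner_simps ucp_adj[OF assms] matrix_vector_mul_assoc)
qed

lemma bounded_bilinear_mat_mult: "bounded_bilinear ((**) :: complex^'n^'n \<Rightarrow> complex^'n^'n \<Rightarrow> complex^'n^'n)"
  unfolding bilinear_conv_bounded_bilinear[symmetric] bilinear_def
  by (auto intro!: linearI simp: mat_simps)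

lemma bounded_linear_adj: "bounded_linear (adj :: complex^'n::finite^'n \<Rightarrow> _)"
  unfolding linear_conv_bounded_linear[symmetric] by (auto intro!: linearI simp: adj_add adj_scaleR)

lemma trace_zero [simp]: "trace (0::complex^'n^'n) = 0"
  by (simp add: trace_def)

lemma bounded_linear_trace: "bounded_linear (trace :: complex^'n::finite^'n \<Rightarrow> complex)"
  unfolding linear_conv_bounded_linear[symmetric]
  by (auto intro!: linearI simp: trace_add trace_scaleR scaleR_conv_of_real[where 'a=complex])

lemma bounded_linear_quadratic_form: "bounded_linear (\<lambda>X::complex^'n::finite^'n. cinner v (X *v w))"
  unfolding linear_conv_bounded_linear[symmetric]
  by (auto intro!: linearI simp: mult_vec_simps cinner_simps scaleR_conv_of_real[where 'a=complex])

lemmas tendsto_mat_mult = bounded_bilinear.tendsto[OF bounded_bilinear_mat_mult]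
lemmas tendsto_adj = bounded_linear.tendsto[OF bounded_linear_adj]
lemmas tendsto_trace = bounded_linear.tendsto[OF bounded_linear_trace]

lemma closed_nonneg_c: "closed {z. nonneg_c z}"
proof -
  have "{z. nonneg_c z} = {z. Im z = 0} \<inter> {z. 0 \<le> Re z}" by (auto simp: nonneg_c_def)
  also have "closed \<dots>"
    by (intro closed_Int closed_Collect_eq closed_Collect_le continuous_intros)
  finally show ?thesis .
qed

lemma ucp_pointwise_limit:
  assumes lim: "\<And>X. ((\<lambda>k. \<Phi> k X) \<longlongrightarrow> \<Psi> X) F" and nt: "F \<noteq> bot" and ucp: "\<And>k. ucp (\<Phi> k)"
  shows "ucp \<Psi>"
  unfolding ucp_def
proof (intro conjI)
  show "clinear_map \<Psi>"
    unfolding clinear_map_def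
  proof (intro allI)
    fix c X Y
    have lin: "clinear_map (\<Phi> k)" for k using ucp by (simp add: ucp_def)
    have b: "bounded_linear (smat c :: 'a cmat \<Rightarrow> _)"
      unfolding linear_conv_bounded_linear[symmetric]
      by (auto intro!: linearI simp: vec_eq_iff algebra_simps)
    have "((\<lambda>k. smat c (\<Phi> k X) + \<Phi> k Y) \<longlongrightarrow> smat c (\<Psi> X) + \<Psi> Y) F"
      by (intro tendsto_add bounded_linear.tendsto[OF b] lim)
    then have "((\<lambda>k. \<Phi> k (smat c X + Y)) \<longlongrightarrow> smat c (\<Psi> X) + \<Psi> Y) F"
      by (simp add: clinear_map_simps[OF lin])
    then show "\<Psi> (smat c X + Y) = smat c (\<Psi> X) + \<Psi> Y"
      using lim tendsto_unique[OF nt] by blast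
  qed
  show "completely_positive \<Psi>"
    unfolding completely_positive_def
  proof (intro allI impI)
    fix k :: nat and X :: "nat \<Rightarrow> nat \<Rightarrow> 'a cmat" assume X: "block_psd k X"
    show "block_psd k (\<lambda>i j. \<Psi> (X i j))"
      unfolding block_psd_def
    proof
      fix v :: "nat \<Rightarrow> complex^'a"
      have "((\<lambda>n. \<Sum>i<k. \<Sum>j<k. cinner (v i) (\<Phi> n (X i j) *v v j)) \<longlongrightarrow>
         (\<Sum>i<k. \<Sum>j<k. cinner (v i) (\<Psi> (X i j) *v v j))) F"
        by (intro tendsto_sum bounded_linear.tendsto[OF bounded_linear_quadratic_form] lim)
      moreover have "\<forall>\<^sub>F n in F. (\<Sum>i<k. \<Sum>j<k. cinner (v i) (\<Phi> n (X i j) *v v j)) \<in> {z. nonneg_c z}"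
        using X ucp by (intro always_eventually) (auto simp: ucp_def completely_positive_def block_psd_def)
      ultimately have "(\<Sum>i<k. \<Sum>j<k. cinner (v i) (\<Psi> (X i j) *v v j)) \<in> {z. nonneg_c z}"
        by (intro Lim_in_closed_set[OF closed_nonneg_c _ nt])
      then show "nonneg_c (\<Sum>i<k. \<Sum>j<k. cinner (v i) (\<Psi> (X i j) *v v j))" by simp
    qed
  qed
  have "((\<lambda>k. \<Phi> k (mat 1)) \<longlongrightarrow> \<Psi> (mat 1)) F" by (rule lim)
  moreover have "\<Phi> k (mat 1) = mat 1" for k using ucp by (simp add: ucp_def)
  ultimately show "\<Psi> (mat 1) = mat 1" using tendsto_unique[OF nt _ tendsto_const] by simp
qed

text \<open>The Schwarz defect is a positive semidefinite matrix-valued form, so it vanishes against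
  every X as soon as it vanishes on the diagonal at A.\<close>

lemma multiplicative_domain:
  assumes u: "ucp \<Phi>" and A: "\<Phi> (adj A ** A) = adj (\<Phi> A) ** \<Phi> A"
  shows "\<Phi> (adj A ** X) = adj (\<Phi> A) ** \<Phi> X"
proof -
  have lin: "clinear_map \<Phi>" using u by (simp add: ucp_def)
  note L = clinear_map_simps[OF lin]
  define D where "D X Y = \<Phi> (adj X ** Y) - adj (\<Phi> X) ** \<Phi> Y" for X Y
  have "cinner v (D A X *v v) = 0" for v
  proof -
    define z where "z = cinner v (D A X *v v)"
    define c where "c = Re (cinner v (D X X *v v))"
    have DXA: "D X A = adj (D A X)"
      using ucp_adj[OF u, of "adj A ** X"] by (simp add: D_def adj_diff adj_mult)
    have z': "cinner v (D X A *v v) = cnj z"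
      by (simp add: DXA z_def cinner_mult_right cnj_cinner)
    have main: "0 \<le> 2 * Re (t * z) + (cmod t)\<^sup>2 * c" for t
    proof -
      have "D (A + smat t X) (A + smat t X) = D A A + smat t (D A X) + smat (cnj t) (D X A) + smat (cnj t * t) (D X X)"
        by (simp add: D_def L adj_add adj_smat mat_simps smat_smat vec_eq_iff algebra_simps)
      moreover have "D A A = 0" using A by (simp add: D_def)
      ultimately have "cinner v (D (A + smat t X) (A + smat t X) *v v)
        = t * z + cnj t * cnj z + (cnj t * t) * cinner v (D X X *v v)"
        by (simp add: mult_vec_simps cinner_simps z_def[symmetric] z')
      also have "cnj t * t = of_real ((cmod t)\<^sup>2)" by (metis complex_norm_square mult.commute)
      finally have "Re (cinner v (D (A + smat t X) (A + smat t X) *v v)) = 2 * Re (t * z) + (cmod t)\<^sup>2 * c"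
        by (simp add: c_def)
      moreover have "0 \<le> Re (cinner v (D (A + smat t X) (A + smat t X) *v v))"
        using kadison_schwarz[OF u, of "A + smat t X"] unfolding D_def psd_def nonneg_c_def by blast
      ultimately show ?thesis by linarith
    qed
    have c: "c \<ge> 0" using kadison_schwarz[OF u, of X] by (simp add: D_def c_def psd_def nonneg_c_def)
    \<comment> \<open>At \<open>t = - d * cnj z\<close> the linear term is \<open>- 2 * d\<close>
      times the squared modulus of \<open>z\<close>, and the quadratic term only
      \<open>d * d * c\<close> times it. Nonnegativity of the sum forces
      \<open>z = 0\<close>.\<close>
    define d where "d = 1 / (c + 1)"
    have d: "d > 0" "d * c < 1" using c by (auto simp: d_def)
    have "cnj z * z = of_real ((cmod z)\<^sup>2)" by (metis complex_norm_square mult.commute)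
    then have "Re (- of_real d * cnj z * z) = - d * (cmod z)\<^sup>2" by (simp add: mult.assoc)
    then have "0 \<le> d * (cmod z)\<^sup>2 * (d * c - 2)"
      using main[of "- of_real d * cnj z"] d by (simp add: norm_mult power2_eq_square algebra_simps)
    then have "d * (cmod z)\<^sup>2 \<le> 0" using d by (simp add: zero_le_mult_iff)
    then have "(cmod z)\<^sup>2 \<le> 0" using d by (simp add: mult_le_0_iff)
    then show ?thesis by (simp add: z_def)
  qed
  then have "D A X = 0" by (rule quadratic_form_eq_0)
  then show ?thesis by (simp add: D_def)
qed

section \<open>The decoherence-free algebra\<close>

locale decohering_semigroup =
  fixes P :: "real \<Rightarrow> complex^'n::finite^'n \<Rightarrow> complex^'n^'n" and \<rho> :: "complex^'n^'n"
  assumes qms: "qms P" and rho: "pos_def \<rho>"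
    and inv: "\<And>t X. t \<ge> 0 \<Longrightarrow> trace (\<rho> ** P t X) = trace (\<rho> ** X)"
begin

text \<open>The square of the norm given by the state \<open>\<rho>\<close>, without a root:
  invariance and the Schwarz inequality apply directly to this expression.\<close>

definition rho_norm :: "complex^'n^'n \<Rightarrow> real" where
  "rho_norm X = Re (trace (\<rho> ** (adj X ** X)))"

lemma ucp: "t \<ge> 0 \<Longrightarrow> ucp (P t)"
  using qms by (simp add: qms_def ucp_def)

lemma semigroup: "s \<ge> 0 \<Longrightarrow> t \<ge> 0 \<Longrightarrow> P (s + t) X = P s (P t X)"
  using qms by (simp add: qms_def)

lemma rho_norm_0: "rho_norm X \<le> 0 \<Longrightarrow> X = 0"
  using pos_def_trace_mult_0[OF rho psd_adj_mult, of X] trace_adj_mult_norm[of X]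
  by (simp add: rho_norm_def)

text \<open>The Schwarz inequality under the state, whose invariance removes \<open>P t\<close> from
  the larger side.\<close>

lemma rho_norm_contraction:
  assumes "t \<ge> 0" shows "rho_norm (P t X) \<le> rho_norm X"
  using trace_mult_mono[OF pos_def_psd[OF rho] kadison_schwarz[OF ucp[OF assms], of X]]
  by (simp add: rho_norm_def inv[OF assms])

lemma tendsto_rho_norm: "(f \<longlongrightarrow> X) F \<Longrightarrow> ((\<lambda>k. rho_norm (f k)) \<longlongrightarrow> rho_norm X) F"
  unfolding rho_norm_def by (intro tendsto_Re tendsto_trace tendsto_mat_mult tendsto_adj tendsto_const)

text \<open>\<open>rho_norm\<close> is contracted, and the spectral bounds \<open>c\<close> and
  \<open>d\<close> of \<open>\<rho>\<close> make it comparable to the squared Euclidean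
  norm.\<close>

lemma uniformly_bounded: "\<exists>C>0. \<forall>t\<ge>0. \<forall>X. norm (P t X) \<le> C * norm X"
proof -
  obtain c where c: "c > 0" "psd (\<rho> - c *\<^sub>R mat 1)" using pos_def_lower_bound[OF rho] .
  obtain d where d: "d > 0" "psd (d *\<^sub>R mat 1 - \<rho>)" using herm_upper_bound[OF pos_def_herm[OF rho]] .
  have tr: "Re (trace (adj X ** X)) = (norm X)\<^sup>2" for X :: "complex^'n^'n"
    by (simp add: trace_adj_mult_norm del: of_real_power)
  have lo: "c * (norm X)\<^sup>2 \<le> rho_norm X" for X
    using trace_mult_mono'[OF psd_adj_mult c(2), of X] by (simp add: rho_norm_def mat_scaleR_mult trace_scaleR tr)
  have hi: "rho_norm X \<le> d * (norm X)\<^sup>2" for X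
    using trace_mult_mono'[OF psd_adj_mult d(2), of X] by (simp add: rho_norm_def mat_scaleR_mult trace_scaleR tr)
  have "norm (P t X) \<le> sqrt (d / c) * norm X" if "t \<ge> 0" for t X
  proof -
    have "c * (norm (P t X))\<^sup>2 \<le> d * (norm X)\<^sup>2"
      using lo[of "P t X"] hi[of X] rho_norm_contraction[OF that, of X] by linarith
    then have "(norm (P t X))\<^sup>2 \<le> (d / c) * (norm X)\<^sup>2" using c by (simp add: field_simps)
    then have "sqrt ((norm (P t X))\<^sup>2) \<le> sqrt ((d / c) * (norm X)\<^sup>2)" by (rule real_sqrt_le_mono)
    also have "\<dots> = sqrt (d / c) * norm X" by (simp only: real_sqrt_mult real_sqrt_abs abs_norm_cancel)
    finally show ?thesis by simp
  qed
  then show ?thesis using c d by (intro exI[of _ "sqrt (d / c)"]) auto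
qed

text \<open>If the maps at times phi k converge to Q, then along a common subsequence the maps at the
  increments m k - phi k and m k - 2 phi k converge to E and R with Q = Q E and E = R Q,
  which makes E idempotent.\<close>

lemma idempotent_limit:
  obtains E and n :: "nat \<Rightarrow> nat" where "\<And>k. n k \<ge> k" "\<And>X. (\<lambda>k. P (real (n k)) X) \<longlonglongrightarrow> E X" "\<And>X. E (E X) = E X"
proof -
  obtain C where C: "C > 0" "\<And>t X. t \<ge> 0 \<Longrightarrow> norm (P t X) \<le> C * norm X" using uniformly_bounded by blast
  define f where "f k = Blinfun (P (real k))" for k :: nat
  have bl: "bounded_linear (P (real k))" for k
    using ucp[of "real k"] by (simp add: ucp_def clinear_map_bounded_linear)
  have f: "blinfun_apply (f k) X = P (real k) X" for k X
    by (simp add: f_def bounded_linear_Blinfun_apply[OF bl])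
  have nf: "norm (f k) \<le> C" for k
    using C by (intro norm_blinfun_bound) (simp_all add: f)
  have sub: "\<exists>l r. strict_mono (r :: nat \<Rightarrow> nat) \<and> (\<lambda>k. f (g (r k))) \<longlonglongrightarrow> l" for g :: "nat \<Rightarrow> nat"
  proof -
    have "bounded (range (\<lambda>k. f (g k)))" unfolding bounded_iff using nf by blast
    from bounded_imp_convergent_subsequence[OF this] show ?thesis unfolding o_def .
  qed
  have fadd: "f (i + j) = f i o\<^sub>L f j" for i j
    by (rule blinfun_eqI) (simp add: f semigroup)
  obtain Q \<phi> where \<phi>: "strict_mono \<phi>" "(\<lambda>k. f (\<phi> k)) \<longlonglongrightarrow> Q"
    using sub[of "\<lambda>k. k"] by blast
  \<comment> \<open>The factor 3 keeps the natural-number differences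
    \<open>\<phi> (b k) - \<phi> k\<close> and \<open>\<phi> (b k) - 2 * \<phi> k\<close> free of
    truncation at 0; the summand \<open>k\<close> makes the resulting times tend to
    infinity.\<close>
  define b where "b k = 3 * \<phi> k + k" for k
  obtain E \<psi> where \<psi>: "strict_mono \<psi>" "(\<lambda>k. f (\<phi> (b (\<psi> k)) - \<phi> (\<psi> k))) \<longlonglongrightarrow> E"
    using sub[of "\<lambda>k. \<phi> (b k) - \<phi> k"] by blast
  obtain R \<eta> where \<eta>: "strict_mono \<eta>" "(\<lambda>k. f (\<phi> (b (\<psi> (\<eta> k))) - 2 * \<phi> (\<psi> (\<eta> k)))) \<longlonglongrightarrow> R"
    using sub[of "\<lambda>k. \<phi> (b (\<psi> k)) - 2 * \<phi> (\<psi> k)"] by blast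
  define \<theta> where "\<theta> = \<psi> \<circ> \<eta>"
  have \<theta>: "strict_mono \<theta>" using \<psi> \<eta> by (simp add: \<theta>_def strict_mono_o)
  define m where "m k = \<phi> (b (\<theta> k))" for k
  have m: "m k \<ge> 3 * \<phi> (\<theta> k) + k" for k
    using seq_suble[OF \<phi>(1), of "b (\<theta> k)"] seq_suble[OF \<theta>, of k] by (simp add: m_def b_def)
  have smb: "strict_mono (b \<circ> \<theta>)"
  proof (rule strict_mono_o[OF _ \<theta>])
    show "strict_mono b"
    proof (rule strict_monoI)
      fix i j :: nat assume "i < j"
      then show "b i < b j" using strict_monoD[OF \<phi>(1), of i j] by (simp add: b_def)
    qed
  qed
  have Q1: "(\<lambda>k. f (m k)) \<longlonglongrightarrow> Q"
    using LIMSEQ_subseq_LIMSEQ[OF \<phi>(2) smb] by (simp add: m_def o_def)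
  have Q2: "(\<lambda>k. f (\<phi> (\<theta> k))) \<longlonglongrightarrow> Q"
    using LIMSEQ_subseq_LIMSEQ[OF \<phi>(2) \<theta>] by (simp add: o_def)
  have E: "(\<lambda>k. f (m k - \<phi> (\<theta> k))) \<longlonglongrightarrow> E"
    using LIMSEQ_subseq_LIMSEQ[OF \<psi>(2) \<eta>(1)] by (simp add: m_def \<theta>_def o_def)
  have R: "(\<lambda>k. f (m k - 2 * \<phi> (\<theta> k))) \<longlonglongrightarrow> R"
    using \<eta>(2) by (simp add: m_def \<theta>_def o_def)
  note comp = bounded_bilinear.tendsto[OF bounded_bilinear_blinfun_compose]
  have "f (m k) = f (\<phi> (\<theta> k)) o\<^sub>L f (m k - \<phi> (\<theta> k))" for k
    using fadd[of "\<phi> (\<theta> k)" "m k - \<phi> (\<theta> k)"] m[of k] by simp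
  then have "(\<lambda>k. f (m k)) \<longlonglongrightarrow> (Q o\<^sub>L E)" using comp[OF Q2 E] by simp
  then have QE: "Q = Q o\<^sub>L E" by (rule LIMSEQ_unique[OF Q1])
  have "f (m k - \<phi> (\<theta> k)) = f (m k - 2 * \<phi> (\<theta> k)) o\<^sub>L f (\<phi> (\<theta> k))" for k
    using fadd[of "m k - 2 * \<phi> (\<theta> k)" "\<phi> (\<theta> k)"] m[of k] by simp
  then have "(\<lambda>k. f (m k - \<phi> (\<theta> k))) \<longlonglongrightarrow> (R o\<^sub>L Q)" using comp[OF R Q2] by simp
  then have ER: "E = R o\<^sub>L Q" by (rule LIMSEQ_unique[OF E])
  have ER': "blinfun_apply E X = blinfun_apply R (blinfun_apply Q X)" for X
    by (subst ER) simp
  have QE': "blinfun_apply Q X = blinfun_apply Q (blinfun_apply E X)" for X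
    by (subst QE) simp
  have idem: "blinfun_apply E (blinfun_apply E X) = blinfun_apply E X" for X
    using ER'[of "blinfun_apply E X"] unfolding QE'[of X, symmetric] ER'[of X, symmetric] .
  show ?thesis
  proof (rule that[of "\<lambda>k. m k - \<phi> (\<theta> k)" "blinfun_apply E"])
    show "(\<lambda>k. P (real (m k - \<phi> (\<theta> k))) X) \<longlonglongrightarrow> blinfun_apply E X" for X
      using blinfun.tendsto[OF E tendsto_const[of X]] unfolding f .
    show "m k - \<phi> (\<theta> k) \<ge> k" for k using m[of k] by linarith
  qed (rule idem)
qed

lemma dfa_adj: "X \<in> dfa P \<Longrightarrow> adj X \<in> dfa P"
  by (auto simp: dfa_def ucp_adj[OF ucp])

lemma dfa_one: "mat 1 \<in> dfa P"
  using ucp by (simp add: dfa_def ucp_def)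

lemma rho_norm_dfa: "X \<in> dfa P \<Longrightarrow> t \<ge> 0 \<Longrightarrow> rho_norm (P t X) = rho_norm X"
  using inv[of t "adj X ** X"] by (simp add: rho_norm_def dfa_def)

text \<open>The idempotent limit is known only along the integer times \<open>n k\<close>.
  Monotonicity of \<open>rho_norm\<close> in time, the uniform bound and the multiplicative domain
  of \<open>E\<close> upgrade it. Preservation of \<open>\<rho>\<close> is recorded because it makes
  \<open>E\<close> faithful.\<close>

lemma cond_exp_exists:
  obtains E where "cond_exp_onto (dfa P) E" "\<And>X. ((\<lambda>t. P t (X - E X)) \<longlongrightarrow> 0) at_top"
    "\<And>X. trace (\<rho> ** E X) = trace (\<rho> ** X)"
proof -
  obtain E and n :: "nat \<Rightarrow> nat" where n: "\<And>k. n k \<ge> k"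
    and lim: "\<And>X. (\<lambda>k. P (real (n k)) X) \<longlonglongrightarrow> E X" and idem: "\<And>X. E (E X) = E X"
    using idempotent_limit by metis
  have uE: "ucp E" by (rule ucp_pointwise_limit[OF lim]) (simp_all add: ucp)
  have lE: "clinear_map E" using uE by (simp add: ucp_def)
  note L = clinear_map_simps[OF lE]
  have adjE: "E (adj X) = adj (E X)" for X by (rule ucp_adj[OF uE])
  have invE: "trace (\<rho> ** E X) = trace (\<rho> ** X)" for X
  proof -
    have "(\<lambda>k. trace (\<rho> ** P (real (n k)) X)) \<longlonglongrightarrow> trace (\<rho> ** E X)"
      by (intro tendsto_trace tendsto_mat_mult tendsto_const lim)
    then have "(\<lambda>k::nat. trace (\<rho> ** X)) \<longlonglongrightarrow> trace (\<rho> ** E X)" by (simp add: inv)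
    then show ?thesis by (rule LIMSEQ_unique) (rule tendsto_const)
  qed
  have dec: "((\<lambda>t. P t (X - E X)) \<longlongrightarrow> 0) at_top" for X
  proof -
    obtain C where C: "C > 0" "\<And>t X. t \<ge> 0 \<Longrightarrow> norm (P t X) \<le> C * norm X" using uniformly_bounded by blast
    define Z where "Z = X - E X"
    have "(\<lambda>k. P (real (n k)) Z) \<longlonglongrightarrow> 0" using lim[of Z] by (simp add: Z_def L idem)
    show ?thesis unfolding Z_def[symmetric]
    proof (rule tendstoI)
      fix e :: real assume e: "e > 0"
      have "\<forall>\<^sub>F k in sequentially. dist (P (real (n k)) Z) 0 < e / C"
        using \<open>(\<lambda>k. P (real (n k)) Z) \<longlonglongrightarrow> 0\<close> e C by (intro tendstoD) auto
      then obtain k where k: "norm (P (real (n k)) Z) < e / C"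
        by (auto simp: eventually_sequentially)
      \<comment> \<open>One time at which the norm is small suffices: the uniform bound carries
        smallness to all later times.\<close>
      have "norm (P t Z) < e" if "t \<ge> real (n k)" for t
      proof -
        have "P t Z = P (t - real (n k)) (P (real (n k)) Z)"
          using semigroup[of "t - real (n k)" "real (n k)" Z] that by simp
        then have "norm (P t Z) \<le> C * norm (P (real (n k)) Z)" using C(2)[of "t - real (n k)"] that by simp
        also have "\<dots> < e" using k C by (simp add: field_simps)
        finally show ?thesis .
      qed
      then show "\<forall>\<^sub>F t in at_top. dist (P t Z) 0 < e"
        by (intro eventually_mono[OF eventually_ge_at_top[of "real (n k)"]]) simp
    qed
  qed
  \<comment> \<open>\<open>rho_norm (P t X)\<close> does not increase with \<open>t\<close>, yet it
    tends back to its initial value along \<open>n k\<close>, so it is constant. The Schwarz defect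
    is then a positive matrix of zero trace against \<open>\<rho>\<close>.\<close>
  have rng1: "P t (adj X ** X) = adj (P t X) ** P t X" if X: "E X = X" and t: "t \<ge> 0" for X t
  proof -
    have l: "(\<lambda>k. rho_norm (P (real (n k)) X)) \<longlonglongrightarrow> rho_norm X"
      using tendsto_rho_norm[OF lim[of X]] X by simp
    have "\<forall>\<^sub>F k in sequentially. rho_norm (P (real (n k)) X) \<le> rho_norm (P t X)"
    proof -
      obtain k0 :: nat where k0: "real k0 \<ge> t" using real_arch_simple by blast
      have "rho_norm (P (real (n k)) X) \<le> rho_norm (P t X)" if "k \<ge> k0" for k
      proof -
        have ge: "real (n k) \<ge> t" using k0 that n[of k] by linarith
        show ?thesis
          using semigroup[of "real (n k) - t" t X] rho_norm_contraction[of "real (n k) - t" "P t X"] t ge by simp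
      qed
      then show ?thesis by (auto simp: eventually_sequentially)
    qed
    with l have "rho_norm X \<le> rho_norm (P t X)"
      by (intro tendsto_upperbound[OF l]) auto
    then have "Re (trace (\<rho> ** (P t (adj X ** X) - adj (P t X) ** P t X))) \<le> 0"
      by (simp add: mat_simps trace_sub rho_norm_def inv[OF t])
    then have "P t (adj X ** X) - adj (P t X) ** P t X = 0"
      by (rule pos_def_trace_mult_0[OF rho kadison_schwarz[OF ucp[OF t]]])
    then show ?thesis by simp
  qed
  have rng: "X \<in> dfa P" if X: "E X = X" for X
  proof -
    have aX: "E (adj X) = adj X" by (simp add: adjE X)
    have "P t (X ** adj X) = P t X ** adj (P t X)" if t: "t \<ge> 0" for t
      using rng1[OF aX t] by (simp add: ucp_adj[OF ucp[OF t]])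
    then show ?thesis using rng1[OF X] unfolding dfa_def by blast
  qed
  have multE: "E (adj X ** X) = adj (E X) ** E X" if "X \<in> dfa P" for X
  proof -
    have "(\<lambda>k. adj (P (real (n k)) X) ** P (real (n k)) X) \<longlonglongrightarrow> adj (E X) ** E X"
      by (intro tendsto_mat_mult tendsto_adj lim)
    moreover have "adj (P (real (n k)) X) ** P (real (n k)) X = P (real (n k)) (adj X ** X)" for k
      using that by (simp add: dfa_def)
    ultimately have "(\<lambda>k. P (real (n k)) (adj X ** X)) \<longlonglongrightarrow> adj (E X) ** E X" by simp
    then show ?thesis by (rule LIMSEQ_unique[OF lim])
  qed
  \<comment> \<open>The multiplicative domain is applied at \<open>adj A\<close>, which also lies in
    the range of \<open>E\<close>.\<close>
  have left: "E (A ** X) = A ** E X" if A: "E A = A" for A X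
  proof -
    have "E (adj A) = adj A" by (simp add: adjE A)
    then have "adj A \<in> dfa P" by (rule rng)
    from multiplicative_domain[OF uE multE[OF this]]
    have "E (adj (adj A) ** X) = adj (E (adj A)) ** E X" .
    then show ?thesis by (simp add: \<open>E (adj A) = adj A\<close>)
  qed
  have right: "E (X ** B) = E X ** B" if B: "E B = B" for B X
  proof -
    have "E (adj B) = adj B" by (simp add: adjE B)
    then have "E (adj B ** adj X) = adj B ** E (adj X)" by (rule left)
    then have "adj (E (X ** B)) = adj (E X ** B)"
      unfolding adjE[symmetric] adj_mult[of "E X" B] adj_mult[of X B] .
    then show ?thesis by (simp add: adj_eq_iff)
  qed
  \<comment> \<open>The component \<open>Z\<close> of \<open>X\<close> in the kernel of
    \<open>E\<close> satisfies \<open>E (adj Z ** Z) = 0\<close>, and preservation of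
    \<open>\<rho>\<close> forces \<open>Z = 0\<close>.\<close>
  have fix1: "E X = X" if X: "X \<in> dfa P" for X
  proof -
    define Z where "Z = X - E X"
    have a: "E (adj (E X)) = adj (E X)" by (simp add: adjE idem)
    have 1: "E (adj (E X) ** X) = adj (E X) ** E X" by (rule left[OF a])
    have 2: "E (adj X ** E X) = adj (E X) ** E X" using right[OF idem, of "adj X" X] by (simp add: adjE)
    have 3: "E (adj (E X) ** E X) = adj (E X) ** E X" using left[OF a, of "E X"] by (simp add: idem)
    have "E (adj Z ** Z) = 0"
      by (simp add: Z_def adj_diff mat_simps L multE[OF X] 1 2 3)
    then have "rho_norm Z = 0" using invE[of "adj Z ** Z"] by (simp add: rho_norm_def)
    then have "Z = 0" by (intro rho_norm_0) simp
    then show ?thesis by (simp add: Z_def)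
  qed
  have "cond_exp_onto (dfa P) E"
    unfolding cond_exp_onto_def
  proof (intro conjI allI ballI impI)
    show "clinear_map E" by (rule lE)
    show "E X \<in> dfa P" for X by (rule rng[OF idem])
    show "E X = X" if "X \<in> dfa P" for X by (rule fix1[OF that])
    show "psd (E X)" if "psd X" for X by (rule ucp_psd[OF uE that])
    show "E (A ** X ** B) = A ** E X ** B" if "A \<in> dfa P" "B \<in> dfa P" for A B X
      by (simp add: right[OF fix1[OF that(2)]] left[OF fix1[OF that(1)]])
  qed
  then show ?thesis by (rule that[OF _ dec invE])
qed

text \<open>Uniqueness behind the description operator: the difference of two candidates lies in the
  algebra, where \<open>P t\<close> preserves \<open>rho_norm\<close>, yet \<open>P t\<close> sends
  it to 0 as time grows.\<close>

lemma condexpN_spec: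
  "cond_exp_onto (dfa P) (condexpN P)" "trace (\<rho> ** condexpN P X) = trace (\<rho> ** X)"
proof -
  obtain E where E: "cond_exp_onto (dfa P) E" "\<And>X. ((\<lambda>t. P t (X - E X)) \<longlongrightarrow> 0) at_top"
    "\<And>X. trace (\<rho> ** E X) = trace (\<rho> ** X)" using cond_exp_exists by metis
  have "condexpN P = E"
    unfolding condexpN_def
  proof (rule the_equality)
    show "cond_exp_onto (dfa P) E \<and> (\<forall>X. ((\<lambda>t. P t (X - E X)) \<longlongrightarrow> 0) at_top)" using E by blast
    fix F assume F: "cond_exp_onto (dfa P) F \<and> (\<forall>X. ((\<lambda>t. P t (X - F X)) \<longlongrightarrow> 0) at_top)"
    show "F = E"
    proof
      fix X
      define D where "D = E X - F X"
      have lin: "clinear_map E" using E(1) by (simp add: cond_exp_onto_def)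
      have "E D = D" using E(1) F by (simp add: D_def clinear_map_simps[OF lin] cond_exp_onto_def)
      then have DN: "D \<in> dfa P" using E(1) unfolding cond_exp_onto_def by metis
      have "((\<lambda>t. P t (X - F X) - P t (X - E X)) \<longlongrightarrow> 0 - 0) at_top"
        using F E(2) by (intro tendsto_diff) auto
      moreover have "\<forall>\<^sub>F t in at_top. P t (X - F X) - P t (X - E X) = P t D"
        using eventually_ge_at_top[of 0]
      proof eventually_elim
        case (elim t)
        then have "clinear_map (P t)" using ucp by (simp add: ucp_def)
        then have "P t (X - F X) - P t (X - E X) = P t ((X - F X) - (X - E X))" by (simp add: clinear_map_simps)
        then show ?case by (simp add: D_def)
      qed
      ultimately have "((\<lambda>t. P t D) \<longlongrightarrow> 0) at_top" by (simp add: tendsto_cong)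
      then have "((\<lambda>t. rho_norm (P t D)) \<longlongrightarrow> rho_norm 0) at_top" by (rule tendsto_rho_norm)
      moreover have "\<forall>\<^sub>F t in at_top. rho_norm (P t D) = rho_norm D"
        using eventually_ge_at_top[of 0] by eventually_elim (simp add: rho_norm_dfa[OF DN])
      ultimately have "((\<lambda>t::real. rho_norm D) \<longlongrightarrow> rho_norm 0) at_top" by (simp add: tendsto_cong)
      then have "rho_norm D = rho_norm 0" using tendsto_unique[OF _ tendsto_const] by (metis trivial_limit_at_top_linorder)
      then have "D = 0" by (intro rho_norm_0) (simp add: rho_norm_def)
      then show "F X = E X" by (simp add: D_def)
    qed
  qed
  then show "cond_exp_onto (dfa P) (condexpN P)" "trace (\<rho> ** condexpN P X) = trace (\<rho> ** X)"
    using E by auto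
qed

end

section \<open>The state sigma and the properties extracted from the semigroup\<close>

lemma predual_eq:
  assumes lin: "clinear_map \<Phi>"
  shows "trace (predual \<Phi> R ** X) = trace (R ** \<Phi> X)"
proof -
  \<comment> \<open>Matrix units: the functional to be represented is determined by its values on
    them.\<close>
  define e :: "'a \<Rightarrow> 'a \<Rightarrow> 'a cmat" where "e j i = (\<chi> a b. if a = j \<and> b = i then 1 else 0)" for j i
  define S :: "'a cmat" where "S = (\<chi> i j. trace (R ** \<Phi> (e j i)))"
  have bl: "linear (\<lambda>X. trace (R ** \<Phi> X))"
    by (rule linearI) (simp_all add: clinear_map_simps[OF lin] mat_simps trace_add trace_scaleR scaleR_conv_of_real[where 'a=complex])
  have S: "trace (S ** X) = trace (R ** \<Phi> X)" for X
  proof -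
    have "X = (\<Sum>j\<in>UNIV. \<Sum>i\<in>UNIV. smat (X$j$i) (e j i))"
    proof -
      have "(\<Sum>j\<in>UNIV. \<Sum>i\<in>UNIV. X$j$i * (if a = j \<and> b = i then 1 else 0)) = X$a$b" for a b
      proof -
        have "(\<Sum>i\<in>UNIV. X$j$i * (if a = j \<and> b = i then 1 else 0)) = (if j = a then X$a$b else 0)" for j
        proof -
          have "(\<Sum>i\<in>UNIV. X$j$i * (if a = j \<and> b = i then 1 else 0)) = (\<Sum>i\<in>UNIV. if i = b then (if j = a then X$a$b else 0) else 0)"
            by (rule sum.cong) auto
          then show ?thesis by simp
        qed
        then show ?thesis by simp
      qed
      then show ?thesis by (simp add: vec_eq_iff e_def)
    qed
    then have "trace (R ** \<Phi> X) = trace (R ** \<Phi> (\<Sum>j\<in>UNIV. \<Sum>i\<in>UNIV. smat (X$j$i) (e j i)))" by simp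
    also have "\<dots> = (\<Sum>j\<in>UNIV. \<Sum>i\<in>UNIV. trace (R ** \<Phi> (smat (X$j$i) (e j i))))"
      by (simp add: linear_sum[OF bl])
    also have "\<dots> = (\<Sum>j\<in>UNIV. \<Sum>i\<in>UNIV. X$j$i * S$i$j)"
      by (simp add: clinear_map_simps[OF lin] mat_simps trace_smat S_def)
    also have "\<dots> = (\<Sum>i\<in>UNIV. \<Sum>j\<in>UNIV. X$j$i * S$i$j)" by (rule sum.swap)
    also have "\<dots> = trace (S ** X)" by (simp add: trace_def mat_mult_nth mult.commute)
    finally show ?thesis ..
  qed
  have "predual \<Phi> R = S"
    unfolding predual_def
  proof (rule the_equality)
    show "\<forall>X. trace (S ** X) = trace (R ** \<Phi> X)" using S by blast
    fix T assume T: "\<forall>X. trace (T ** X) = trace (R ** \<Phi> X)"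
    have "trace ((T - S) ** adj (T - S)) = 0" using T S by (simp add: mat_diff_distrib(2) trace_sub)
    then show "T = S" by (simp add: trace_mult_adj_norm del: of_real_power)
  qed
  then show ?thesis using S by simp
qed

text \<open>What the later estimates use about the semigroup. Closure of \<open>N\<close> under
  sums, products and functional calculus is derived from \<open>E\<close> being a linear bimodule
  projection onto \<open>N\<close>.\<close>

locale tracial_expectation =
  fixes N :: "(complex^'n::finite^'n) set" and E :: "complex^'n^'n \<Rightarrow> complex^'n^'n" and \<sigma> :: "complex^'n^'n"
  assumes E: "cond_exp_onto N E" and N_one: "mat 1 \<in> N" and N_adj: "A \<in> N \<Longrightarrow> adj A \<in> N"
    and sigma: "pos_def \<sigma>" and trace_sigma: "trace \<sigma> = 1"
    and sigma_commute: "A \<in> N \<Longrightarrow> \<sigma> ** A = A ** \<sigma>"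
    and sigma_E: "trace (\<sigma> ** E X) = trace (\<sigma> ** X)"

lemma trace_outer:
  "trace (S ** (\<chi> i j. v$i * cnj (v$j))) = cinner v (S *v v)"
  by (simp add: trace_def mat_mult_nth cinner_def matrix_vector_mult_def sum_distrib_left mult_ac)

lemma psd_outer: "psd (\<chi> i j. v$i * cnj (v$j))"
proof -
  have "cinner w ((\<chi> i j. v$i * cnj (v$j)) *v w) = cinner w v * cnj (cinner w v)" for w
    by (simp add: cinner_def matrix_vector_mult_def sum_distrib_left sum_distrib_right mult_ac) (rule sum.swap)
  then show ?thesis
    by (simp add: psd_def nonneg_c_def complex_norm_square[symmetric] del: of_real_power)
qed

text \<open>All properties of \<open>sigmaTr P\<close> come from the identity \<open>tr\<close>.
  Positivity holds because the expectation is faithful; commutation with the algebra holds because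
  the bimodule property reduces both orders of the product to a plain trace, which is
  cyclic.\<close>

lemma (in decohering_semigroup) tracial_expectation:
  "tracial_expectation (dfa P) (condexpN P) (sigmaTr P)"
proof -
  let ?E = "condexpN P" and ?d = "real CARD('n)"
  have C: "cond_exp_onto (dfa P) ?E" by (rule condexpN_spec)
  then have lin: "clinear_map ?E" by (simp add: cond_exp_onto_def)
  have d: "?d > 0" by simp
  have tr: "trace (sigmaTr P ** X) = trace (?E X) / ?d" for X
    unfolding sigmaTr_def predual_eq[OF lin] by (simp add: mat_smat_mult trace_smat)
  have faithful: "X = 0" if "psd X" "?E X = 0" for X
  proof -
    have "trace (\<rho> ** X) = 0" using condexpN_spec(2)[of X] that by (simp add: trace_zero)
    then show ?thesis using pos_def_trace_mult_0[OF rho that(1)] by simp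
  qed
  have bim: "?E (A ** X ** B) = A ** ?E X ** B" if "A \<in> dfa P" "B \<in> dfa P" for A B X
    using C that by (simp add: cond_exp_onto_def)
  show ?thesis
  proof
    show "cond_exp_onto (dfa P) ?E" by (rule C)
    show "mat 1 \<in> dfa P" by (rule dfa_one)
    show "A \<in> dfa P \<Longrightarrow> adj A \<in> dfa P" for A by (rule dfa_adj)
    show "pos_def (sigmaTr P)"
      unfolding pos_def_def
    proof (intro allI impI)
      fix v :: "complex^'n" assume v: "v \<noteq> 0"
      define V :: "complex^'n^'n" where "V = (\<chi> i j. v$i * cnj (v$j))"
      have V: "psd V" unfolding V_def by (rule psd_outer)
      then have EV: "psd (?E V)" using C by (simp add: cond_exp_onto_def)
      have "V \<noteq> 0"
      proof
        assume "V = 0"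
        then have "v$i * cnj (v$i) = 0" for i by (simp add: V_def vec_eq_iff)
        then show False using v by (simp add: vec_eq_iff)
      qed
      then have "Re (trace (?E V)) > 0" using faithful[OF V] psd_trace_0[OF EV] by force
      moreover have "Im (trace (?E V)) = 0" using trace_psd_mult(2)[OF psd_one EV] by simp
      moreover have "cinner v (sigmaTr P *v v) = trace (?E V) / ?d"
        using tr[of V] by (simp add: V_def trace_outer)
      ultimately show "Im (cinner v (sigmaTr P *v v)) = 0 \<and> 0 < Re (cinner v (sigmaTr P *v v))"
        using d by (simp add: Im_divide_of_real Re_divide_of_real del: of_real_of_nat_eq)
    qed
    show "trace (sigmaTr P) = 1"
      using tr[of "mat 1"] C dfa_one by (simp add: cond_exp_onto_def trace_I)
    show "trace (sigmaTr P ** ?E X) = trace (sigmaTr P ** X)" for X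
      using C by (simp add: tr cond_exp_onto_def)
    show "sigmaTr P ** A = A ** sigmaTr P" if A: "A \<in> dfa P" for A
    proof -
      define D where "D = sigmaTr P ** A - A ** sigmaTr P"
      have "trace (D ** X) = 0" for X
      proof -
        have 1: "trace (sigmaTr P ** (A ** X)) = trace (A ** ?E X) / ?d"
          using bim[OF A dfa_one, of X] by (simp add: tr)
        have 2: "trace (sigmaTr P ** (X ** A)) = trace (?E X ** A) / ?d"
          using bim[OF dfa_one A, of X] by (simp add: tr)
        have "trace (D ** X) = trace (sigmaTr P ** (A ** X)) - trace (A ** (sigmaTr P ** X))"
          by (simp add: D_def mat_simps trace_sub)
        also have "trace (A ** (sigmaTr P ** X)) = trace (sigmaTr P ** (X ** A))"
          using trace_cyc[of A "sigmaTr P ** X"] by (simp add: matrix_mul_assoc)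
        finally show ?thesis by (simp add: 1 2 trace_cyc)
      qed
      then have "trace (D ** adj D) = 0" by blast
      then have "D = 0" by (simp add: trace_mult_adj_norm del: of_real_power)
      then show ?thesis by (simp add: D_def)
    qed
  qed
qed

lemma decohering_tracial_expectation:
  assumes "decohering P"
  shows "tracial_expectation (dfa P) (condexpN P) (sigmaTr P)"
proof -
  obtain \<rho> where "qms P" "pos_def \<rho>" "\<forall>t\<ge>0. \<forall>X. trace (\<rho> ** P t X) = trace (\<rho> ** X)"
    using assms by (auto simp: decohering_def)
  then interpret decohering_semigroup P \<rho> by unfold_locales auto
  show ?thesis by (rule tracial_expectation)
qed

section \<open>Weighted norms relative to the algebra\<close>

lemma herm_mpow: "herm A \<Longrightarrow> herm (mpow A s)"
  by (simp add: mpow_def)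

lemma pos_def_mpow: "pos_def A \<Longrightarrow> pos_def (mpow A s)"
  unfolding mpow_def by (rule pos_def_mfun) auto

lemma mpow_add: "herm A \<Longrightarrow> mpow A s ** mpow A t = mpow A (s + t)"
  by (simp add: mpow_def mfun_mult powr_add)

lemma mpow_0: "pos_def A \<Longrightarrow> mpow A 0 = mat 1"
  using mfun_cong_pos_def[of A "\<lambda>x. x powr 0" "\<lambda>x. 1"] mfun_const[OF pos_def_herm, of A 1]
  by (simp add: mpow_def)

lemma mpow_1: "psd A \<Longrightarrow> mpow A 1 = A"
  using mfun_cong_psd[of A "\<lambda>x. x powr 1" "\<lambda>x. x"] by (simp add: mpow_def psd_herm)

lemma mpow_mpow: "herm A \<Longrightarrow> mpow (mpow A s) t = mpow A (s * t)"
  by (simp add: mpow_def mfun_mfun powr_powr)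

lemma mpow_inverse: "pos_def A \<Longrightarrow> mpow A s ** mpow A (- s) = mat 1" "pos_def A \<Longrightarrow> mpow A (- s) ** mpow A s = mat 1"
  by (simp_all add: mpow_add pos_def_herm mpow_0)

lemma mpow_commute: "herm A \<Longrightarrow> A ** B = B ** A \<Longrightarrow> mpow A s ** B = B ** mpow A s"
  unfolding mpow_def by (rule mfun_intertwine)

lemma mfun_zero: "mfun f (0::complex^'n::finite^'n) = f 0 *\<^sub>R mat 1"
  using mfun_mfun[OF herm_simps(4), of f "\<lambda>_. 0"] by (simp add: mfun_const herm_simps)

lemma invertible_mpow: "pos_def A \<Longrightarrow> invertible (mpow A s)"
  by (simp add: pos_def_invertible pos_def_mpow)

lemma diagonalizes_mult:
  assumes "diagonalizes U a A" "diagonalizes U b B"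
  shows "diagonalizes U (\<lambda>i. a i * b i) (A ** B)"
proof -
  have u: "unitary U" using assms by (simp add: diagonalizes_def)
  let ?a = "diag_mat (\<lambda>i. complex_of_real (a i))" and ?b = "diag_mat (\<lambda>i. complex_of_real (b i))"
  have "A ** B = U ** ?a ** (adj U ** U) ** ?b ** adj U"
    using assms by (simp add: diagonalizes_def matrix_mul_assoc)
  also have "\<dots> = U ** (?a ** ?b) ** adj U"
    by (simp add: unitary_simps[OF u] matrix_mul_assoc)
  finally show ?thesis using u by (simp add: diagonalizes_def diag_mat_mult)
qed

section \<open>Operator bounds and Schatten norms at finite exponents\<close>

definition op_bound :: "complex^'n::finite^'n \<Rightarrow> real \<Rightarrow> bool" where
  "op_bound C \<alpha> \<longleftrightarrow> (\<forall>v. norm (C *v v) \<le> \<alpha> * norm v)"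

text \<open>An operator bound in the form of a matrix inequality, to which trace monotonicity
  applies.\<close>

lemma op_bound_psd:
  assumes "\<alpha> \<ge> 0" shows "op_bound C \<alpha> \<longleftrightarrow> psd (\<alpha>\<^sup>2 *\<^sub>R mat 1 - adj C ** C)"
proof -
  have form: "Re (cinner v ((\<alpha>\<^sup>2 *\<^sub>R mat 1 - adj C ** C) *v v)) = (\<alpha> * norm v)\<^sup>2 - (norm (C *v v))\<^sup>2" for v
  proof -
    have "cinner v ((adj C ** C) *v v) = cinner (C *v v) (C *v v)"
      by (simp add: matrix_vector_mul_assoc[symmetric] cinner_mult_right[of v "adj C"])
    then show ?thesis
      by (simp add: mult_vec_simps cinner_simps cinner_self power_mult_distrib del: of_real_power)
  qed
  have "herm (\<alpha>\<^sup>2 *\<^sub>R mat 1 - adj C ** C)" by (intro herm_simps)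
  then have "psd (\<alpha>\<^sup>2 *\<^sub>R mat 1 - adj C ** C) \<longleftrightarrow> (\<forall>v. (norm (C *v v))\<^sup>2 \<le> (\<alpha> * norm v)\<^sup>2)"
    by (simp add: psd_iff form)
  then show ?thesis using assms
    by (simp add: op_bound_def abs_le_square_iff[symmetric])
qed

lemma op_bound_adj:
  assumes "\<alpha> \<ge> 0" "op_bound C \<alpha>" shows "op_bound (adj C) \<alpha>"
  unfolding op_bound_def
proof
  fix v
  have "(norm (adj C *v v))\<^sup>2 = cmod (cinner (adj C *v v) (adj C *v v))"
    by (simp add: cinner_self del: of_real_power)
  also have "\<dots> = cmod (cinner v (C *v (adj C *v v)))" by (simp add: cinner_mult_right)
  also have "\<dots> \<le> norm v * norm (C *v (adj C *v v))" by (rule cmod_cinner_le)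
  also have "\<dots> \<le> norm v * (\<alpha> * norm (adj C *v v))"
    using assms(2) by (intro mult_left_mono) (auto simp: op_bound_def)
  finally have "norm (adj C *v v) * norm (adj C *v v) \<le> (\<alpha> * norm v) * norm (adj C *v v)"
    by (simp add: power2_eq_square algebra_simps)
  then show "norm (adj C *v v) \<le> \<alpha> * norm v"
    using assms(1) by (cases "adj C *v v = 0") auto
qed

definition sch :: "real \<Rightarrow> complex^'n::finite^'n \<Rightarrow> real" where
  "sch p Y = (Re (trace (mfun (\<lambda>x. x powr (p / 2)) (adj Y ** Y)))) powr (1 / p)"

lemma sch_nonneg: "sch p Y \<ge> 0"
  by (simp add: sch_def)

lemma trace_mfun_nonneg: "psd A \<Longrightarrow> (\<And>x. x \<ge> 0 \<Longrightarrow> f x \<ge> 0) \<Longrightarrow> Re (trace (mfun f A)) \<ge> 0"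
  by (intro trace_psd_nonneg psd_mfun)

lemma sch_adj: "sch p (adj Y) = sch p Y"
  using trace_mfun_commute[of "\<lambda>x. x powr (p / 2)" Y] by (simp add: sch_def)

text \<open>The Gram matrix of \<open>C ** X\<close> is at most the square of
  \<open>\<alpha>\<close> times the Gram matrix of \<open>X\<close>, and the trace of the power
  \<open>p / 2\<close> is monotone. The argument covers exponents below 1.\<close>

lemma sch_left:
  assumes p: "p > 0" and a: "\<alpha> \<ge> 0" and C: "op_bound C \<alpha>"
  shows "sch p (C ** X) \<le> \<alpha> * sch p X"
proof -
  let ?f = "\<lambda>x. x powr (p / 2)"
  have "psd (adj X ** (\<alpha>\<^sup>2 *\<^sub>R mat 1 - adj C ** C) ** X)"
    using C unfolding op_bound_psd[OF a] by (rule psd_conj)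
  then have "psd (\<alpha>\<^sup>2 *\<^sub>R (adj X ** X) - adj (C ** X) ** (C ** X))"
    by (simp add: adj_mult mat_simps)
  then have le: "Re (trace (mfun ?f (adj (C ** X) ** (C ** X)))) \<le> Re (trace (mfun ?f (\<alpha>\<^sup>2 *\<^sub>R (adj X ** X))))"
    using p by (intro trace_powr_mono psd_adj_mult) auto
  have h: "herm (adj X ** X)" by (rule herm_simps)
  have "mfun ?f (\<alpha>\<^sup>2 *\<^sub>R (adj X ** X)) = mfun ?f (mfun (\<lambda>x. \<alpha>\<^sup>2 * x) (adj X ** X))"
    using mfun_scaleR[OF h, of "\<alpha>\<^sup>2" "\<lambda>x. x"] h by simp
  also have "\<dots> = mfun (\<lambda>x. (\<alpha>\<^sup>2 * x) powr (p / 2)) (adj X ** X)" by (rule mfun_mfun[OF h])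
  also have "\<dots> = mfun (\<lambda>x. \<alpha> powr p * x powr (p / 2)) (adj X ** X)"
  proof (rule mfun_cong_psd[OF psd_adj_mult])
    fix x :: real assume "x \<ge> 0"
    moreover have "\<alpha>\<^sup>2 powr (p / 2) = \<alpha> powr p"
    proof -
      have "\<alpha>\<^sup>2 = \<alpha> powr 2" using a by (cases "\<alpha> = 0") simp_all
      then show ?thesis by (simp only: powr_powr) simp
    qed
    ultimately show "(\<alpha>\<^sup>2 * x) powr (p / 2) = \<alpha> powr p * x powr (p / 2)"
      by (simp add: powr_mult)
  qed
  also have "\<dots> = \<alpha> powr p *\<^sub>R mfun ?f (adj X ** X)" by (rule mfun_scaleR[OF h])
  finally have "Re (trace (mfun ?f (adj (C ** X) ** (C ** X)))) \<le> \<alpha> powr p * Re (trace (mfun ?f (adj X ** X)))"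
    using le by (simp add: trace_scaleR)
  then have "sch p (C ** X) \<le> (\<alpha> powr p * Re (trace (mfun ?f (adj X ** X)))) powr (1 / p)"
    unfolding sch_def using p
    by (intro powr_mono2 trace_mfun_nonneg psd_adj_mult) auto
  also have "\<dots> = \<alpha> * sch p X"
    using a p trace_mfun_nonneg[OF psd_adj_mult, of ?f X] by (simp add: powr_mult sch_def powr_powr)
  finally show ?thesis .
qed

lemma sch_right:
  assumes p: "p > 0" and a: "\<beta> \<ge> 0" and D: "op_bound D \<beta>"
  shows "sch p (X ** D) \<le> \<beta> * sch p X"
proof -
  have "sch p (adj (X ** D)) \<le> \<beta> * sch p (adj X)"
    unfolding adj_mult by (rule sch_left[OF p a op_bound_adj[OF a D]])
  then show ?thesis by (simp add: sch_adj)
qed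

lemma sch_sandwich:
  assumes p: "p > 0" and a: "\<alpha> \<ge> 0" "\<beta> \<ge> 0" and C: "op_bound C \<alpha>" and D: "op_bound D \<beta>"
  shows "sch p (C ** X ** D) \<le> \<alpha> * \<beta> * sch p X"
proof -
  have "sch p (C ** X ** D) \<le> \<beta> * sch p (C ** X)" by (rule sch_right[OF p a(2) D])
  also have "\<dots> \<le> \<beta> * (\<alpha> * sch p X)" using sch_left[OF p a(1) C] a by (intro mult_left_mono)
  finally show ?thesis by (simp add: mult_ac)
qed

section \<open>The algebra N and its weighted norms\<close>

context tracial_expectation
begin

lemma E_lin: "clinear_map E" and E_in [simp]: "E X \<in> N" and E_fix: "X \<in> N \<Longrightarrow> E X = X"
  and E_psd: "psd X \<Longrightarrow> psd (E X)"
  and E_bimodule: "A \<in> N \<Longrightarrow> B \<in> N \<Longrightarrow> E (A ** X ** B) = A ** E X ** B"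
  using E by (auto simp: cond_exp_onto_def)

lemma N_add: "A \<in> N \<Longrightarrow> B \<in> N \<Longrightarrow> A + B \<in> N"
  using E_in[of "A + B"] by (simp add: clinear_map_simps[OF E_lin] E_fix)

lemma N_scaleR: "A \<in> N \<Longrightarrow> r *\<^sub>R A \<in> N"
  using E_in[of "r *\<^sub>R A"] by (simp add: clinear_map_simps[OF E_lin] E_fix)

lemma N_mult: "A \<in> N \<Longrightarrow> B \<in> N \<Longrightarrow> A ** B \<in> N"
proof -
  assume A: "A \<in> N" and B: "B \<in> N"
  have "E (A ** B ** mat 1) = A ** E B ** mat 1" by (rule E_bimodule[OF A N_one])
  then have "E (A ** B) = A ** B" by (simp add: E_fix[OF B])
  then show ?thesis using E_in[of "A ** B"] by simp
qed

text \<open>On the finite spectrum of \<open>A\<close> the function \<open>f\<close> agrees with its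
  Lagrange interpolation polynomial, and \<open>N\<close> is closed under polynomials.\<close>

lemma mfun_in_N:
  assumes h: "herm A" and A: "A \<in> N"
  shows "mfun f A \<in> N"
proof -
  obtain U l where U: "diagonalizes U l A" using spectral_theorem[OF h] by blast
  have shift: "mfun (\<lambda>x. x - m) A \<in> N" for m
    using N_add[OF A N_scaleR[OF N_one, of "- m"]] h by (simp add: mfun_diff mfun_const)
  have prod: "mfun (\<lambda>x. \<Prod>m\<in>S. x - m) A \<in> N" if "finite S" for S
    using that
  proof (induction S rule: finite_induct)
    case empty
    then show ?case using h N_one N_scaleR[OF N_one, of 1] by (simp add: mfun_const)
  next
    case (insert m S)
    then have "mfun (\<lambda>x. \<Prod>m\<in>insert m S. x - m) A = mfun (\<lambda>x. x - m) A ** mfun (\<lambda>x. \<Prod>m\<in>S. x - m) A"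
      using mfun_mult[OF h, of "\<lambda>x. x - m" "\<lambda>x. \<Prod>m\<in>S. x - m"] by simp
    then show ?case using N_mult[OF shift insert.IH] by simp
  qed
  have sum: "mfun (\<lambda>x. \<Sum>k\<in>S. c k * (\<Prod>m\<in>T k. x - m)) A \<in> N" if "finite S" "\<And>k. finite (T k)"
    for S :: "real set" and c and T :: "real \<Rightarrow> real set"
    using that(1)
  proof (induction S rule: finite_induct)
    case empty
    then show ?case using h N_scaleR[OF N_one, of 0] by (simp add: mfun_const)
  next
    case (insert k S)
    then have "mfun (\<lambda>x. \<Sum>k\<in>insert k S. c k * (\<Prod>m\<in>T k. x - m)) A
      = c k *\<^sub>R mfun (\<lambda>x. \<Prod>m\<in>T k. x - m) A + mfun (\<lambda>x. \<Sum>k\<in>S. c k * (\<Prod>m\<in>T k. x - m)) A"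
      using mfun_add[OF h, of "\<lambda>x. c k * (\<Prod>m\<in>T k. x - m)"] mfun_scaleR[OF h, of "c k" "\<lambda>x. \<Prod>m\<in>T k. x - m"] by simp
    then show ?case using N_add[OF N_scaleR[OF prod[OF that(2)]] insert.IH] by simp
  qed
  \<comment> \<open>The nodes form a set, so a repeated eigenvalue counts once and the denominators
    do not vanish.\<close>
  let ?S = "range l"
  define c where "c k = f k / (\<Prod>m\<in>?S - {k}. k - m)" for k
  have "mfun f A = mfun (\<lambda>x. \<Sum>k\<in>?S. c k * (\<Prod>m\<in>?S - {k}. x - m)) A"
  proof (rule mfun_cong[OF U])
    fix i
    have "(\<Sum>k\<in>?S. c k * (\<Prod>m\<in>?S - {k}. l i - m)) = (\<Sum>k\<in>{l i}. c k * (\<Prod>m\<in>?S - {k}. l i - m))"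
      by (rule sum.mono_neutral_right) auto
    also have "\<dots> = f (l i)"
    proof -
      have "(\<Prod>m\<in>?S - {l i}. l i - m) \<noteq> 0" by (subst prod_zero_iff) auto
      then show ?thesis by (simp add: c_def)
    qed
    finally show "f (l i) = (\<Sum>k\<in>?S. c k * (\<Prod>m\<in>?S - {k}. l i - m))" ..
  qed
  then show ?thesis using sum[of ?S "\<lambda>k. ?S - {k}" c] by simp
qed

lemma mpow_in_N: "herm A \<Longrightarrow> A \<in> N \<Longrightarrow> mpow A s \<in> N"
  unfolding mpow_def by (rule mfun_in_N)

lemma hermS: "herm \<sigma>"
  by (rule pos_def_herm[OF sigma])

lemma mpow_sigma_commute: "A \<in> N \<Longrightarrow> mpow \<sigma> s ** A = A ** mpow \<sigma> s"
  by (rule mpow_commute[OF hermS sigma_commute])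

definition Gam :: "real \<Rightarrow> complex^'n^'n \<Rightarrow> complex^'n^'n" where
  "Gam s X = mpow \<sigma> (s / 2) ** X ** mpow \<sigma> (s / 2)"

definition wn :: "real \<Rightarrow> complex^'n^'n \<Rightarrow> real" where
  "wn p X = sch p (Gam (1 / p) X)"

lemma wn_nonneg: "wn p X \<ge> 0"
  by (simp add: wn_def sch_nonneg)

lemma Gam_sandwich: "A \<in> N \<Longrightarrow> B \<in> N \<Longrightarrow> Gam s (A ** X ** B) = A ** Gam s X ** B"
proof -
  assume A: "A \<in> N" and B: "B \<in> N"
  let ?S = "mpow \<sigma> (s / 2)"
  have "Gam s (A ** X ** B) = (?S ** A) ** X ** (B ** ?S)" by (simp add: Gam_def matrix_mul_assoc)
  also have "\<dots> = A ** Gam s X ** B"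
    by (simp only: mpow_sigma_commute[OF A] mpow_sigma_commute[OF B, symmetric]) (simp add: Gam_def matrix_mul_assoc)
  finally show ?thesis .
qed

lemma wn_sandwich:
  assumes "p > 0" "\<alpha> \<ge> 0" "\<beta> \<ge> 0" "op_bound C \<alpha>" "op_bound D \<beta>" "C \<in> N" "D \<in> N"
  shows "wn p (C ** X ** D) \<le> \<alpha> * \<beta> * wn p X"
  unfolding wn_def Gam_sandwich[OF assms(6,7)] by (rule sch_sandwich[OF assms(1-5)])

text \<open>\<open>\<sigma>\<close> commutes with \<open>N\<close>, so its powers in the weighted
  norm combine to a single factor. The state is tracial on \<open>N\<close>, which permits the
  passage from \<open>adj A ** A\<close> to \<open>A ** adj A\<close>, the form suited to left
  factors.\<close>

lemma wn_algebra:
  assumes A: "A \<in> N" and u: "u > 0"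
  shows "wn u A = (Re (trace (\<sigma> ** mfun (\<lambda>x. x powr (u / 2)) (A ** adj A)))) powr (1 / u)"
proof -
  let ?f = "\<lambda>x. x powr (u / 2)"
  define h where "h = adj A ** A"
  have hh: "herm h" by (simp add: h_def herm_simps)
  have hN: "h \<in> N" by (simp add: h_def N_mult N_adj A)
  have Gam: "Gam (1 / u) A = A ** mpow \<sigma> (1 / u)"
  proof -
    have "Gam (1 / u) A = A ** (mpow \<sigma> (1 / u / 2) ** mpow \<sigma> (1 / u / 2))"
      by (simp add: Gam_def mpow_sigma_commute[OF A] matrix_mul_assoc)
    then show ?thesis by (simp only: mpow_add[OF hermS] field_sum_of_halves)
  qed
  have "adj (Gam (1 / u) A) ** Gam (1 / u) A = mpow \<sigma> (1 / u) ** h ** mpow \<sigma> (1 / u)"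
    by (simp add: Gam adj_mult adj_herm[OF herm_mpow[OF hermS]] h_def matrix_mul_assoc)
  also have "\<dots> = mpow \<sigma> (2 / u) ** h"
  proof -
    have "mpow \<sigma> (1 / u) ** h ** mpow \<sigma> (1 / u) = mpow \<sigma> (1 / u) ** mpow \<sigma> (1 / u) ** h"
      by (simp add: mpow_sigma_commute[OF hN, symmetric] matrix_mul_assoc[symmetric])
    then show ?thesis by (simp add: mpow_add[OF hermS])
  qed
  finally have K: "adj (Gam (1 / u) A) ** Gam (1 / u) A = mpow \<sigma> (2 / u) ** h" .
  obtain U s l where U: "diagonalizes U s \<sigma>" "diagonalizes U l h"
    using joint_spectral_theorem[OF hermS hh sigma_commute[OF hN]] by blast
  have s: "s i > 0" for i using sigma pos_def_diagonalizes[OF U(1)] by simp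
  have l: "l i \<ge> 0" for i using psd_adj_mult[of A] psd_diagonalizes[OF U(2)] by (simp add: h_def)
  have "diagonalizes U (\<lambda>i. s i powr (2 / u) * l i) (mpow \<sigma> (2 / u) ** h)"
    unfolding mpow_def by (rule diagonalizes_mult[OF diagonalizes_mfun[OF U(1)] U(2)])
  then have "mfun ?f (mpow \<sigma> (2 / u) ** h) = U ** diag_mat (\<lambda>i. complex_of_real ((s i powr (2 / u) * l i) powr (u / 2))) ** adj U"
    by (rule mfun_eq)
  also have "(\<lambda>i. (s i powr (2 / u) * l i) powr (u / 2)) = (\<lambda>i. s i * l i powr (u / 2))"
    using s l u by (auto simp: powr_mult powr_powr less_imp_le)
  also have "U ** diag_mat (\<lambda>i. complex_of_real (s i * l i powr (u / 2))) ** adj U = \<sigma> ** mfun ?f h"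
    using diagonalizes_mult[OF U(1) diagonalizes_mfun[OF U(2), of ?f]] by (simp add: diagonalizes_def)
  finally have 1: "mfun ?f (adj (Gam (1 / u) A) ** Gam (1 / u) A) = \<sigma> ** mfun ?f h" by (simp add: K)
  define g where "g x = ?f x / x" for x
  have g: "?f = (\<lambda>x. x * g x)" using u by (auto simp: g_def)
  have hh': "herm (A ** adj A)" by (rule herm_simps)
  have i: "mfun g (A ** adj A) ** A = A ** mfun g h"
    unfolding h_def by (rule mfun_intertwine) (simp_all add: herm_simps matrix_mul_assoc)
  have "mfun ?f h = h ** mfun g h"
    unfolding g using mfun_mult[OF hh, of "\<lambda>x. x" g] hh by simp
  then have "trace (\<sigma> ** mfun ?f h) = trace ((\<sigma> ** adj A ** mfun g (A ** adj A)) ** A)"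
    by (simp add: h_def matrix_mul_assoc[symmetric] i[unfolded h_def])
  also have "\<dots> = trace (A ** (\<sigma> ** adj A ** mfun g (A ** adj A)))" by (rule trace_cyc)
  also have "\<dots> = trace (\<sigma> ** ((A ** adj A) ** mfun g (A ** adj A)))"
    using sigma_commute[OF A] by (simp add: matrix_mul_assoc)
  also have "(A ** adj A) ** mfun g (A ** adj A) = mfun ?f (A ** adj A)"
    unfolding g using mfun_mult[OF hh', of "\<lambda>x. x" g] hh' by simp
  finally show ?thesis by (simp add: wn_def sch_def 1)
qed

lemma wn_algebra_adj: "A \<in> N \<Longrightarrow> u > 0 \<Longrightarrow> wn u (adj A) = wn u A"
proof -
  assume A: "A \<in> N" and u: "u > 0"
  have "adj (Gam (1 / u) A) = Gam (1 / u) (adj A)"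
    by (simp add: Gam_def adj_mult adj_herm[OF herm_mpow[OF hermS]] matrix_mul_assoc)
  then show ?thesis using sch_adj[of u "Gam (1 / u) A"] by (simp add: wn_def)
qed

text \<open>Densities with respect to \<open>\<sigma>\<close> correspond to factors of norm one;
  this is why weights \<open>a\<close> can replace the factors \<open>A\<close> in the variational
  formulas.\<close>

lemma wn_mpow:
  assumes a: "a \<in> N" "pos_def a" and tr: "Re (trace (\<sigma> ** a)) = 1" and u: "u > 0"
  shows "wn u (mpow a (1 / u)) = 1"
proof -
  have h: "herm a" using a by (simp add: pos_def_herm)
  have "mpow a (1 / u) ** adj (mpow a (1 / u)) = mpow a (2 / u)"
    by (simp add: adj_herm[OF herm_mpow[OF h]] mpow_add[OF h])
  moreover have "mfun (\<lambda>x. x powr (u / 2)) (mpow a (2 / u)) = a"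
    using mpow_mpow[OF h, of "2 / u" "u / 2"] u mpow_1[OF pos_def_psd[OF a(2)]] by (simp add: mpow_def)
  ultimately show ?thesis
    using wn_algebra[OF mpow_in_N[OF h a(1)] u, of "1 / u"] tr by simp
qed

text \<open>Densities shifted by \<open>\<delta>\<close>: the lower bound keeps logarithms bounded,
  and the trace becomes \<open>1 + \<delta>\<close> because \<open>\<sigma>\<close> has trace
  one.\<close>

definition trunc :: "real \<Rightarrow> (complex^'n^'n) set" where
  "trunc \<delta> = {a \<in> N. psd (a - \<delta> *\<^sub>R mat 1) \<and> Re (trace (\<sigma> ** a)) = 1 + \<delta>}"

lemma trunc_pos_def:
  assumes "\<delta> > 0" "a \<in> trunc \<delta>" shows "pos_def a"
  using pos_def_add_psd[OF pos_def_scaleR[OF pos_def_one assms(1)], of "a - \<delta> *\<^sub>R mat 1"] assms(2)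
  by (simp add: trunc_def)

lemma trunc_scalar: "(1 + \<delta>) *\<^sub>R mat 1 \<in> trunc \<delta>"
proof -
  have "(1 + \<delta>) *\<^sub>R mat 1 - \<delta> *\<^sub>R mat 1 = (mat 1 :: complex^'n^'n)" by (simp add: scaleR_left_distrib)
  then show ?thesis
    using psd_one N_scaleR[OF N_one, of "1 + \<delta>"] by (simp add: trunc_def mat_simps trace_scaleR trace_sigma)
qed

text \<open>\<open>\<sigma>\<close> is at least \<open>m\<close>, so a bound on the trace against
  \<open>\<sigma>\<close> bounds the ordinary trace, and with it every eigenvalue of a positive
  matrix.\<close>

lemma trunc_bounded: "\<exists>M. \<forall>a\<in>trunc \<delta>. \<delta> > 0 \<longrightarrow> psd (M *\<^sub>R mat 1 - a)"
proof -
  obtain m where m: "m > 0" "psd (\<sigma> - m *\<^sub>R mat 1)" using pos_def_lower_bound[OF sigma] .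
  show ?thesis
  proof (intro exI[of _ "(1 + \<delta>) / m"] ballI impI)
    fix a assume a: "a \<in> trunc \<delta>" and d: "\<delta> > 0"
    have pa: "psd a" using trunc_pos_def[OF d a] by (rule pos_def_psd)
    obtain U l where U: "diagonalizes U l a" using spectral_theorem[OF psd_herm[OF pa]] by blast
    have l: "l i \<ge> 0" for i using psd_diagonalizes[OF U] pa by simp
    have "m * Re (trace a) \<le> Re (trace (\<sigma> ** a))"
      using trace_mult_mono'[OF pa m(2)] by (simp add: mat_scaleR_mult trace_scaleR)
    then have tr: "Re (trace a) \<le> (1 + \<delta>) / m" using a m by (simp add: trunc_def field_simps)
    have "Re (trace a) = (\<Sum>i\<in>UNIV. l i)"
      using trace_mfun[OF U, of "\<lambda>x. x"] psd_herm[OF pa] by simp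
    then have "l i \<le> (1 + \<delta>) / m" for i
      using tr member_le_sum[of i UNIV l] l by simp
    then show "psd (((1 + \<delta>) / m) *\<^sub>R mat 1 - a)" using psd_upper_bound[OF U] by blast
  qed
qed

text \<open>The weight is the power \<open>u / 2\<close> of \<open>A ** adj A\<close>, divided by
  \<open>T\<close> and shifted by \<open>\<delta>\<close>, where \<open>T\<close> is the power
  \<open>u\<close> of \<open>wn u A\<close>. It dominates the exact density of \<open>A\<close>, so
  dividing by \<open>mpow a (1 / u)\<close> leaves a matrix of operator norm at most
  \<open>wn u A\<close>.\<close>

lemma truncation:
  assumes A: "A \<in> N" "wn u A > 0" and u: "u > 0" and d: "\<delta> > 0"
  obtains a where "a \<in> trunc \<delta>" "op_bound (adj A ** mpow a (- 1 / u)) (wn u A)"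
proof -
  let ?f = "\<lambda>x. x powr (u / 2)"
  define h where "h = A ** adj A"
  have hp: "psd h" by (simp add: h_def psd_mult_adj)
  have hh: "herm h" using hp by (rule psd_herm)
  have hN: "h \<in> N" by (simp add: h_def N_mult N_adj A)
  define T where "T = Re (trace (\<sigma> ** mfun ?f h))"
  have wn: "wn u A = T powr (1 / u)" using wn_algebra[OF A(1) u] by (simp add: T_def h_def)
  have "T \<ge> 0" unfolding T_def
    by (intro trace_psd_mult(1) psd_mfun hp pos_def_psd[OF sigma]) simp
  moreover have "T \<noteq> 0" using A(2) wn by auto
  ultimately have T: "T > 0" by simp
  define \<phi> where "\<phi> x = ?f x / T + \<delta>" for x
  define a where "a = mfun \<phi> h"
  have a: "a = (1 / T) *\<^sub>R mfun ?f h + \<delta> *\<^sub>R mat 1"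
    using mfun_add[OF hh, of "\<lambda>x. (1 / T) * ?f x" "\<lambda>_. \<delta>"] mfun_scaleR[OF hh, of "1 / T" ?f] mfun_const[OF hh, of \<delta>]
    by (simp add: a_def \<phi>_def[abs_def])
  have "a \<in> N" unfolding a_def by (rule mfun_in_N[OF hh hN])
  moreover have "psd (a - \<delta> *\<^sub>R mat 1)"
    using T by (simp add: a) (intro psd_scaleR psd_mfun hp, auto)
  moreover have "Re (trace (\<sigma> ** a)) = 1 + \<delta>"
    using T by (simp add: a mat_simps trace_add trace_scaleR trace_sigma T_def[symmetric])
  ultimately have 1: "a \<in> trunc \<delta>" by (simp add: trunc_def)
  let ?b = "mpow a (- 1 / u)"
  have b: "?b = mfun (\<lambda>x. \<phi> x powr (- 1 / u)) h" by (simp add: mpow_def a_def mfun_mfun[OF hh])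
  have hb: "herm ?b" unfolding b by (rule herm_mfun[OF hh])
  have "adj (adj A ** ?b) ** (adj A ** ?b) = ?b ** h ** ?b"
    by (simp only: adj_mult adj_herm[OF hb] adj_adj h_def matrix_mul_assoc)
  also have "\<dots> = mfun (\<lambda>x. \<phi> x powr (- 1 / u) * x * \<phi> x powr (- 1 / u)) h"
    unfolding b using mfun_mult[OF hh, of "\<lambda>x. \<phi> x powr (- 1 / u)" "\<lambda>x. x"]
      mfun_mult[OF hh, of "\<lambda>x. \<phi> x powr (- 1 / u) * x" "\<lambda>x. \<phi> x powr (- 1 / u)"] hh by simp
  finally have eq: "adj (adj A ** ?b) ** (adj A ** ?b) = mfun (\<lambda>x. \<phi> x powr (- 1 / u) * x * \<phi> x powr (- 1 / u)) h" .
  obtain U l where U: "diagonalizes U l h" using spectral_theorem[OF hh] by blast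
  have l: "l i \<ge> 0" for i using psd_diagonalizes[OF U] hp by simp
  \<comment> \<open>Discarding \<open>\<delta>\<close> from \<open>\<phi> x\<close> and taking the
    power \<open>2 / u\<close> bounds \<open>x\<close> by
    \<open>T powr (2 / u) * \<phi> x powr (2 / u)\<close>.\<close>
  have le: "\<phi> x powr (- 1 / u) * x * \<phi> x powr (- 1 / u) \<le> (wn u A)\<^sup>2" if x: "x \<ge> 0" for x
  proof -
    have \<phi>: "\<phi> x > 0" using d T by (simp add: \<phi>_def add_nonneg_pos)
    have "?f x \<le> T * \<phi> x" using d T by (simp add: \<phi>_def field_simps)
    then have "(?f x) powr (2 / u) \<le> (T * \<phi> x) powr (2 / u)" using u by (intro powr_mono2) auto
    then have "x \<le> T powr (2 / u) * \<phi> x powr (2 / u)"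
      using x u T \<phi> by (simp add: powr_powr powr_mult)
    then have "x * \<phi> x powr (- 2 / u) \<le> T powr (2 / u) * \<phi> x powr (2 / u) * \<phi> x powr (- 2 / u)"
      by (intro mult_right_mono) auto
    also have "\<dots> = T powr (2 / u)" using \<phi> by (simp add: mult.assoc powr_add[symmetric])
    also have "\<dots> = (wn u A)\<^sup>2" unfolding wn power2_eq_square by (simp add: powr_add[symmetric])
    also have "x * \<phi> x powr (- 2 / u) = \<phi> x powr (- 1 / u) * x * \<phi> x powr (- 1 / u)"
    proof -
      have "\<phi> x powr (- 2 / u) = \<phi> x powr (- 1 / u) * \<phi> x powr (- 1 / u)" by (simp add: powr_add[symmetric])
      then show ?thesis by (simp add: mult_ac)
    qed
    finally show ?thesis .
  qed
  have "psd ((wn u A)\<^sup>2 *\<^sub>R mat 1 - adj (adj A ** ?b) ** (adj A ** ?b))"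
    unfolding eq using psd_upper_bound[OF diagonalizes_mfun[OF U]] le l by blast
  then have "op_bound (adj A ** ?b) (wn u A)" using op_bound_psd[OF wn_nonneg] by blast
  then show ?thesis using that 1 by blast
qed

lemma wn_pos:
  assumes A: "A \<in> N" "A \<noteq> 0" and u: "u > 0" shows "wn u A > 0"
proof (rule ccontr)
  assume "\<not> wn u A > 0"
  then have z: "wn u A = 0" using wn_nonneg[of u A] by simp
  let ?f = "\<lambda>x. x powr (u / 2)"
  have hp: "psd (A ** adj A)" by (rule psd_mult_adj)
  have "Re (trace (\<sigma> ** mfun ?f (A ** adj A))) = 0" using z wn_algebra[OF A(1) u] by simp
  then have z: "mfun ?f (A ** adj A) = 0"
    by (intro pos_def_trace_mult_0[OF sigma] psd_mfun[OF hp]) auto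
  have "mfun (\<lambda>x. x) (A ** adj A) = mfun (\<lambda>x. (?f x) powr (2 / u)) (A ** adj A)"
    using u by (intro mfun_cong_psd[OF hp]) (simp add: powr_powr)
  also have "\<dots> = mfun (\<lambda>x. x powr (2 / u)) (mfun ?f (A ** adj A))"
    by (rule mfun_mfun[OF psd_herm[OF hp], symmetric])
  also have "\<dots> = 0" by (simp add: z mfun_zero)
  finally have "A ** adj A = 0" using psd_herm[OF hp] by simp
  then show False using A(2) trace_mult_adj_norm[of A] by (simp del: of_real_power)
qed

text \<open>\<open>mpow a (- 1 / u) ** A\<close> and \<open>B ** mpow b (- 1 / u)\<close> have
  operator norms at most \<open>wn u A\<close> and \<open>wn u B\<close>, so the sandwich inequality
  absorbs arbitrary factors into truncated weights. The right factor is treated through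
  \<open>adj B\<close>.\<close>

lemma factorization_lower_bound:
  assumes N: "A \<in> N" "B \<in> N" and Y: "A ** X ** B \<noteq> 0" and u: "u > 0" and p: "p > 0" and d: "\<delta> > 0"
  obtains a b where "a \<in> trunc \<delta>" "b \<in> trunc \<delta>"
    "wn p (mpow a (- 1 / u) ** (A ** X ** B) ** mpow b (- 1 / u)) \<le> wn u A * wn u B * wn p X"
proof -
  have nz: "A \<noteq> 0" "adj B \<noteq> 0" using Y adj_eq_iff[of B 0] by auto
  obtain a where a: "a \<in> trunc \<delta>" "op_bound (adj A ** mpow a (- 1 / u)) (wn u A)"
    using truncation[OF N(1) wn_pos[OF N(1) nz(1) u] u d] by blast
  obtain b where b: "b \<in> trunc \<delta>" "op_bound (adj (adj B) ** mpow b (- 1 / u)) (wn u (adj B))"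
    using truncation[OF N_adj[OF N(2)] wn_pos[OF N_adj[OF N(2)] nz(2) u] u d] by blast
  have ha: "herm a" "a \<in> N" "herm b" "b \<in> N"
    using trunc_pos_def[OF d] a(1) b(1) by (auto simp: trunc_def pos_def_herm)
  have 1: "op_bound (mpow a (- 1 / u) ** A) (wn u A)"
    using op_bound_adj[OF wn_nonneg a(2)] by (simp add: adj_mult adj_herm[OF herm_mpow[OF ha(1)]])
  have 2: "op_bound (B ** mpow b (- 1 / u)) (wn u B)"
    using b(2) by (simp add: wn_algebra_adj[OF N(2) u])
  have "wn p ((mpow a (- 1 / u) ** A) ** X ** (B ** mpow b (- 1 / u))) \<le> wn u A * wn u B * wn p X"
    using N ha by (intro wn_sandwich[OF p wn_nonneg wn_nonneg 1 2] N_mult mpow_in_N)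
  then show ?thesis using that[OF a(1) b(1)] by (simp add: matrix_mul_assoc)
qed

text \<open>The counterpart for the supremum: \<open>A\<close> is a bounded factor times
  \<open>mpow a (1 / u)\<close>, and \<open>wn u A\<close> in the denominator cancels the bound of
  that factor.\<close>

lemma quotient_upper_bound:
  assumes N: "A \<in> N" "B \<in> N" and u: "u > 0" and p: "p > 0" and d: "\<delta> > 0"
  obtains a b where "a \<in> trunc \<delta>" "b \<in> trunc \<delta>"
    "wn p (A ** Y ** B) / (wn u A * wn u B) \<le> wn p (mpow a (1 / u) ** Y ** mpow b (1 / u))"
proof (cases "A = 0 \<or> B = 0")
  \<comment> \<open>Zero factors belong to the set over which the supremum is taken. Their numerator
    vanishes, so the quotient is 0, also as 0 divided by 0.\<close>
  case True
  have "Gam s 0 = 0" for s by (simp add: Gam_def)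
  then have "wn p (A ** Y ** B) = 0"
    using True p by (auto simp: wn_def sch_def mfun_zero trace_scaleR)
  then show ?thesis using that[OF trunc_scalar trunc_scalar] wn_nonneg by simp
next
  case False
  then have nz: "adj A \<noteq> 0" "B \<noteq> 0" using adj_eq_iff[of A 0] by auto
  have pos: "wn u A > 0" "wn u B > 0" using wn_pos N u False by auto
  obtain a where a: "a \<in> trunc \<delta>" "op_bound (adj (adj A) ** mpow a (- 1 / u)) (wn u (adj A))"
    using truncation[OF N_adj[OF N(1)] wn_pos[OF N_adj[OF N(1)] nz(1) u] u d] by blast
  obtain b where b: "b \<in> trunc \<delta>" "op_bound (adj B ** mpow b (- 1 / u)) (wn u B)"
    using truncation[OF N(2) wn_pos[OF N(2) nz(2) u] u d] by blast
  have pd: "pos_def a" "pos_def b" using trunc_pos_def[OF d] a b by auto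
  have ha: "herm a" "a \<in> N" "herm b" "b \<in> N"
    using pd a(1) b(1) by (auto simp: trunc_def pos_def_herm)
  have 1: "op_bound (A ** mpow a (- 1 / u)) (wn u A)"
    using a(2) by (simp add: wn_algebra_adj[OF N(1) u])
  have 2: "op_bound (mpow b (- 1 / u) ** B) (wn u B)"
    using op_bound_adj[OF wn_nonneg b(2)] by (simp add: adj_mult adj_herm[OF herm_mpow[OF ha(3)]])
  let ?Z = "mpow a (1 / u) ** Y ** mpow b (1 / u)"
  have "wn p ((A ** mpow a (- 1 / u)) ** ?Z ** (mpow b (- 1 / u) ** B)) \<le> wn u A * wn u B * wn p ?Z"
    using N ha by (intro wn_sandwich[OF p wn_nonneg wn_nonneg 1 2] N_mult mpow_in_N)
  moreover have "(A ** mpow a (- 1 / u)) ** ?Z ** (mpow b (- 1 / u) ** B)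
    = A ** (mpow a (- 1 / u) ** mpow a (1 / u)) ** Y ** (mpow b (1 / u) ** mpow b (- 1 / u)) ** B"
    by (simp add: matrix_mul_assoc)
  moreover have "mpow a (- 1 / u) ** mpow a (1 / u) = mat 1" "mpow b (1 / u) ** mpow b (- 1 / u) = mat 1"
    using mpow_inverse[OF pd(1), of "1 / u"] mpow_inverse[OF pd(2), of "1 / u"] by simp_all
  ultimately have "wn p (A ** Y ** B) \<le> wn u A * wn u B * wn p ?Z" by simp
  then have "wn p (A ** Y ** B) / (wn u A * wn u B) \<le> wn p ?Z"
    using pos by (simp add: divide_le_eq mult_ac)
  then show ?thesis using that[OF a(1) b(1)] by blast
qed

end

section \<open>First-order expansions\<close>

text \<open>An expansion X(t) = X0 + t X1(t) + o(t) whose coefficient is only bounded: the auxiliary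
  matrices in the variational formulas depend on t without any regularity.\<close>

definition first_order :: "(real \<Rightarrow> 'a::real_normed_vector) \<Rightarrow> 'a \<Rightarrow> (real \<Rightarrow> 'a) \<Rightarrow> bool" where
  "first_order X X0 X1 \<longleftrightarrow> Zfun (\<lambda>t. (1 / t) *\<^sub>R (X t - X0) - X1 t) (at 0) \<and> Bfun X1 (at 0)"

lemma Bfun_add:
  fixes f g :: "'a \<Rightarrow> 'b::real_normed_vector"
  assumes "Bfun f F" "Bfun g F" shows "Bfun (\<lambda>x. f x + g x) F"
proof -
  obtain A B where "eventually (\<lambda>x. norm (f x) \<le> A) F" "eventually (\<lambda>x. norm (g x) \<le> B) F"
    using assms by (auto elim!: BfunE)
  then have "eventually (\<lambda>x. norm (f x + g x) \<le> A + B) F"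
    by eventually_elim (meson add_mono norm_triangle_le)
  then show ?thesis by (rule BfunI)
qed

lemma Bfun_bounded_linear:
  assumes "bounded_linear h" "Bfun f F" shows "Bfun (\<lambda>x. h (f x)) F"
proof -
  obtain A where A: "eventually (\<lambda>x. norm (f x) \<le> A) F" using assms(2) by (auto elim!: BfunE)
  obtain K where K: "K > 0" "\<And>x. norm (h x) \<le> norm x * K" using bounded_linear.pos_bounded[OF assms(1)] by blast
  have "eventually (\<lambda>x. norm (h (f x)) \<le> A * K) F"
    using A by eventually_elim (meson K mult_right_mono order_trans less_imp_le)
  then show ?thesis by (rule BfunI)
qed

lemma Zfun_Bfun: "Zfun f F \<Longrightarrow> Bfun f F"
  by (rule BfunI[of _ 1]) (auto simp: Zfun_def elim!: allE[of _ 1] eventually_mono)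

lemma eventually_at_0_nonzero: "eventually (\<lambda>t::real. t \<noteq> 0) (at 0)"
  by (simp add: eventually_at_filter)

lemma first_order_quotient_Bfun:
  assumes "first_order X X0 X1" shows "Bfun (\<lambda>t. (1 / t) *\<^sub>R (X t - X0)) (at 0)"
proof -
  have "Bfun (\<lambda>t. ((1 / t) *\<^sub>R (X t - X0) - X1 t) + X1 t) (at 0)"
    using assms by (intro Bfun_add[OF Zfun_Bfun]) (auto simp: first_order_def)
  then show ?thesis by simp
qed

lemma Zfun_ident_at_0: "Zfun (\<lambda>t::real. t) (at 0)"
  using tendsto_Zfun_iff[of "\<lambda>t. t" 0 "at (0::real)"] by (simp add: tendsto_ident_at)

lemma first_order_Zfun:
  assumes "first_order X X0 X1" shows "Zfun (\<lambda>t. X t - X0) (at 0)"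
proof (rule Zfun_ssubst)
  show "Zfun (\<lambda>t. t *\<^sub>R ((1 / t) *\<^sub>R (X t - X0))) (at 0)"
    by (rule bounded_bilinear.Zfun_prod_Bfun[OF bounded_bilinear_scaleR Zfun_ident_at_0 first_order_quotient_Bfun[OF assms]])
  show "eventually (\<lambda>t. X t - X0 = t *\<^sub>R ((1 / t) *\<^sub>R (X t - X0))) (at 0)"
    using eventually_at_0_nonzero by eventually_elim simp
qed

lemma first_order_tendsto: "first_order X X0 X1 \<Longrightarrow> (X \<longlongrightarrow> X0) (at 0)"
  by (simp add: tendsto_Zfun_iff first_order_Zfun)

lemma first_order_linear:
  assumes h: "bounded_linear h" and X: "first_order X X0 X1"
  shows "first_order (\<lambda>t. h (X t)) (h X0) (\<lambda>t. h (X1 t))"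
proof -
  interpret bounded_linear h by (rule h)
  have "Zfun (\<lambda>t. h ((1 / t) *\<^sub>R (X t - X0) - X1 t)) (at 0)"
    using X by (intro Zfun) (simp add: first_order_def)
  moreover have "Bfun (\<lambda>t. h (X1 t)) (at 0)"
    using X by (intro Bfun_bounded_linear[OF h]) (simp add: first_order_def)
  ultimately show ?thesis by (simp add: first_order_def diff scaleR)
qed

text \<open>Product rule; the extra term is the null factor \<open>X t - X0\<close> times a bounded
  difference quotient.\<close>

lemma first_order_bilinear:
  assumes h: "bounded_bilinear h" and X: "first_order X X0 X1" and Y: "first_order Y Y0 Y1"
  shows "first_order (\<lambda>t. h (X t) (Y t)) (h X0 Y0) (\<lambda>t. h (X1 t) Y0 + h X0 (Y1 t))"
proof -
  interpret bounded_bilinear h by (rule h)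
  have "Zfun (\<lambda>t. h ((1 / t) *\<^sub>R (X t - X0) - X1 t) Y0 + h X0 ((1 / t) *\<^sub>R (Y t - Y0) - Y1 t)
       + h (X t - X0) ((1 / t) *\<^sub>R (Y t - Y0))) (at 0)"
    using X Y by (intro Zfun_add Zfun_left Zfun_right Zfun_prod_Bfun first_order_Zfun[OF X] first_order_quotient_Bfun[OF Y])
      (auto simp: first_order_def)
  then have "Zfun (\<lambda>t. (1 / t) *\<^sub>R (h (X t) (Y t) - h X0 Y0) - (h (X1 t) Y0 + h X0 (Y1 t))) (at 0)"
    by (simp only: diff_left diff_right scaleR_left scaleR_right scaleR_diff_right) (simp add: algebra_simps)
  moreover have "Bfun (\<lambda>t. h (X1 t) Y0 + h X0 (Y1 t)) (at 0)"
    using X Y by (intro Bfun_add Bfun_bounded_linear[OF bounded_linear_left] Bfun_bounded_linear[OF bounded_linear_right])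
      (auto simp: first_order_def)
  ultimately show ?thesis by (simp add: first_order_def)
qed

lemma first_order_vector_derivative:
  assumes "(f has_vector_derivative d) (at 0)" shows "first_order f (f 0) (\<lambda>t. d)"
proof -
  have "((\<lambda>t. (f t - f 0 - t *\<^sub>R d) /\<^sub>R norm t) \<longlongrightarrow> 0) (at 0)"
    using assms by (simp add: has_vector_derivative_def has_derivative_at2 divide_inverse diff_diff_eq)
  then have "Zfun (\<lambda>t. (f t - f 0 - t *\<^sub>R d) /\<^sub>R norm t) (at 0)" by (simp add: tendsto_Zfun_iff)
  then have "Zfun (\<lambda>t. (1 / t) *\<^sub>R (f t - f 0) - d) (at 0)"
  proof (rule Zfun_imp_Zfun[of _ _ _ 1])
    show "eventually (\<lambda>t. norm ((1 / t) *\<^sub>R (f t - f 0) - d) \<le> norm ((f t - f 0 - t *\<^sub>R d) /\<^sub>R norm t) * 1) (at 0)"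
      using eventually_at_0_nonzero
    proof eventually_elim
      case (elim t)
      have "(1 / t) *\<^sub>R (f t - f 0) - d = (1 / t) *\<^sub>R (f t - f 0 - t *\<^sub>R d)"
        using elim by (simp add: scaleR_diff_right)
      then show ?case by (simp add: divide_inverse)
    qed
  qed
  then show ?thesis by (simp add: first_order_def)
qed

text \<open>Caratheodory's slope function is continuous at \<open>X0\<close> and avoids division by
  \<open>X t - X0\<close>, which may vanish for \<open>t\<close> other than 0.\<close>

lemma first_order_compose:
  fixes X :: "real \<Rightarrow> real"
  assumes X: "first_order X X0 X1" and f: "(f has_real_derivative d) (at X0)"
  shows "first_order (\<lambda>t. f (X t)) (f X0) (\<lambda>t. d * X1 t)"
proof -
  obtain g where g: "\<forall>z. f z - f X0 = g z * (z - X0)" "isCont g X0" "g X0 = d"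
    using f unfolding CARAT_DERIV by blast
  have "((\<lambda>t. g (X t)) \<longlongrightarrow> d) (at 0)"
    using isCont_tendsto_compose[OF g(2) first_order_tendsto[OF X]] g(3) by simp
  then have Z: "Zfun (\<lambda>t. g (X t) - d) (at 0)" by (simp add: tendsto_Zfun_iff)
  have "Zfun (\<lambda>t. (g (X t) - d) * ((1 / t) *\<^sub>R (X t - X0)) + d * ((1 / t) *\<^sub>R (X t - X0) - X1 t)) (at 0)"
    using X by (intro Zfun_add bounded_bilinear.Zfun_prod_Bfun[OF bounded_bilinear_mult Z first_order_quotient_Bfun[OF X]]
        Zfun_mult_right) (simp add: first_order_def)
  moreover have "(g (X t) - d) * ((1 / t) *\<^sub>R (X t - X0)) + d * ((1 / t) *\<^sub>R (X t - X0) - X1 t)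
     = (1 / t) *\<^sub>R (f (X t) - f X0) - d * X1 t" for t
    by (simp only: g(1)[rule_format, of "X t"]) (simp add: algebra_simps)
  ultimately have "Zfun (\<lambda>t. (1 / t) *\<^sub>R (f (X t) - f X0) - d * X1 t) (at 0)" by simp
  moreover have "Bfun (\<lambda>t. d * X1 t) (at 0)"
    using X by (intro Bfun_bounded_linear[OF bounded_linear_mult_right]) (simp add: first_order_def)
  ultimately show ?thesis by (simp add: first_order_def)
qed

section \<open>Powers of matrices and traces of powers\<close>

lemma norm_mfun_le:
  fixes A :: "complex^'n::finite^'n"
  assumes A: "diagonalizes U l A" and f: "\<And>i. \<bar>f (l i)\<bar> \<le> B"
  shows "norm (mfun f A) \<le> real CARD('n) * B"
proof -
  have B: "B \<ge> 0" using f[of undefined] by linarith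
  have "(norm (mfun f A))\<^sup>2 = (\<Sum>i\<in>UNIV. (f (l i))\<^sup>2)" by (rule norm_mfun[OF A])
  also have "\<dots> \<le> (\<Sum>i\<in>(UNIV::'n set). B\<^sup>2)"
    using f B by (intro sum_mono) (simp add: abs_le_square_iff[symmetric])
  also have "\<dots> = real CARD('n) * B\<^sup>2" by simp
  also have "\<dots> \<le> (real CARD('n))\<^sup>2 * B\<^sup>2"
  proof (rule mult_right_mono)
    have "1 \<le> real CARD('n)" by (simp add: Suc_leI)
    then show "real CARD('n) \<le> (real CARD('n))\<^sup>2" by (simp add: power2_eq_square)
  qed simp
  finally show ?thesis using B by (simp add: power_mult_distrib[symmetric] abs_le_square_iff[symmetric])
qed

text \<open>The upper bound combines \<open>exp y * (1 - y) \<le> 1\<close> with the fact that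
  \<open>1 / (1 - y)\<close> is at most \<open>1 + y + 2 * y\<^sup>2\<close> for \<open>y\<close> up
  to one half.\<close>

lemma exp_second_order:
  fixes y :: real assumes "\<bar>y\<bar> \<le> 1 / 2" shows "\<bar>exp y - 1 - y\<bar> \<le> 2 * y\<^sup>2"
proof -
  have "1 + (- y) \<le> exp (- y)" by (rule exp_ge_add_one_self)
  then have "exp y * (1 - y) \<le> exp y * exp (- y)" by (intro mult_left_mono) auto
  then have "exp y * (1 - y) \<le> 1" by (simp add: exp_minus)
  moreover have "1 \<le> (1 + y + 2 * y\<^sup>2) * (1 - y)"
  proof -
    have "(1 + y + 2 * y\<^sup>2) * (1 - y) - 1 = y\<^sup>2 * (1 - 2 * y)" by (simp add: power2_eq_square algebra_simps)
    moreover have "y\<^sup>2 * (1 - 2 * y) \<ge> 0" using assms by (intro mult_nonneg_nonneg) auto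
    ultimately show ?thesis by linarith
  qed
  ultimately have "exp y * (1 - y) \<le> (1 + y + 2 * y\<^sup>2) * (1 - y)" by linarith
  then have "exp y \<le> 1 + y + 2 * y\<^sup>2" using assms mult_right_le_imp_le[of "exp y" "1 - y" "1 + y + 2 * y\<^sup>2"] by auto
  then show ?thesis using exp_ge_add_one_self[of y] zero_le_power2[of y] unfolding abs_le_iff by linarith
qed

lemma ln_bounded_on_interval:
  fixes m M :: real assumes "m > 0"
  shows "\<exists>B>0. \<forall>x\<in>{m..M}. \<bar>ln x\<bar> \<le> B"
proof (intro exI[of _ "\<bar>ln m\<bar> + \<bar>ln M\<bar> + 1"] conjI ballI)
  fix x assume "x \<in> {m..M}"
  then have "ln m \<le> ln x" "ln x \<le> ln M" using assms by auto
  then show "\<bar>ln x\<bar> \<le> \<bar>ln m\<bar> + \<bar>ln M\<bar> + 1" by linarith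
qed simp

text \<open>\<open>mpow a s\<close> is the exponential of \<open>s\<close> times the logarithm of
  \<open>a\<close>. The bounds \<open>m\<close> and \<open>M\<close> control the logarithm for all
  weights at once, so the second-order remainder is uniform and \<open>a\<close> may jump with
  \<open>t\<close>.\<close>

lemma first_order_mpow:
  fixes a :: "real \<Rightarrow> complex^'n::finite^'n"
  assumes s: "first_order s 0 (\<lambda>t. s')" and m: "m > 0"
    and a: "\<And>t. psd (a t - m *\<^sub>R mat 1)" "\<And>t. psd (M *\<^sub>R mat 1 - a t)"
  shows "first_order (\<lambda>t. mpow (a t) (s t)) (mat 1) (\<lambda>t. s' *\<^sub>R mfun ln (a t))"
proof -
  obtain B where B: "B > 0" "\<forall>x\<in>{m..M}. \<bar>ln x\<bar> \<le> B" using ln_bounded_on_interval[OF m] by blast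
  have h: "herm (a t)" for t
    using herm_simps(1)[OF psd_herm[OF a(1)[of t]] herm_simps(3)[OF herm_simps(4), of m]] by simp
  have spec: "\<exists>U l. diagonalizes U l (a t) \<and> (\<forall>i. l i \<in> {m..M})" for t
  proof -
    obtain U l where U: "diagonalizes U l (a t)" using spectral_theorem[OF h] by blast
    then show ?thesis using psd_lower_bound[OF U, of m] psd_upper_bound[OF U, of M] a[of t]
      by (metis atLeastAtMost_iff)
  qed
  let ?n = "real CARD('n)"
  have lnB: "norm (mfun ln (a t)) \<le> ?n * B" for t
  proof -
    obtain U l where "diagonalizes U l (a t)" "\<forall>i. l i \<in> {m..M}" using spec by blast
    then show ?thesis using B by (intro norm_mfun_le) auto
  qed
  then have bl: "Bfun (\<lambda>t. mfun ln (a t)) (at 0)" by (intro BfunI[of _ "?n * B"]) simp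
  define R where "R t = mpow (a t) (s t) - mat 1 - s t *\<^sub>R mfun ln (a t)" for t
  have R: "norm (R t) \<le> ?n * (2 * (s t * B)\<^sup>2)" if st: "\<bar>s t\<bar> * B \<le> 1 / 2" for t
  proof -
    obtain U l where U: "diagonalizes U l (a t)" "\<forall>i. l i \<in> {m..M}" using spec by blast
    have "R t = mfun (\<lambda>x. x powr s t - 1 - s t * ln x) (a t)"
      using mfun_diff[OF h, of "\<lambda>x. x powr s t - 1" "\<lambda>x. s t * ln x" t] mfun_diff[OF h, of "\<lambda>x. x powr s t" "\<lambda>_. 1" t]
        mfun_scaleR[OF h, of "s t" ln t] mfun_const[OF h, of 1 t] by (simp add: R_def mpow_def)
    moreover have "norm (mfun (\<lambda>x. x powr s t - 1 - s t * ln x) (a t)) \<le> ?n * (2 * (s t * B)\<^sup>2)"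
    proof (rule norm_mfun_le[OF U(1)])
      fix i
      have x: "l i > 0" using U(2) m by (metis atLeastAtMost_iff less_le_trans)
      have le: "\<bar>s t * ln (l i)\<bar> \<le> \<bar>s t\<bar> * B" using U(2) B by (simp add: abs_mult mult_left_mono)
      then have "\<bar>exp (s t * ln (l i)) - 1 - s t * ln (l i)\<bar> \<le> 2 * (s t * ln (l i))\<^sup>2"
        using st by (intro exp_second_order) linarith
      also have "\<dots> \<le> 2 * (s t * B)\<^sup>2"
        using le B by (simp add: abs_le_square_iff[symmetric] abs_mult)
      finally show "\<bar>l i powr s t - 1 - s t * ln (l i)\<bar> \<le> 2 * (s t * B)\<^sup>2"
        using x by (simp add: powr_def mult.commute)
    qed
    ultimately show ?thesis by simp
  qed
  have sZ: "Zfun s (at 0)" using first_order_Zfun[OF s] by simp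
  have sq: "Bfun (\<lambda>t. (1 / t) *\<^sub>R s t) (at 0)" using first_order_quotient_Bfun[OF s] by simp
  have "Zfun (\<lambda>t. s t * ((1 / t) *\<^sub>R s t)) (at 0)"
    by (rule bounded_bilinear.Zfun_prod_Bfun[OF bounded_bilinear_mult sZ sq])
  then have "Zfun (\<lambda>t. (1 / t) *\<^sub>R R t) (at 0)"
  proof (rule Zfun_imp_Zfun[of _ _ _ "?n * 2 * B\<^sup>2"])
    have "eventually (\<lambda>t. \<bar>s t\<bar> < 1 / (2 * B)) (at 0)"
      using ZfunD[OF sZ, of "1 / (2 * B)"] B by simp
    then show "eventually (\<lambda>t. norm ((1 / t) *\<^sub>R R t) \<le> norm (s t * ((1 / t) *\<^sub>R s t)) * (?n * 2 * B\<^sup>2)) (at 0)"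
    proof eventually_elim
      case (elim t)
      then have "\<bar>s t\<bar> * B \<le> 1 / 2" using B by (simp add: field_simps)
      from R[OF this] have "\<bar>1 / t\<bar> * norm (R t) \<le> \<bar>1 / t\<bar> * (?n * (2 * (s t * B)\<^sup>2))" by (intro mult_left_mono) auto
      moreover have "norm (s t * ((1 / t) *\<^sub>R s t)) = \<bar>1 / t\<bar> * (s t)\<^sup>2"
        by (simp add: abs_mult power2_eq_square)
      then have "norm (s t * ((1 / t) *\<^sub>R s t)) * (?n * 2 * B\<^sup>2) = \<bar>1 / t\<bar> * (?n * (2 * (s t * B)\<^sup>2))"
        by (simp only: power_mult_distrib mult_ac)
      ultimately show ?case unfolding norm_scaleR by linarith
    qed
  qed
  moreover have "Zfun (\<lambda>t. ((1 / t) *\<^sub>R s t - s') *\<^sub>R mfun ln (a t)) (at 0)"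
    using s bl by (intro bounded_bilinear.Zfun_prod_Bfun[OF bounded_bilinear_scaleR]) (simp_all add: first_order_def)
  ultimately have "Zfun (\<lambda>t. (1 / t) *\<^sub>R R t + ((1 / t) *\<^sub>R s t - s') *\<^sub>R mfun ln (a t)) (at 0)" by (rule Zfun_add)
  moreover have "(1 / t) *\<^sub>R R t + ((1 / t) *\<^sub>R s t - s') *\<^sub>R mfun ln (a t)
     = (1 / t) *\<^sub>R (mpow (a t) (s t) - mat 1) - s' *\<^sub>R mfun ln (a t)" for t
    by (simp add: R_def scaleR_diff_right scaleR_diff_left)
  ultimately show ?thesis using Bfun_bounded_linear[OF bounded_linear_scaleR_right bl]
    by (simp add: first_order_def)
qed

text \<open>The interval from \<open>1 / c\<close> to \<open>c\<close> is invariant under inversion,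
  so one bound covers positive and negative exponents.\<close>

lemma powr_bound_abs:
  fixes z c e d :: real assumes "c \<ge> 1" "1 / c \<le> z" "z \<le> c" "\<bar>e\<bar> \<le> d"
  shows "z powr e \<le> c powr d"
proof -
  have z: "z > 0" using assms by (smt (verit) divide_pos_pos)
  have "z powr e \<le> c powr \<bar>e\<bar>"
  proof (cases "e \<ge> 0")
    case True
    then show ?thesis using assms z by (simp add: powr_mono2)
  next
    case False
    have "z powr e = (1 / z) powr (- e)" using z by (simp add: powr_divide powr_minus field_simps)
    also have "\<dots> \<le> c powr (- e)" using False z assms by (intro powr_mono2) (auto simp: field_simps)
    finally show ?thesis using False by simp
  qed
  also have "\<dots> \<le> c powr d" using assms by (intro powr_mono) auto
  finally show ?thesis .
qed

text \<open>Taylor's formula of first order. The constant bounds the second derivative for all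
  exponents at once: \<open>(D + 1)\<^sup>2\<close> for the coefficient \<open>u * (u - 1)\<close>
  and \<open>c powr (D + 2)\<close> for the power \<open>u - 2\<close>.\<close>

lemma powr_second_order:
  fixes x y c u D :: real
  assumes c: "c \<ge> 1" and x: "x \<in> {1 / c..c}" and y: "y \<in> {1 / c..c}" and u: "\<bar>u\<bar> \<le> D"
  shows "\<bar>y powr u - x powr u - u * x powr (u - 1) * (y - x)\<bar> \<le> (D + 1)\<^sup>2 * c powr (D + 2) * (y - x)\<^sup>2"
proof -
  define f where "f k z = (if k = 0 then z powr u else if k = 1 then u * z powr (u - 1) else u * (u - 1) * z powr (u - 2))"
    for k :: nat and z :: real
  have "norm (f 0 y - (\<Sum>i\<le>1. f i x * (y - x) ^ i / fact i)) \<le> (D + 1)\<^sup>2 * c powr (D + 2) * norm (y - x) ^ Suc 1 / fact 1"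
  proof (rule field_Taylor[where S = "{1 / c..c}"])
    show "convex {1 / c..c}" by simp
    fix i :: nat and z assume z: "z \<in> {1 / c..c}"
    then have z0: "z > 0" using c by (smt (verit) atLeastAtMost_iff divide_pos_pos)
    {
      assume "i \<le> 1"
      then consider "i = 0" | "i = 1" by linarith
      then show "(f i has_field_derivative f (Suc i) z) (at z within {1 / c..c})"
      proof cases
        case 1
        have "((\<lambda>z. z powr u) has_field_derivative u * z powr (u - 1)) (at z within {1 / c..c})"
          by (rule has_field_derivative_at_within[OF has_real_derivative_powr[OF z0]])
        then show ?thesis using 1 by (simp add: f_def[abs_def])
      next
        case 2
        have "((\<lambda>z. u * z powr (u - 1)) has_field_derivative u * (u - 1) * z powr (u - 2)) (at z within {1 / c..c})"
          using has_field_derivative_at_within[OF DERIV_cmult[OF has_real_derivative_powr[OF z0, of "u - 1"], of u], of "{1 / c..c}"]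
          by (simp add: mult_ac)
        then show ?thesis using 2 by (simp add: f_def[abs_def])
      qed
    }
    have "norm (f (Suc 1) z) = \<bar>u\<bar> * \<bar>u - 1\<bar> * z powr (u - 2)" by (simp add: f_def abs_mult)
    also have "\<dots> \<le> (D + 1) * (D + 1) * c powr (D + 2)"
      using u z c by (intro mult_mono powr_bound_abs) auto
    finally show "norm (f (Suc 1) z) \<le> (D + 1)\<^sup>2 * c powr (D + 2)" by (simp add: power2_eq_square)
  qed (use x y in auto)
  then show ?thesis by (simp add: f_def power2_eq_square algebra_simps)
qed

lemma herm_norm_bound:
  assumes "herm H" "norm H \<le> c" shows "psd (c *\<^sub>R mat 1 - H)" "psd (H - (- c) *\<^sub>R mat 1)"
proof -
  obtain U l where U: "diagonalizes U l H" using spectral_theorem[OF assms(1)] by blast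
  have n: "(norm H)\<^sup>2 = (\<Sum>i\<in>UNIV. (l i)\<^sup>2)" using norm_mfun[OF U, of "\<lambda>x. x"] assms(1) by simp
  have "\<bar>l i\<bar> \<le> c" for i
  proof -
    have "(l i)\<^sup>2 \<le> (norm H)\<^sup>2" unfolding n by (rule member_le_sum) auto
    then have "\<bar>l i\<bar> \<le> norm H" by (simp add: abs_le_square_iff[symmetric])
    then show ?thesis using assms(2) by simp
  qed
  then show "psd (c *\<^sub>R mat 1 - H)" "psd (H - (- c) *\<^sub>R mat 1)"
    using psd_upper_bound[OF U, of c] psd_lower_bound[OF U, of "- c"] by (auto simp: abs_le_iff minus_le_iff)
qed

lemma tendsto_mfun:
  fixes A :: "complex^'n::finite^'n"
  assumes A: "diagonalizes U l A" and f: "\<And>i. ((\<lambda>t. f t (l i)) \<longlongrightarrow> g (l i)) F"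
  shows "((\<lambda>t. mfun (f t) A) \<longlongrightarrow> mfun g A) F"
proof -
  have "((\<lambda>t. diag_mat (\<lambda>i. complex_of_real (f t (l i)))) \<longlongrightarrow> diag_mat (\<lambda>i. complex_of_real (g (l i)))) F"
  proof (intro vec_tendstoI)
    fix i j
    show "((\<lambda>t. diag_mat (\<lambda>i. complex_of_real (f t (l i))) $ i $ j) \<longlongrightarrow> diag_mat (\<lambda>i. complex_of_real (g (l i))) $ i $ j) F"
      using f by (cases "i = j") (auto simp: diag_mat_nth intro!: tendsto_of_real)
  qed
  then show ?thesis unfolding mfun_eq[OF A] by (intro tendsto_mat_mult tendsto_const)
qed

text \<open>Matrix and exponent move together. The increment splits into a Taylor remainder in the
  matrix at the current exponent, the change of exponent at the fixed \<open>K0\<close>, and a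
  linear term whose slope converges. The remainder is controlled because its bound is uniform in the
  exponent.\<close>

lemma first_order_trace_power:
  fixes K :: "real \<Rightarrow> complex^'n::finite^'n"
  assumes K: "first_order K K0 K1" "\<And>t. herm (K t)" and K0: "pos_def K0"
    and u: "(u has_real_derivative u') (at 0)"
  shows "first_order (\<lambda>t. Re (trace (mfun (\<lambda>x. x powr u t) (K t)))) (Re (trace (mfun (\<lambda>x. x powr u 0) K0)))
    (\<lambda>t. u' * Re (trace (mfun (\<lambda>x. x powr u 0 * ln x) K0)) + Re (trace (mfun (\<lambda>x. u 0 * x powr (u 0 - 1)) K0 ** K1 t)))"
proof -
  have h0: "herm K0" using K0 by (rule pos_def_herm)
  obtain U l where U: "diagonalizes U l K0" using spectral_theorem[OF h0] by blast
  have l: "l i > 0" for i using K0 pos_def_diagonalizes[OF U] by simp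
  obtain m where m: "m > 0" "psd (K0 - m *\<^sub>R mat 1)" using pos_def_lower_bound[OF K0] .
  obtain M where M: "M > 0" "psd (M *\<^sub>R mat 1 - K0)" using herm_upper_bound[OF h0] .
  \<comment> \<open>The interval from \<open>1 / c\<close> to \<open>c\<close> contains the spectrum
    of \<open>K0\<close>, which lies between \<open>m\<close> and \<open>M\<close>, and that of
    every Hermitian matrix at distance at most \<open>m / 2\<close> from \<open>K0\<close>.\<close>
  define c where "c = max 1 (max (M + m / 2) (2 / m))"
  have c: "c \<ge> 1" "1 / c \<le> m / 2" "M + m / 2 \<le> c"
  proof -
    show "c \<ge> 1" "M + m / 2 \<le> c" by (auto simp: c_def)
    have "2 / m \<le> c" by (auto simp: c_def)
    then show "1 / c \<le> m / 2" using m \<open>c \<ge> 1\<close> by (simp add: field_simps)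
  qed
  define D where "D = \<bar>u 0\<bar> + 1"
  have isc: "isCont u 0" using u by (rule DERIV_isCont)
  then have ulim: "(u \<longlongrightarrow> u 0) (at 0)" by (simp add: isCont_def)
  have evu: "eventually (\<lambda>t. \<bar>u t\<bar> \<le> D) (at 0)"
    using tendstoD[OF ulim, of 1] by (rule eventually_mono) (auto simp: D_def dist_real_def)
  have evK: "eventually (\<lambda>t. norm (K t - K0) \<le> m / 2) (at 0)"
    using ZfunD[OF first_order_Zfun[OF K(1)], of "m / 2"] m by (auto elim: eventually_mono)
  let ?C = "(D + 1)\<^sup>2 * c powr (D + 2)"
  define f' where "f' t x = u t * x powr (u t - 1)" for t x
  have shift: "psd (A - r *\<^sub>R mat 1)" if "psd (A - r' *\<^sub>R mat 1)" "r \<le> r'" for A :: "complex^'n^'n" and r r'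
    using psd_add[OF that(1) psd_scaleR[OF psd_one, of "r' - r"]] that(2) by (simp add: scaleR_diff_left)
  have shift': "psd (r *\<^sub>R mat 1 - A)" if "psd (r' *\<^sub>R mat 1 - A)" "r' \<le> r" for A :: "complex^'n^'n" and r r'
    using psd_add[OF that(1) psd_scaleR[OF psd_one, of "r - r'"]] that(2) by (simp add: scaleR_diff_left)
  define T where "T t = Re (trace (mfun (\<lambda>x. x powr u t) (K t))) - Re (trace (mfun (\<lambda>x. x powr u t) K0))
    - Re (trace (mfun (f' t) K0 ** (K t - K0)))" for t
  have evT: "eventually (\<lambda>t. \<bar>T t\<bar> \<le> ?C * (norm (K t - K0))\<^sup>2) (at 0)"
    using evu evK
  proof eventually_elim
    case (elim t)
    have hK: "herm (K t - K0)" using K(2) h0 by (intro herm_simps)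
    have lo: "psd (K t - (1 / c) *\<^sub>R mat 1)"
    proof (rule shift[OF _ c(2)])
      have "m *\<^sub>R mat 1 = (m / 2) *\<^sub>R mat 1 + (m / 2) *\<^sub>R (mat 1 :: complex^'n^'n)"
        unfolding scaleR_left_distrib[symmetric] by simp
      then have eq: "K t - (m / 2) *\<^sub>R mat 1 = (K0 - m *\<^sub>R mat 1) + ((K t - K0) - (- (m / 2)) *\<^sub>R mat 1)"
        by (simp add: algebra_simps)
      show "psd (K t - (m / 2) *\<^sub>R mat 1)" unfolding eq by (rule psd_add[OF m(2) herm_norm_bound(2)[OF hK elim(2)]])
    qed
    have hi: "psd (c *\<^sub>R mat 1 - K t)"
    proof (rule shift'[OF _ c(3)])
      have eq: "(M + m / 2) *\<^sub>R mat 1 - K t = (M *\<^sub>R mat 1 - K0) + ((m / 2) *\<^sub>R mat 1 - (K t - K0))"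
        by (simp add: scaleR_left_distrib)
      show "psd ((M + m / 2) *\<^sub>R mat 1 - K t)" unfolding eq by (rule psd_add[OF M(2) herm_norm_bound(1)[OF hK elim(2)]])
    qed
    have "\<bar>Re (trace (mfun (\<lambda>x. x powr u t) (K t))) - Re (trace (mfun (\<lambda>x. x powr u t) K0))
       - Re (trace (mfun (f' t) K0 ** (K t - K0)))\<bar> \<le> ?C * (norm (K t - K0))\<^sup>2"
    proof (rule trace_mfun_taylor[OF h0 K(2) _ _ lo hi])
      show "psd (K0 - (1 / c) *\<^sub>R mat 1)" using m c by (intro shift[OF m(2)]) linarith
      show "psd (c *\<^sub>R mat 1 - K0)" using m c by (intro shift'[OF M(2)]) linarith
      show "\<bar>y powr u t - x powr u t - f' t x * (y - x)\<bar> \<le> ?C * (y - x)\<^sup>2" if "x \<in> {1 / c..c}" "y \<in> {1 / c..c}" for x y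
        unfolding f'_def by (rule powr_second_order[OF c(1) that elim(1)])
    qed
    then show ?case by (simp add: T_def)
  qed
  have Bq: "Bfun (\<lambda>t. (1 / t) *\<^sub>R (K t - K0)) (at 0)" by (rule first_order_quotient_Bfun[OF K(1)])
  have "Zfun (\<lambda>t. norm (K t - K0) * norm ((1 / t) *\<^sub>R (K t - K0))) (at 0)"
    using first_order_Zfun[OF K(1)] Bq
    by (intro bounded_bilinear.Zfun_prod_Bfun[OF bounded_bilinear_mult]) (auto simp: Zfun_norm_iff Bfun_def)
  then have ZT: "Zfun (\<lambda>t. (1 / t) *\<^sub>R T t) (at 0)"
  proof (rule Zfun_imp_Zfun[of _ _ _ ?C])
    show "eventually (\<lambda>t. norm ((1 / t) *\<^sub>R T t) \<le> norm (norm (K t - K0) * norm ((1 / t) *\<^sub>R (K t - K0))) * ?C) (at 0)"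
      using evT
    proof eventually_elim
      case (elim t)
      then have "\<bar>1 / t\<bar> * \<bar>T t\<bar> \<le> \<bar>1 / t\<bar> * (?C * (norm (K t - K0))\<^sup>2)" by (intro mult_left_mono) auto
      then show ?case by (simp add: abs_mult power2_eq_square mult_ac)
    qed
  qed
  have "((\<lambda>t. \<Sum>i\<in>UNIV. l i powr u t) has_real_derivative (\<Sum>i\<in>UNIV. u' * (l i powr u 0 * ln (l i)))) (at 0)"
  proof (rule DERIV_sum)
    fix i
    have "((\<lambda>t. exp (u t * ln (l i))) has_real_derivative exp (u 0 * ln (l i)) * (u' * ln (l i))) (at 0)"
      using u by (auto intro!: derivative_eq_intros)
    then show "((\<lambda>t. l i powr u t) has_real_derivative u' * (l i powr u 0 * ln (l i))) (at 0)"
      using l[of i] by (simp add: powr_def mult_ac)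
  qed
  then have "((\<lambda>t. Re (trace (mfun (\<lambda>x. x powr u t) K0))) has_vector_derivative
      u' * Re (trace (mfun (\<lambda>x. x powr u 0 * ln x) K0))) (at 0)"
    by (simp add: trace_mfun[OF U] sum_distrib_left has_real_derivative_iff_has_vector_derivative)
  from first_order_vector_derivative[OF this]
  have Zd: "Zfun (\<lambda>t. (1 / t) *\<^sub>R (Re (trace (mfun (\<lambda>x. x powr u t) K0)) - Re (trace (mfun (\<lambda>x. x powr u 0) K0)))
     - u' * Re (trace (mfun (\<lambda>x. x powr u 0 * ln x) K0))) (at 0)" by (simp add: first_order_def)
  have "((\<lambda>t. mfun (f' t) K0) \<longlongrightarrow> mfun (f' 0) K0) (at 0)"
    unfolding f'_def using l
    by (intro tendsto_mfun[OF U] tendsto_intros ulim) (auto simp: less_imp_neq[symmetric])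
  then have Zf: "Zfun (\<lambda>t. mfun (f' t) K0 - mfun (f' 0) K0) (at 0)" by (simp add: tendsto_Zfun_iff)
  have bt: "bounded_linear (\<lambda>X::complex^'n^'n. Re (trace X))"
    by (intro bounded_linear_compose[OF bounded_linear_Re] bounded_linear_trace)
  have Zl: "Zfun (\<lambda>t. Re (trace ((mfun (f' t) K0 - mfun (f' 0) K0) ** ((1 / t) *\<^sub>R (K t - K0))
     + mfun (f' 0) K0 ** ((1 / t) *\<^sub>R (K t - K0) - K1 t)))) (at 0)"
    using K(1) by (intro bounded_linear.Zfun[OF bt] Zfun_add bounded_bilinear.Zfun_prod_Bfun[OF bounded_bilinear_mat_mult Zf Bq]
        bounded_bilinear.Zfun_right[OF bounded_bilinear_mat_mult]) (simp add: first_order_def)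
  have f'0: "f' 0 = (\<lambda>x. u 0 * x powr (u 0 - 1))" by (simp add: f'_def[abs_def])
  have "Zfun (\<lambda>t. (1 / t) *\<^sub>R (Re (trace (mfun (\<lambda>x. x powr u t) (K t))) - Re (trace (mfun (\<lambda>x. x powr u 0) K0)))
     - (u' * Re (trace (mfun (\<lambda>x. x powr u 0 * ln x) K0)) + Re (trace (mfun (f' 0) K0 ** K1 t)))) (at 0)"
  proof (rule Zfun_ssubst[OF always_eventually Zfun_add[OF Zfun_add[OF ZT Zd] Zl]], rule allI)
    fix t
    have "(1 / t) * Re (trace (mfun (f' t) K0 ** (K t - K0))) = Re (trace (mfun (f' t) K0 ** ((1 / t) *\<^sub>R (K t - K0))))"
      by (simp add: mat_scaleR_mult trace_scaleR)
    then have "Re (trace ((mfun (f' t) K0 - mfun (f' 0) K0) ** ((1 / t) *\<^sub>R (K t - K0))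
     + mfun (f' 0) K0 ** ((1 / t) *\<^sub>R (K t - K0) - K1 t)))
     = (1 / t) * Re (trace (mfun (f' t) K0 ** (K t - K0))) - Re (trace (mfun (f' 0) K0 ** K1 t))"
      by (simp only: mat_diff_distrib trace_add trace_sub minus_complex.simps plus_complex.simps)
    then show "(1 / t) *\<^sub>R (Re (trace (mfun (\<lambda>x. x powr u t) (K t))) - Re (trace (mfun (\<lambda>x. x powr u 0) K0)))
     - (u' * Re (trace (mfun (\<lambda>x. x powr u 0 * ln x) K0)) + Re (trace (mfun (f' 0) K0 ** K1 t)))
     = (1 / t) *\<^sub>R T t + ((1 / t) *\<^sub>R (Re (trace (mfun (\<lambda>x. x powr u t) K0)) - Re (trace (mfun (\<lambda>x. x powr u 0) K0)))
     - u' * Re (trace (mfun (\<lambda>x. x powr u 0 * ln x) K0))) + Re (trace ((mfun (f' t) K0 - mfun (f' 0) K0) ** ((1 / t) *\<^sub>R (K t - K0))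
     + mfun (f' 0) K0 ** ((1 / t) *\<^sub>R (K t - K0) - K1 t)))"
      by (simp add: T_def algebra_simps)
  qed
  moreover have "Bfun (\<lambda>t. u' * Re (trace (mfun (\<lambda>x. x powr u 0 * ln x) K0)) + Re (trace (mfun (f' 0) K0 ** K1 t))) (at 0)"
    using K(1) by (intro Bfun_add Bfun_const Bfun_bounded_linear[OF bt]
        Bfun_bounded_linear[OF bounded_bilinear.bounded_linear_right[OF bounded_bilinear_mat_mult]]) (simp add: first_order_def)
  ultimately show ?thesis by (simp add: first_order_def f'0)
qed

lemma first_order_cong:
  assumes "first_order X X0 X1" "eventually (\<lambda>t. Y t = X t) (at 0)"
  shows "first_order Y X0 X1"
proof -
  have "Zfun (\<lambda>t. (1 / t) *\<^sub>R (Y t - X0) - X1 t) (at 0)"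
  proof (rule Zfun_ssubst)
    show "eventually (\<lambda>t. (1 / t) *\<^sub>R (Y t - X0) - X1 t = (1 / t) *\<^sub>R (X t - X0) - X1 t) (at 0)"
      using assms(2) by eventually_elim simp
  qed (use assms(1) in \<open>simp add: first_order_def\<close>)
  then show ?thesis using assms(1) by (simp add: first_order_def)
qed

lemmas first_order_mult = first_order_bilinear[OF bounded_bilinear_mat_mult]

lemma mfun_square:
  assumes "herm Z" shows "mfun f (Z ** Z) = mfun (\<lambda>x. f (x * x)) Z"
  using mfun_mult[OF assms, of "\<lambda>x. x" "\<lambda>x. x"] mfun_mfun[OF assms, of f "\<lambda>x. x * x"] assms by simp

lemma pos_def_square: "pos_def Z \<Longrightarrow> pos_def (Z ** Z)"
  using pos_def_mfun[of Z "\<lambda>x. x * x"] mfun_mult[OF pos_def_herm, of Z "\<lambda>x. x" "\<lambda>x. x"] by (simp add: pos_def_herm)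

lemma square_powr: "x > 0 \<Longrightarrow> (x * x) powr (r / 2) = x powr r" for x :: real
proof -
  assume "x > 0"
  then have "(x * x) powr (r / 2) = x powr (r / 2) * x powr (r / 2)" by (simp add: powr_mult)
  then show ?thesis by (simp add: powr_add[symmetric])
qed

lemma trace_mpow_pos:
  assumes "pos_def Z" shows "Re (trace (mpow Z r)) > 0"
proof -
  obtain U l where U: "diagonalizes U l Z" using spectral_theorem[OF pos_def_herm[OF assms]] by blast
  have "l i > 0" for i using assms pos_def_diagonalizes[OF U] by simp
  then have "(\<Sum>i\<in>UNIV. l i powr r) > 0" by (intro sum_pos) (auto simp: less_imp_neq[symmetric])
  then show ?thesis by (simp add: mpow_def trace_mfun[OF U])
qed

section \<open>Expansion of the weighted norm\<close>

context tracial_expectation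
begin

lemma Gam_pos_def: "pos_def Y \<Longrightarrow> pos_def (Gam s Y)"
  using pos_def_conj[OF _ invertible_mpow[OF sigma], of Y "s / 2"]
  by (simp add: Gam_def adj_herm[OF herm_mpow[OF hermS]])

lemma bounded_linear_Gam: "bounded_linear (Gam s)"
  unfolding linear_conv_bounded_linear[symmetric] Gam_def
  by (auto intro!: linearI simp: mat_simps)

lemma wn_pos_def:
  assumes "pos_def Y" "q > 0"
  shows "wn q Y = Re (trace (mpow (Gam (1 / q) Y) q)) powr (1 / q)"
proof -
  let ?Z = "Gam (1 / q) Y"
  have Z: "pos_def ?Z" by (rule Gam_pos_def[OF assms(1)])
  have h: "herm ?Z" using Z by (rule pos_def_herm)
  have "mfun (\<lambda>x. x powr (q / 2)) (adj ?Z ** ?Z) = mpow ?Z q"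
    unfolding mpow_def adj_herm[OF h] mfun_square[OF h]
    by (rule mfun_cong_pos_def[OF Z]) (rule square_powr)
  then show ?thesis by (simp add: wn_def sch_def)
qed

text \<open>By \<open>1 / p t / 2 = s t + 1 / q / 2\<close> the outer powers of
  \<open>\<sigma>\<close> split: the moving exponent occurs only in powers close to the identity,
  around the fixed map \<open>Gam (1 / q)\<close>. The norm is the exponential of
  \<open>1 / p t\<close> times the logarithm of a trace, to which the expansion rules apply in
  turn.\<close>

lemma norm_expansion:
  assumes p: "(p has_real_derivative p') (at 0)" "p 0 = q" and q: "q > 0"
    and Y: "(Y has_vector_derivative Y') (at 0)" "pos_def (Y 0)"
    and ab: "\<And>t. a t \<in> N" "\<And>t. b t \<in> N" and m: "m > 0"
    and a: "\<And>t. psd (a t - m *\<^sub>R mat 1)" "\<And>t. psd (M *\<^sub>R mat 1 - a t)"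
    and b: "\<And>t. psd (b t - m *\<^sub>R mat 1)" "\<And>t. psd (M *\<^sub>R mat 1 - b t)"
  defines "s \<equiv> \<lambda>t. (1 / p t - 1 / q) / 2" and "s' \<equiv> - p' / (2 * q\<^sup>2)"
    and "Z \<equiv> Gam (1 / q) (Y 0)"
  defines "G \<equiv> Re (trace (mpow Z q))"
  shows "first_order (\<lambda>t. wn (p t) (mpow (a t) (s t) ** Y t ** mpow (b t) (s t))) (wn q (Y 0))
    (\<lambda>t. wn q (Y 0) * (- p' / q\<^sup>2 * ln G + 1 / (q * G) *
       (p' * Re (trace (mfun (\<lambda>x. x powr q * ln x) Z))
        + q * (2 * s' * Re (trace (mpow Z q ** mfun ln \<sigma>)) + Re (trace (mpow Z (q - 1) ** Gam (1 / q) Y')))))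
      + wn q (Y 0) * s' / G * (Re (trace (mpow Z q ** mfun ln (a t))) + Re (trace (mpow Z q ** mfun ln (b t)))))"
proof -
  have Z: "pos_def Z" unfolding Z_def by (rule Gam_pos_def[OF Y(2)])
  have hZ: "herm Z" using Z by (rule pos_def_herm)
  have G: "G > 0" unfolding G_def by (rule trace_mpow_pos[OF Z])
  have ha: "herm (a t)" "herm (b t)" for t
    using herm_simps(1)[OF psd_herm[OF a(1)[of t]] herm_simps(3)[OF herm_simps(4), of m]]
      herm_simps(1)[OF psd_herm[OF b(1)[of t]] herm_simps(3)[OF herm_simps(4), of m]] by simp_all
  have fp: "first_order p q (\<lambda>t. p')"
    using first_order_vector_derivative[of p p'] p by (simp add: has_real_derivative_iff_has_vector_derivative)
  have inv: "((\<lambda>x. 1 / x) has_real_derivative - (1 / q\<^sup>2)) (at q)"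
    using q by (auto intro!: derivative_eq_intros simp: power2_eq_square)
  have fip: "first_order (\<lambda>t. 1 / p t) (1 / q) (\<lambda>t. - (1 / q\<^sup>2) * p')" by (rule first_order_compose[OF fp inv])
  have "((\<lambda>x. (1 / x - 1 / q) / 2) has_real_derivative - (1 / q\<^sup>2) / 2) (at q)"
    using q by (auto intro!: derivative_eq_intros simp: power2_eq_square)
  from first_order_compose[OF fp this]
  have fs: "first_order s 0 (\<lambda>t. s')" by (simp add: s_def s'_def mult.commute)
  obtain m1 where m1: "m1 > 0" "psd (\<sigma> - m1 *\<^sub>R mat 1)" using pos_def_lower_bound[OF sigma] .
  obtain M1 where M1: "psd (M1 *\<^sub>R mat 1 - \<sigma>)" using herm_upper_bound[OF hermS] .
  have f\<sigma>: "first_order (\<lambda>t. mpow \<sigma> (s t)) (mat 1) (\<lambda>t. s' *\<^sub>R mfun ln \<sigma>)"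
    by (rule first_order_mpow[OF fs m1(1), of "\<lambda>_. \<sigma>"]) (use m1 M1 in auto)
  have fa: "first_order (\<lambda>t. mpow (a t) (s t)) (mat 1) (\<lambda>t. s' *\<^sub>R mfun ln (a t))"
    by (rule first_order_mpow[OF fs m a])
  have fb: "first_order (\<lambda>t. mpow (b t) (s t)) (mat 1) (\<lambda>t. s' *\<^sub>R mfun ln (b t))"
    by (rule first_order_mpow[OF fs m b])
  define Z' where "Z' = Gam (1 / q) Y'"
  have fZ: "first_order (\<lambda>t. Gam (1 / q) (Y t)) Z (\<lambda>t. Z')"
    using first_order_linear[OF bounded_linear_Gam first_order_vector_derivative[OF Y(1)]] by (simp add: Z_def Z'_def)
  define W where "W t = Gam (1 / p t) (mpow (a t) (s t) ** Y t ** mpow (b t) (s t))" for t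
  define W1 where "W1 t = s' *\<^sub>R (mfun ln \<sigma> ** Z + mfun ln (a t) ** Z + Z ** mfun ln (b t) + Z ** mfun ln \<sigma>) + Z'" for t
  have W: "W t = mpow \<sigma> (s t) ** mpow (a t) (s t) ** Gam (1 / q) (Y t) ** mpow (b t) (s t) ** mpow \<sigma> (s t)" for t
  proof -
    have N: "mpow (a t) (s t) \<in> N" "mpow (b t) (s t) \<in> N" using ha ab by (auto intro: mpow_in_N)
    have "1 / p t / 2 = s t + 1 / q / 2" by (simp add: s_def field_simps)
    then have S: "mpow \<sigma> (1 / p t / 2) = mpow \<sigma> (s t) ** mpow \<sigma> (1 / q / 2)"
      by (simp only: mpow_add[OF hermS])
    have S': "mpow \<sigma> (1 / p t / 2) = mpow \<sigma> (1 / q / 2) ** mpow \<sigma> (s t)"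
      unfolding mpow_add[OF hermS] using \<open>1 / p t / 2 = s t + 1 / q / 2\<close> by (simp only: add.commute)
    have "W t = mpow \<sigma> (1 / p t / 2) ** (mpow (a t) (s t) ** Y t ** mpow (b t) (s t)) ** mpow \<sigma> (1 / p t / 2)"
      by (simp only: W_def Gam_def)
    also have "\<dots> = (mpow \<sigma> (s t) ** mpow \<sigma> (1 / q / 2)) ** (mpow (a t) (s t) ** Y t ** mpow (b t) (s t)) ** (mpow \<sigma> (1 / q / 2) ** mpow \<sigma> (s t))"
      by (simp only: S[symmetric] S'[symmetric])
    also have "\<dots> = mpow \<sigma> (s t) ** Gam (1 / q) (mpow (a t) (s t) ** Y t ** mpow (b t) (s t)) ** mpow \<sigma> (s t)"
      by (simp only: Gam_def matrix_mul_assoc)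
    finally show ?thesis by (simp only: Gam_sandwich[OF N] matrix_mul_assoc)
  qed
  have fW: "first_order W Z W1"
  proof -
    have "first_order (\<lambda>t. mpow \<sigma> (s t) ** mpow (a t) (s t) ** Gam (1 / q) (Y t) ** mpow (b t) (s t) ** mpow \<sigma> (s t))
      (mat 1 ** mat 1 ** Z ** mat 1 ** mat 1)
      (\<lambda>t. ((((s' *\<^sub>R mfun ln \<sigma>) ** mat 1 + mat 1 ** (s' *\<^sub>R mfun ln (a t))) ** Z + mat 1 ** mat 1 ** Z') ** mat 1
         + mat 1 ** mat 1 ** Z ** (s' *\<^sub>R mfun ln (b t))) ** mat 1 + mat 1 ** mat 1 ** Z ** mat 1 ** (s' *\<^sub>R mfun ln \<sigma>))"
      by (intro first_order_mult f\<sigma> fa fb fZ)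
    moreover have "(\<lambda>t. ((((s' *\<^sub>R mfun ln \<sigma>) ** mat 1 + mat 1 ** (s' *\<^sub>R mfun ln (a t))) ** Z + mat 1 ** mat 1 ** Z') ** mat 1
         + mat 1 ** mat 1 ** Z ** (s' *\<^sub>R mfun ln (b t))) ** mat 1 + mat 1 ** mat 1 ** Z ** mat 1 ** (s' *\<^sub>R mfun ln \<sigma>)) = W1"
      by (rule ext) (simp add: W1_def mat_simps scaleR_add_right)
    ultimately show ?thesis using W by (simp add: W[abs_def])
  qed
  \<comment> \<open>\<open>W t\<close> is in general not Hermitian when \<open>a t\<close> and
    \<open>b t\<close> differ, hence the detour through \<open>adj (W t) ** W t\<close> and half
    exponents.\<close>
  have fK: "first_order (\<lambda>t. adj (W t) ** W t) (Z ** Z) (\<lambda>t. adj (W1 t) ** Z + Z ** W1 t)"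
    using first_order_mult[OF first_order_linear[OF bounded_linear_adj fW] fW] by (simp add: adj_herm[OF hZ])
  have du: "((\<lambda>t. p t / 2) has_real_derivative p' / 2) (at 0)" using p by (auto intro!: derivative_eq_intros)
  define \<tau> where "\<tau> t = Re (trace (mfun (\<lambda>x. x powr (p t / 2)) (adj (W t) ** W t)))" for t
  define \<tau>1 where "\<tau>1 t = p' * Re (trace (mfun (\<lambda>x. x powr q * ln x) Z)) + q * Re (trace (mpow Z (q - 1) ** W1 t))" for t
  have f\<tau>: "first_order \<tau> G \<tau>1"
  proof -
    have 1: "mfun (\<lambda>x. x powr (q / 2)) (Z ** Z) = mpow Z q"
      unfolding mpow_def mfun_square[OF hZ] by (rule mfun_cong_pos_def[OF Z]) (rule square_powr)
    \<comment> \<open>The factor 2 from the logarithm of a square offsets the derivative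
      \<open>p' / 2\<close> of the half exponent.\<close>
    have 2: "mfun (\<lambda>x. x powr (q / 2) * ln x) (Z ** Z) = 2 *\<^sub>R mfun (\<lambda>x. x powr q * ln x) Z"
      unfolding mfun_square[OF hZ] mfun_scaleR[OF hZ, symmetric]
      by (rule mfun_cong_pos_def[OF Z]) (simp add: square_powr ln_mult)
    have 3: "mfun (\<lambda>x. q / 2 * x powr (q / 2 - 1)) (Z ** Z) = (q / 2) *\<^sub>R mpow Z (q - 2)"
      unfolding mfun_square[OF hZ] mpow_def mfun_scaleR[OF hZ, symmetric]
    proof (rule mfun_cong_pos_def[OF Z])
      fix x :: real assume "x > 0"
      then show "q / 2 * (x * x) powr (q / 2 - 1) = q / 2 * x powr (q - 2)"
        using square_powr[of x "q - 2"] by (simp add: diff_divide_distrib)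
    qed
    \<comment> \<open>The two summands of the product rule have complex conjugate traces.\<close>
    have 4: "Re (trace (mpow Z (q - 2) ** (adj (W1 t) ** Z + Z ** W1 t))) = 2 * Re (trace (mpow Z (q - 1) ** W1 t))" for t
    proof -
      have Zq: "mpow Z (q - 2) ** Z = mpow Z (q - 1)" "Z ** mpow Z (q - 2) = mpow Z (q - 1)"
        using mpow_add[OF hZ, of "q - 2" 1] mpow_add[OF hZ, of 1 "q - 2"] mpow_1[OF pos_def_psd[OF Z]] by simp_all
      have "trace (mpow Z (q - 2) ** (adj (W1 t) ** Z)) = trace ((mpow Z (q - 2) ** adj (W1 t)) ** Z)" by (simp add: matrix_mul_assoc)
      also have "\<dots> = trace (Z ** (mpow Z (q - 2) ** adj (W1 t)))" by (rule trace_cyc)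
      also have "\<dots> = trace (mpow Z (q - 1) ** adj (W1 t))" by (simp add: matrix_mul_assoc Zq)
      also have "\<dots> = trace (adj (W1 t ** mpow Z (q - 1)))" by (simp add: adj_mult adj_herm[OF herm_mpow[OF hZ]])
      also have "\<dots> = cnj (trace (mpow Z (q - 1) ** W1 t))" by (simp add: trace_adj trace_cyc)
      finally have "Re (trace (mpow Z (q - 2) ** (adj (W1 t) ** Z))) = Re (trace (mpow Z (q - 1) ** W1 t))" by simp
      moreover have "mpow Z (q - 2) ** (Z ** W1 t) = mpow Z (q - 1) ** W1 t" by (simp add: matrix_mul_assoc Zq)
      ultimately show ?thesis by (simp add: mat_add_distrib trace_add)
    qed
    have "first_order \<tau> (Re (trace (mfun (\<lambda>x. x powr (p 0 / 2)) (Z ** Z))))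
       (\<lambda>t. p' / 2 * Re (trace (mfun (\<lambda>x. x powr (p 0 / 2) * ln x) (Z ** Z)))
         + Re (trace (mfun (\<lambda>x. p 0 / 2 * x powr (p 0 / 2 - 1)) (Z ** Z) ** (adj (W1 t) ** Z + Z ** W1 t))))"
      unfolding \<tau>_def[abs_def] by (rule first_order_trace_power[OF fK herm_simps(6) pos_def_square[OF Z] du])
    then show ?thesis
      unfolding p(2) 1 2 3 by (simp add: G_def \<tau>1_def[abs_def] trace_scaleR mat_scaleR_mult 4)
  qed
  have dln: "(ln has_real_derivative 1 / G) (at G)" using G by (auto intro!: derivative_eq_intros)
  have fl: "first_order (\<lambda>t. ln (\<tau> t)) (ln G) (\<lambda>t. 1 / G * \<tau>1 t)"
    by (rule first_order_compose[OF f\<tau> dln])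
  have fe: "first_order (\<lambda>t. 1 / p t * ln (\<tau> t)) (1 / q * ln G) (\<lambda>t. - (1 / q\<^sup>2) * p' * ln G + 1 / q * (1 / G * \<tau>1 t))"
    by (rule first_order_bilinear[OF bounded_bilinear_mult fip fl])
  have fx: "first_order (\<lambda>t. exp (1 / p t * ln (\<tau> t))) (exp (1 / q * ln G))
     (\<lambda>t. exp (1 / q * ln G) * (- (1 / q\<^sup>2) * p' * ln G + 1 / q * (1 / G * \<tau>1 t)))"
    by (rule first_order_compose[OF fe DERIV_exp])
  have w0: "exp (1 / q * ln G) = wn q (Y 0)"
    using G wn_pos_def[OF Y(2) q] by (simp add: powr_def G_def Z_def)
  \<comment> \<open>A positive base turns \<open>powr\<close> into \<open>exp\<close> of a
    logarithm; at base 0 it would be 0 by convention.\<close>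
  have "eventually (\<lambda>t. \<tau> t > 0) (at 0)"
    using order_tendstoD(1)[OF first_order_tendsto[OF f\<tau>] G] .
  then have ev: "eventually (\<lambda>t. wn (p t) (mpow (a t) (s t) ** Y t ** mpow (b t) (s t)) = exp (1 / p t * ln (\<tau> t))) (at 0)"
    by eventually_elim (simp add: wn_def sch_def \<tau>_def W_def powr_def)
  have co: "wn q (Y 0) * (- (1 / q\<^sup>2) * p' * ln G + 1 / q * (1 / G * \<tau>1 t)) =
     wn q (Y 0) * (- p' / q\<^sup>2 * ln G + 1 / (q * G) *
       (p' * Re (trace (mfun (\<lambda>x. x powr q * ln x) Z))
        + q * (2 * s' * Re (trace (mpow Z q ** mfun ln \<sigma>)) + Re (trace (mpow Z (q - 1) ** Gam (1 / q) Y')))))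
      + wn q (Y 0) * s' / G * (Re (trace (mpow Z q ** mfun ln (a t))) + Re (trace (mpow Z q ** mfun ln (b t))))" for t
  proof -
    have Zq: "mpow Z (q - 1) ** Z = mpow Z q" "Z ** mpow Z (q - 1) = mpow Z q"
      using mpow_add[OF hZ, of "q - 1" 1] mpow_add[OF hZ, of 1 "q - 1"] mpow_1[OF pos_def_psd[OF Z]] by simp_all
    have l: "trace (mpow Z (q - 1) ** (L ** Z)) = trace (mpow Z q ** L)" for L
    proof -
      have "trace (mpow Z (q - 1) ** (L ** Z)) = trace ((mpow Z (q - 1) ** L) ** Z)" by (simp add: matrix_mul_assoc)
      also have "\<dots> = trace (Z ** (mpow Z (q - 1) ** L))" by (rule trace_cyc)
      finally show ?thesis by (simp add: matrix_mul_assoc Zq)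
    qed
    have r: "trace (mpow Z (q - 1) ** (Z ** L)) = trace (mpow Z q ** L)" for L
      by (simp add: matrix_mul_assoc Zq)
    have "Re (trace (mpow Z (q - 1) ** W1 t)) = s' * (2 * Re (trace (mpow Z q ** mfun ln \<sigma>))
       + Re (trace (mpow Z q ** mfun ln (a t))) + Re (trace (mpow Z q ** mfun ln (b t)))) + Re (trace (mpow Z (q - 1) ** Z'))"
      by (simp add: W1_def mat_add_distrib mat_scaleR_mult trace_add trace_scaleR l r algebra_simps)
    then show ?thesis using q G by (simp add: \<tau>1_def Z'_def field_simps)
  qed
  show ?thesis using first_order_cong[OF fx[unfolded w0] ev] by (simp only: co)
qed


section \<open>The optimal weight\<close>

text \<open>\<open>V\<close> equals \<open>r ** w ** r\<close> with \<open>r\<close> the square root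
  of \<open>\<sigma>\<close>. Since \<open>L\<close> commutes with \<open>r\<close>, the trace
  becomes the state \<open>\<sigma>\<close> at \<open>w ** L\<close>, and \<open>E\<close> leaves
  this state invariant. Thus \<open>E w\<close> is the density of \<open>V\<close> restricted to
  \<open>N\<close>, which is the matrix inside the entropy.\<close>

lemma trace_expectation:
  assumes L: "L \<in> N"
  shows "trace (V ** L) = trace (\<sigma> ** E (mpow \<sigma> (- 1 / 2) ** V ** mpow \<sigma> (- 1 / 2)) ** L)"
proof -
  define r where "r = mpow \<sigma> (1 / 2)"
  define w where "w = mpow \<sigma> (- 1 / 2) ** V ** mpow \<sigma> (- 1 / 2)"
  have rr: "r ** mpow \<sigma> (- 1 / 2) = mat 1" "mpow \<sigma> (- 1 / 2) ** r = mat 1"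
    using mpow_inverse[OF sigma, of "1 / 2"] by (simp_all add: r_def)
  have r2: "r ** r = \<sigma>" using mpow_add[OF hermS, of "1 / 2" "1 / 2"] mpow_1[OF pos_def_psd[OF sigma]] by (simp add: r_def)
  have V: "V = r ** w ** r"
  proof -
    have "r ** w ** r = (r ** mpow \<sigma> (- 1 / 2)) ** V ** (mpow \<sigma> (- 1 / 2) ** r)" by (simp only: w_def matrix_mul_assoc)
    then show ?thesis by (simp only: rr) simp
  qed
  have c: "r ** L = L ** r" unfolding r_def by (rule mpow_sigma_commute[OF L])
  have "trace (V ** L) = trace (r ** (w ** (r ** L)))" by (simp only: V matrix_mul_assoc)
  also have "\<dots> = trace ((w ** (r ** L)) ** r)" by (rule trace_cyc)
  also have "\<dots> = trace ((w ** L) ** (r ** r))" by (simp only: c matrix_mul_assoc)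
  also have "\<dots> = trace (\<sigma> ** (w ** L))" by (simp only: r2 trace_cyc)
  also have "\<dots> = trace (\<sigma> ** E (w ** L))" by (simp only: sigma_E)
  also have "E (w ** L) = E w ** L" using E_bimodule[OF N_one L, of w] by simp
  finally show ?thesis by (simp only: w_def matrix_mul_assoc)
qed

lemma E_pos_def:
  assumes "pos_def w" shows "pos_def (E w)"
proof -
  obtain c where c: "c > 0" "psd (w - c *\<^sub>R mat 1)" using pos_def_lower_bound[OF assms] .
  have "psd (E (w - c *\<^sub>R mat 1))" by (rule E_psd[OF c(2)])
  then have "psd (E w - c *\<^sub>R mat 1)" by (simp add: clinear_map_simps[OF E_lin] E_fix[OF N_one])
  then show ?thesis using pos_def_add_psd[OF pos_def_scaleR[OF pos_def_one c(1)], of "E w - c *\<^sub>R mat 1"] by simp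
qed

text \<open>\<open>y\<close> is the density of \<open>V\<close> on \<open>N\<close> and
  \<open>a0\<close> its normalization. The logarithms lie in \<open>N\<close>, so traces against
  \<open>V\<close> become traces against \<open>\<sigma> ** y\<close>, where the Gibbs inequality
  applies. The term \<open>G * ln (1 + \<delta>)\<close> pays for the excess trace of truncated
  weights.\<close>

lemma optimal_weight:
  assumes V: "pos_def V" and G: "G = Re (trace V)" "G > 0"
    and y: "y = E (mpow \<sigma> (- 1 / 2) ** V ** mpow \<sigma> (- 1 / 2))" and a0: "a0 = (1 / G) *\<^sub>R y"
  shows "pos_def y" "a0 \<in> N" "pos_def a0" "Re (trace (\<sigma> ** a0)) = 1"
    "Re (trace (V ** mfun ln a0)) = Re (trace (V ** mfun ln y)) - G * ln G"
    "\<And>a \<delta>. \<delta> > 0 \<Longrightarrow> a \<in> trunc \<delta> \<Longrightarrow> Re (trace (V ** mfun ln a)) \<le> Re (trace (V ** mfun ln a0)) + G * ln (1 + \<delta>)"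
proof -
  have h: "herm (mpow \<sigma> (- 1 / 2))" by (rule herm_mpow[OF hermS])
  have "pos_def (adj (mpow \<sigma> (- 1 / 2)) ** V ** mpow \<sigma> (- 1 / 2))"
    by (rule pos_def_conj[OF V invertible_mpow[OF sigma]])
  then show yp: "pos_def y" unfolding y adj_herm[OF h] by (rule E_pos_def)
  have yN: "y \<in> N" by (simp add: y)
  show a0N: "a0 \<in> N" using N_scaleR[OF yN] by (simp add: a0)
  show a0p: "pos_def a0" using pos_def_scaleR[OF yp] G by (simp add: a0)
  have Gy: "Re (trace (\<sigma> ** y)) = G" using trace_expectation[OF N_one, of V] by (simp add: G y)
  show "Re (trace (\<sigma> ** a0)) = 1" using G Gy by (simp add: a0 mat_scaleR_mult trace_scaleR)
  have hy: "herm y" using yp by (rule pos_def_herm)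
  have lna0: "mfun ln a0 = mfun ln y - ln G *\<^sub>R mat 1"
  proof -
    have "a0 = mfun (\<lambda>x. (1 / G) * x) y" using mfun_scaleR[OF hy, of "1 / G" "\<lambda>x. x"] hy by (simp add: a0)
    then have "mfun ln a0 = mfun (\<lambda>x. ln ((1 / G) * x)) y" by (simp only: mfun_mfun[OF hy])
    also have "\<dots> = mfun (\<lambda>x. ln x - ln G) y" using G by (intro mfun_cong_pos_def[OF yp]) (simp add: ln_div)
    finally show ?thesis by (simp add: mfun_diff[OF hy] mfun_const[OF hy])
  qed
  show l0: "Re (trace (V ** mfun ln a0)) = Re (trace (V ** mfun ln y)) - G * ln G"
    by (simp add: lna0 mat_simps trace_sub trace_scaleR G)
  fix a \<delta> assume d: "\<delta> > (0::real)" and a: "a \<in> trunc \<delta>"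
  have ap: "pos_def a" by (rule trunc_pos_def[OF d a])
  have aN: "a \<in> N" and tra: "Re (trace (\<sigma> ** a)) = 1 + \<delta>" using a by (auto simp: trunc_def)
  define R where "R = mpow \<sigma> (1 / 2)"
  have RR: "R ** R = \<sigma>" using mpow_add[OF hermS, of "1 / 2" "1 / 2"] mpow_1[OF pos_def_psd[OF sigma]] by (simp add: R_def)
  \<comment> \<open>With the scale \<open>(1 + \<delta>) / G\<close> the two linear terms of the
    Gibbs inequality cancel.\<close>
  have "Re (trace (R ** R ** y ** mfun ln a)) \<le> Re (trace (R ** R ** y ** mfun ln y))
    + Re (trace (R ** R ** a)) / ((1 + \<delta>) / G) - Re (trace (R ** R ** y)) + ln ((1 + \<delta>) / G) * Re (trace (R ** R ** y))"
    using d G unfolding R_def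
    by (intro gibbs_inequality[OF yp ap herm_mpow[OF hermS] mpow_sigma_commute[OF yN]]) simp
  then have "Re (trace (\<sigma> ** y ** mfun ln a)) \<le> Re (trace (\<sigma> ** y ** mfun ln y)) + G * ln ((1 + \<delta>) / G)"
    using d G unfolding RR Gy tra by (simp add: mult.commute)
  moreover have "trace (\<sigma> ** y ** mfun ln a) = trace (V ** mfun ln a)"
    unfolding y by (rule trace_expectation[OF mfun_in_N[OF pos_def_herm[OF ap] aN], symmetric])
  moreover have "trace (\<sigma> ** y ** mfun ln y) = trace (V ** mfun ln y)"
    unfolding y by (rule trace_expectation[symmetric]) (use mfun_in_N[OF hy yN] y in simp)
  moreover have "ln ((1 + \<delta>) / G) = ln (1 + \<delta>) - ln G" using d G by (simp add: ln_div)
  ultimately show "Re (trace (V ** mfun ln a)) \<le> Re (trace (V ** mfun ln a0)) + G * ln (1 + \<delta>)"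
    by (simp add: l0 algebra_simps)
qed

section \<open>The derivative\<close>

lemma abs_diff_le_D: "\<bar>x - y - z\<bar> \<le> w \<Longrightarrow> x \<le> y + z + w \<and> y + z - w \<le> x" for x y z w :: real
  by linarith

text \<open>This and \<open>sup_norm\<close> are the two branches of \<open>amal_norm\<close> for
  distinct exponents; \<open>u\<close> stands for the then finite value of
  \<open>two_r\<close>.\<close>

definition inf_norm :: "real \<Rightarrow> real \<Rightarrow> complex^'n^'n \<Rightarrow> real" where
  "inf_norm u p Y = Inf {wn u A * wn u B * wn p X |A B X. A \<in> N \<and> B \<in> N \<and> Y = A ** X ** B}"

definition sup_norm :: "real \<Rightarrow> real \<Rightarrow> complex^'n^'n \<Rightarrow> real" where
  "sup_norm u p Y = Sup {wn p (A ** Y ** B) / (wn u A * wn u B) |A B. A \<in> N \<and> B \<in> N}"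

text \<open>The factorization with \<open>A\<close> and \<open>B\<close> both equal to
  \<open>mpow a (1 / u)\<close>, a factor of norm one.\<close>

lemma inf_norm_le:
  assumes a: "a \<in> N" "pos_def a" "Re (trace (\<sigma> ** a)) = 1" and u: "u > 0"
  shows "inf_norm u p Y \<le> wn p (mpow a (- 1 / u) ** Y ** mpow a (- 1 / u))"
  unfolding inf_norm_def
proof (rule cInf_lower)
  let ?A = "mpow a (1 / u)" and ?X = "mpow a (- 1 / u) ** Y ** mpow a (- 1 / u)"
  have AN: "?A \<in> N" by (rule mpow_in_N[OF pos_def_herm[OF a(2)] a(1)])
  have "?A ** ?X ** ?A = (?A ** mpow a (- 1 / u)) ** Y ** (mpow a (- 1 / u) ** ?A)" by (simp only: matrix_mul_assoc)
  moreover have "?A ** mpow a (- 1 / u) = mat 1" "mpow a (- 1 / u) ** ?A = mat 1"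
    using mpow_inverse[OF a(2), of "1 / u"] by simp_all
  ultimately have "Y = ?A ** ?X ** ?A" by simp
  moreover have "wn p ?X = wn u ?A * wn u ?A * wn p ?X" using wn_mpow[OF a u] by simp
  ultimately show "wn p ?X \<in> {wn u A * wn u B * wn p X |A B X. A \<in> N \<and> B \<in> N \<and> Y = A ** X ** B}"
    using AN by blast
  show "bdd_below {wn u A * wn u B * wn p X |A B X. A \<in> N \<and> B \<in> N \<and> Y = A ** X ** B}"
    by (rule bdd_belowI[of _ 0]) (auto simp: wn_nonneg)
qed

lemma inf_norm_ge:
  assumes u: "u > 0" and p: "p > 0" and d: "\<delta> > 0" and Y: "Y \<noteq> 0"
    and c: "\<And>a b. a \<in> trunc \<delta> \<Longrightarrow> b \<in> trunc \<delta> \<Longrightarrow> c \<le> wn p (mpow a (- 1 / u) ** Y ** mpow b (- 1 / u))"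
  shows "c \<le> inf_norm u p Y"
  unfolding inf_norm_def
proof (rule cInf_greatest)
  have "Y = mat 1 ** Y ** mat 1" by simp
  then show "{wn u A * wn u B * wn p X |A B X. A \<in> N \<and> B \<in> N \<and> Y = A ** X ** B} \<noteq> {}" using N_one by blast
  fix z assume "z \<in> {wn u A * wn u B * wn p X |A B X. A \<in> N \<and> B \<in> N \<and> Y = A ** X ** B}"
  then obtain A B X where z: "z = wn u A * wn u B * wn p X" "A \<in> N" "B \<in> N" "Y = A ** X ** B" by blast
  have nz: "A ** X ** B \<noteq> 0" using Y z by simp
  obtain a b where "a \<in> trunc \<delta>" "b \<in> trunc \<delta>"
    "wn p (mpow a (- 1 / u) ** (A ** X ** B) ** mpow b (- 1 / u)) \<le> wn u A * wn u B * wn p X"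
    using factorization_lower_bound[OF z(2,3) nz u p d] .
  then show "c \<le> z" using c[of a b] z by simp
qed

text \<open>The second claim shares the hypotheses of the first because the bound over truncated
  weights also shows that the set is bounded above; otherwise \<open>Sup\<close> would say nothing
  about its members.\<close>

lemma sup_norm_bounds:
  assumes u: "u > 0" and p: "p > 0" and d: "\<delta> > 0"
    and c: "\<And>a b. a \<in> trunc \<delta> \<Longrightarrow> b \<in> trunc \<delta> \<Longrightarrow> wn p (mpow a (1 / u) ** Y ** mpow b (1 / u)) \<le> c"
  shows "sup_norm u p Y \<le> c"
    and "a0 \<in> N \<Longrightarrow> pos_def a0 \<Longrightarrow> Re (trace (\<sigma> ** a0)) = 1 \<Longrightarrow> wn p (mpow a0 (1 / u) ** Y ** mpow a0 (1 / u)) \<le> sup_norm u p Y"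
proof -
  let ?S = "{wn p (A ** Y ** B) / (wn u A * wn u B) |A B. A \<in> N \<and> B \<in> N}"
  have le: "z \<le> c" if z: "z \<in> ?S" for z
  proof -
    obtain A B where AB: "z = wn p (A ** Y ** B) / (wn u A * wn u B)" "A \<in> N" "B \<in> N" using z by blast
    obtain a b where "a \<in> trunc \<delta>" "b \<in> trunc \<delta>"
      "wn p (A ** Y ** B) / (wn u A * wn u B) \<le> wn p (mpow a (1 / u) ** Y ** mpow b (1 / u))"
      using quotient_upper_bound[OF AB(2,3) u p d] .
    then show ?thesis using c[of a b] AB(1) by simp
  qed
  show "sup_norm u p Y \<le> c" unfolding sup_norm_def by (rule cSup_least) (use N_one le in blast)+
  assume a: "a0 \<in> N" "pos_def a0" "Re (trace (\<sigma> ** a0)) = 1"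
  let ?A = "mpow a0 (1 / u)"
  have AN: "?A \<in> N" by (rule mpow_in_N[OF pos_def_herm[OF a(2)] a(1)])
  have "wn p (?A ** Y ** ?A) = wn p (?A ** Y ** ?A) / (wn u ?A * wn u ?A)" using wn_mpow[OF a u] by simp
  then have "wn p (?A ** Y ** ?A) \<in> ?S" using AN by blast
  moreover have "bdd_above ?S" using le by (rule bdd_aboveI)
  ultimately show "wn p (?A ** Y ** ?A) \<le> sup_norm u p Y" unfolding sup_norm_def by (rule cSup_upper)
qed

text \<open>The case of equal exponents, where the factors are measured in the operator norm: by the
  sandwich inequality no factorization beats the trivial one.\<close>

lemma inf_operator_norm:
  assumes p: "p > 0"
  shows "Inf {onorm ((*v) A) * onorm ((*v) B) * wn p X |A B X. A \<in> N \<and> B \<in> N \<and> Y = A ** X ** B} = wn p Y"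
    (is "Inf ?S = _")
proof (rule antisym)
  have bl: "bounded_linear ((*v) (A :: complex^'n^'n))" for A by (rule matrix_vector_mul_bounded_linear)
  have ob: "op_bound A (onorm ((*v) A))" for A :: "complex^'n^'n"
    unfolding op_bound_def using onorm[OF bl] by blast
  have one: "onorm ((*v) (mat 1 :: complex^'n^'n)) \<le> 1"
    by (rule onorm_bound) auto
  have bd: "bdd_below ?S"
    by (rule bdd_belowI[of _ 0]) (auto intro!: mult_nonneg_nonneg wn_nonneg onorm_pos_le[OF bl])
  have "Y = mat 1 ** Y ** mat 1" by simp
  then have mem: "onorm ((*v) (mat 1 :: complex^'n^'n)) * onorm ((*v) (mat 1 :: complex^'n^'n)) * wn p Y \<in> ?S"
    using N_one by blast
  have "Inf ?S \<le> onorm ((*v) (mat 1 :: complex^'n^'n)) * onorm ((*v) (mat 1 :: complex^'n^'n)) * wn p Y"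
    by (rule cInf_lower[OF mem bd])
  also have "\<dots> \<le> 1 * 1 * wn p Y"
    by (intro mult_mono one wn_nonneg onorm_pos_le[OF bl] mult_nonneg_nonneg) auto
  finally show "Inf ?S \<le> wn p Y" by simp
  show "wn p Y \<le> Inf ?S"
  proof (rule cInf_greatest)
    show "?S \<noteq> {}" using mem by blast
    fix z assume "z \<in> ?S"
    then obtain A B X where z: "z = onorm ((*v) A) * onorm ((*v) B) * wn p X" "A \<in> N" "B \<in> N" "Y = A ** X ** B" by blast
    show "wn p Y \<le> z" unfolding z(1,4)
      by (rule wn_sandwich[OF p onorm_pos_le[OF bl] onorm_pos_le[OF bl] ob ob z(2,3)])
  qed
qed

lemma derivative_of_amalgamated_norm:
  assumes p: "(p has_real_derivative p') (at 0)" "p 0 = q" "p' > 0" and q: "q > 0"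
    and Y: "(Y has_vector_derivative Y') (at 0)" "pos_def (Y 0)" "eventually (\<lambda>t. Y t \<noteq> 0) (at 0)"
    and f0: "f 0 = wn q (Y 0)"
    and finf: "\<And>t. q < p t \<Longrightarrow> f t = inf_norm (2 / (1 / q - 1 / p t)) (p t) (Y t)"
    and fsup: "\<And>t. p t < q \<Longrightarrow> f t = sup_norm (2 / (1 / p t - 1 / q)) (p t) (Y t)"
  defines "s' \<equiv> - p' / (2 * q\<^sup>2)" and "Z \<equiv> Gam (1 / q) (Y 0)"
  defines "G \<equiv> Re (trace (mpow Z q))" and "y \<equiv> E (mpow \<sigma> (- 1 / 2) ** mpow Z q ** mpow \<sigma> (- 1 / 2))"
  shows "(f has_real_derivative
     wn q (Y 0) * (- p' / q\<^sup>2 * ln G + 1 / (q * G) *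
       (p' * Re (trace (mfun (\<lambda>x. x powr q * ln x) Z))
        + q * (2 * s' * Re (trace (mpow Z q ** mfun ln \<sigma>)) + Re (trace (mpow Z (q - 1) ** Gam (1 / q) Y')))))
      + wn q (Y 0) * s' / G * (2 * (Re (trace (mpow Z q ** mfun ln y)) - G * ln G))) (at 0)"
proof -
  have Z: "pos_def Z" unfolding Z_def by (rule Gam_pos_def[OF Y(2)])
  have G: "G > 0" unfolding G_def by (rule trace_mpow_pos[OF Z])
  define a0 where "a0 = (1 / G) *\<^sub>R y"
  note ow = optimal_weight[OF pos_def_mpow[OF Z, of q] meta_eq_to_obj_eq[OF G_def] G meta_eq_to_obj_eq[OF y_def] a0_def]
  define l where "l a = Re (trace (mpow Z q ** mfun ln a))" for a
  define D0 where "D0 = wn q (Y 0) * (- p' / q\<^sup>2 * ln G + 1 / (q * G) *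
       (p' * Re (trace (mfun (\<lambda>x. x powr q * ln x) Z))
        + q * (2 * s' * Re (trace (mpow Z q ** mfun ln \<sigma>)) + Re (trace (mpow Z (q - 1) ** Gam (1 / q) Y')))))"
  define c0 where "c0 = wn q (Y 0) * s' / G"
  define D where "D = D0 + c0 * (2 * l a0)"
  have s'0: "s' \<le> 0" using p q by (simp add: s'_def)
  have c0: "c0 \<le> 0" using s'0 wn_nonneg[of q "Y 0"] G by (simp add: c0_def divide_nonpos_pos mult_nonneg_nonpos)
  define s where "s t = (1 / p t - 1 / q) / 2" for t
  define F where "F t a b = wn (p t) (mpow a (s t) ** Y t ** mpow b (s t))" for t a b
  define \<Phi> where "\<Phi> = wn q (Y 0)"
  have expansion: "eventually (\<lambda>t. \<bar>F t (a t) (b t) - \<Phi> - t * (D0 + c0 * (l (a t) + l (b t)))\<bar> \<le> e * \<bar>t\<bar>) (at 0)"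
    if ab: "\<And>t. a t \<in> N" "\<And>t. b t \<in> N" and m: "m > 0" and e: "e > 0"
    and a: "\<And>t. psd (a t - m *\<^sub>R mat 1)" "\<And>t. psd (M *\<^sub>R mat 1 - a t)"
    and b: "\<And>t. psd (b t - m *\<^sub>R mat 1)" "\<And>t. psd (M *\<^sub>R mat 1 - b t)" for a b m M e
  proof -
    have "first_order (\<lambda>t. F t (a t) (b t)) \<Phi> (\<lambda>t. D0 + c0 * (l (a t) + l (b t)))"
      using norm_expansion[OF p(1,2) q Y(1,2) ab m a b]
      unfolding F_def s_def \<Phi>_def D0_def c0_def l_def G_def Z_def s'_def .
    then have "Zfun (\<lambda>t. (1 / t) *\<^sub>R (F t (a t) (b t) - \<Phi>) - (D0 + c0 * (l (a t) + l (b t)))) (at 0)"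
      by (simp add: first_order_def)
    from ZfunD[OF this e] eventually_at_0_nonzero show ?thesis
    proof eventually_elim
      case (elim t)
      define x where "x = (1 / t) *\<^sub>R (F t (a t) (b t) - \<Phi>) - (D0 + c0 * (l (a t) + l (b t)))"
      have "F t (a t) (b t) - \<Phi> - t * (D0 + c0 * (l (a t) + l (b t))) = t * x"
        using elim(2) by (simp add: x_def right_diff_distrib)
      moreover have "\<bar>t\<bar> * \<bar>x\<bar> \<le> \<bar>t\<bar> * e" using elim(1) by (intro mult_left_mono) (auto simp: x_def)
      ultimately show ?case by (simp only: abs_mult mult.commute)
    qed
  qed
  have uniform: "eventually (\<lambda>t. \<forall>a\<in>trunc \<delta>. \<forall>b\<in>trunc \<delta>. \<bar>F t a b - \<Phi> - t * (D0 + c0 * (l a + l b))\<bar> \<le> e * \<bar>t\<bar>) (at 0)"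
    if d: "\<delta> > 0" and e: "e > 0" for \<delta> e
  proof -
    \<comment> \<open>At every \<open>t\<close> where some pair violates the estimate such a pair is
      selected, and elsewhere a scalar weight. The expansion holds along this irregular selection
      for all small \<open>t\<close>, so violations cease near 0.\<close>
    define Q where "Q t ab \<longleftrightarrow> fst ab \<in> trunc \<delta> \<and> snd ab \<in> trunc \<delta> \<and>
       \<not> \<bar>F t (fst ab) (snd ab) - \<Phi> - t * (D0 + c0 * (l (fst ab) + l (snd ab)))\<bar> \<le> e * \<bar>t\<bar>" for t ab
    define ab where "ab t = (if Ex (Q t) then (SOME x. Q t x) else ((1 + \<delta>) *\<^sub>R mat 1, (1 + \<delta>) *\<^sub>R mat 1))" for t
    have Qab: "Ex (Q t) \<Longrightarrow> Q t (ab t)" for t unfolding ab_def by (auto intro: someI_ex)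
    have mem: "fst (ab t) \<in> trunc \<delta>" "snd (ab t) \<in> trunc \<delta>" for t
      using Qab[of t] trunc_scalar[of \<delta>] by (cases "Ex (Q t)"; auto simp: Q_def ab_def)+
    obtain M where M: "\<And>a. a \<in> trunc \<delta> \<Longrightarrow> psd (M *\<^sub>R mat 1 - a)" using trunc_bounded d by blast
    have "eventually (\<lambda>t. \<bar>F t (fst (ab t)) (snd (ab t)) - \<Phi> - t * (D0 + c0 * (l (fst (ab t)) + l (snd (ab t))))\<bar> \<le> e * \<bar>t\<bar>) (at 0)"
      using mem by (intro expansion[of "\<lambda>t. fst (ab t)" "\<lambda>t. snd (ab t)", OF _ _ d e _ M _ M]) (auto simp: trunc_def)
    then show ?thesis
    proof eventually_elim
      case (elim t)
      then have "\<not> Ex (Q t)" using Qab[of t] by (auto simp: Q_def)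
      then show ?case by (auto simp: Q_def)
    qed
  qed
  have witness: "eventually (\<lambda>t. \<bar>F t a0 a0 - \<Phi> - t * D\<bar> \<le> e * \<bar>t\<bar>) (at 0)" if e: "e > 0" for e
  proof -
    obtain m where m: "m > 0" "psd (a0 - m *\<^sub>R mat 1)" using pos_def_lower_bound[OF ow(3)] .
    obtain M where M: "psd (M *\<^sub>R mat 1 - a0)" using herm_upper_bound[OF pos_def_herm[OF ow(3)]] .
    show ?thesis
      using expansion[of "\<lambda>_. a0" "\<lambda>_. a0", OF ow(2) ow(2) m(1) e m(2) M m(2) M] by (simp add: D_def)
  qed
  \<comment> \<open>A positive difference quotient decides the branch: near 0, \<open>p t\<close>
    exceeds \<open>q\<close> for \<open>t > 0\<close> and is below \<open>q\<close> for
    \<open>t < 0\<close>.\<close>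
  have pq: "((\<lambda>t. (p t - q) / t) \<longlongrightarrow> p') (at 0)"
    using p(1,2) by (simp add: has_field_derivative_iff)
  have plim: "(p \<longlongrightarrow> q) (at 0)" using DERIV_isCont[OF p(1)] p(2) by (simp add: isCont_def)
  have "((\<lambda>t. (f t - f 0) / (t - 0)) \<longlongrightarrow> D) (at 0)"
  proof (rule tendstoI)
    fix e :: real assume e: "e > 0"
    \<comment> \<open>Makes the truncation error \<open>- 2 * c0 * G * ln (1 + \<delta>)\<close> at
      most \<open>e / 4\<close>; the summand 1 keeps the denominator positive.\<close>
    define \<delta> where "\<delta> = e / (8 * (- c0 * G + 1))"
    have cG: "c0 * G \<le> 0" using c0 G by (simp add: mult_nonpos_nonneg)
    then have k: "- c0 * G + 1 > 0" by simp
    have d: "\<delta> > 0" using e k by (simp add: \<delta>_def)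
    have small: "- 2 * c0 * G * ln (1 + \<delta>) \<le> e / 4"
    proof -
      have "- 2 * c0 * G * ln (1 + \<delta>) \<le> - 2 * c0 * G * \<delta>"
        using cG d by (intro mult_left_mono ln_add_one_self_le_self) (auto simp: mult.commute)
      also have "\<dots> \<le> 2 * (- c0 * G + 1) * \<delta>" using d by (intro mult_right_mono) auto
      also have "\<dots> = e / 4" using k by (simp add: \<delta>_def field_simps)
      finally show ?thesis .
    qed
    have e4: "e / 4 > 0" using e by simp
    show "eventually (\<lambda>t. dist ((f t - f 0) / (t - 0)) D < e) (at 0)"
      using uniform[OF d e4] witness[OF e4] order_tendstoD(1)[OF pq p(3)] order_tendstoD(1)[OF plim q]
        eventually_at_0_nonzero Y(3)
    proof eventually_elim
      case (elim t)
      have lb: "l a \<le> l a0 + G * ln (1 + \<delta>)" if "a \<in> trunc \<delta>" for a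
        using ow(6)[OF d that] by (simp add: l_def)
      have cl: "D0 + c0 * (l a + l b) \<ge> D - e / 4" if "a \<in> trunc \<delta>" "b \<in> trunc \<delta>" for a b
      proof -
        have "c0 * (2 * l a0 + 2 * (G * ln (1 + \<delta>))) \<le> c0 * (l a + l b)"
          using lb[OF that(1)] lb[OF that(2)] c0 by (intro mult_left_mono_neg) auto
        then show ?thesis using small by (simp add: D_def algebra_simps)
      qed
      \<comment> \<open>One quarter of \<open>e\<close> is spent on truncation and one on the
        uniform expansion. The opposite side is given by the witness \<open>a0\<close>.\<close>
      have "\<bar>f t - \<Phi> - t * D\<bar> \<le> e / 2 * \<bar>t\<bar>"
      proof (cases "t > 0")
        case True
        then have pt: "q < p t" using elim(3) by (simp add: zero_less_divide_iff)
        define u where "u = 2 / (1 / q - 1 / p t)"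
        have u: "u > 0" using pt q by (simp add: u_def field_simps)
        \<comment> \<open>For \<open>t > 0\<close> the weights carry the power
          \<open>- 1 / u\<close>, for \<open>t < 0\<close> the power \<open>1 / u\<close>; both
          equal \<open>s t\<close>, so one expansion serves both branches.\<close>
        have su: "- 1 / u = s t" by (simp add: u_def s_def field_simps)
        have "f t \<le> F t a0 a0" using inf_norm_le[OF ow(2-4) u, of "p t" "Y t"] finf[OF pt] by (simp only: F_def su u_def[symmetric])
        moreover have "\<Phi> + t * D - t * (e / 2) \<le> f t"
          unfolding finf[OF pt] u_def[symmetric]
        proof (rule inf_norm_ge[OF u elim(4) d elim(6)])
          fix a b assume ab: "a \<in> trunc \<delta>" "b \<in> trunc \<delta>"
          define X where "X = t * (D0 + c0 * (l a + l b))"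
          have "F t a b \<le> \<Phi> + X + e / 4 * \<bar>t\<bar> \<and> \<Phi> + X - e / 4 * \<bar>t\<bar> \<le> F t a b"
            using elim(1) ab by (intro abs_diff_le_D) (simp only: X_def)
          moreover have "t * (D - e / 4) \<le> X" unfolding X_def using True cl[OF ab] by (intro mult_left_mono) auto
          ultimately have "\<Phi> + t * D - t * (e / 2) \<le> F t a b"
            using True by (auto simp: algebra_simps)
          then show "\<Phi> + t * D - t * (e / 2) \<le> wn (p t) (mpow a (- 1 / u) ** Y t ** mpow b (- 1 / u))"
            by (simp only: F_def su)
        qed
        moreover have "t * e > 0" using True e by simp
        ultimately show ?thesis using abs_diff_le_D[OF elim(2)] True by (intro abs_leI) (auto simp: algebra_simps)
      next
        case False
        then have t: "t < 0" using elim(5) by simp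
        then have pt: "p t < q" using elim(3) by (simp add: zero_less_divide_iff)
        define u where "u = 2 / (1 / p t - 1 / q)"
        have u: "u > 0" using pt elim(4) q by (simp add: u_def field_simps)
        have su: "1 / u = s t" by (simp add: u_def s_def field_simps)
        have ub: "wn (p t) (mpow a (1 / u) ** Y t ** mpow b (1 / u)) \<le> \<Phi> + t * D - t * (e / 2)"
          if ab: "a \<in> trunc \<delta>" "b \<in> trunc \<delta>" for a b
        proof -
          define X where "X = t * (D0 + c0 * (l a + l b))"
          have "F t a b \<le> \<Phi> + X + e / 4 * \<bar>t\<bar> \<and> \<Phi> + X - e / 4 * \<bar>t\<bar> \<le> F t a b"
            using elim(1) ab by (intro abs_diff_le_D) (simp only: X_def)
          moreover have "X \<le> t * (D - e / 4)" unfolding X_def using t cl[OF ab] by (intro mult_left_mono_neg) auto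
          ultimately have "F t a b \<le> \<Phi> + t * D - t * (e / 2)"
            using t by (auto simp: algebra_simps)
          then show ?thesis by (simp only: F_def su)
        qed
        have "f t \<le> \<Phi> + t * D - t * (e / 2)"
          unfolding fsup[OF pt] u_def[symmetric] by (rule sup_norm_bounds(1)[OF u elim(4) d ub])
        moreover have "F t a0 a0 \<le> f t"
          using sup_norm_bounds(2)[OF u elim(4) d ub ow(2-4)] unfolding fsup[OF pt] u_def[symmetric] by (simp only: F_def su)
        moreover have "t * e < 0" using t e by (simp add: mult_neg_pos)
        ultimately show ?thesis using abs_diff_le_D[OF elim(2)] t by (intro abs_leI) (auto simp: algebra_simps)
      qed
      moreover have "(f t - f 0) / (t - 0) - D = (f t - \<Phi> - t * D) / t"
        using elim(5) by (simp add: f0 \<Phi>_def field_simps)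
      ultimately have "\<bar>(f t - f 0) / (t - 0) - D\<bar> \<le> e / 2" using elim(5) by (simp add: abs_divide field_simps)
      then show ?case using e by (simp add: dist_real_def)
    qed
  qed
  then have "(f has_real_derivative D) (at 0)" by (simp add: has_field_derivative_iff)
  then show ?thesis by (simp only: D_def D0_def c0_def l_def ow(5))
qed

end


section \<open>Reality of the traces and the final formula\<close>

lemma hermitian_derivative:
  assumes Y: "(Y has_vector_derivative Y') (at 0)" and h: "\<And>t. t \<in> ball 0 \<epsilon> \<Longrightarrow> herm (Y t)" and e: "\<epsilon> > 0"
  shows "herm Y'"
proof -
  have "((\<lambda>t. adj (Y t)) has_vector_derivative adj Y') (at 0)"
    by (rule bounded_linear.has_vector_derivative[OF bounded_linear_adj Y])
  moreover have "adj (Y t) = Y t" if "t \<in> ball 0 \<epsilon>" for t using h[OF that] by (rule adj_herm)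
  ultimately have "(Y has_vector_derivative adj Y') (at 0)"
    using e by (intro has_vector_derivative_transform_within_open[of "\<lambda>t. adj (Y t)" "adj Y'" 0 "ball 0 \<epsilon>" Y]) auto
  from vector_derivative_unique_at[OF Y this] show ?thesis unfolding herm_def by (rule sym)
qed

text \<open>\<open>V\<close> and the three logarithms are Hermitian, so the complex-valued entropy
  is real. In the first term the logarithm of the power \<open>q\<close> contributes a factor
  \<open>q\<close>, which cancels the prefactor \<open>1 / q\<close>.\<close>

lemma EntN_eq:
  assumes te: "tracial_expectation (dfa P) (condexpN P) (sigmaTr P)" and Y: "pos_def Y" and q: "q > 0"
  defines "Z \<equiv> GammaS P (1 / q) Y"
  shows "EntN P q Y = complex_of_real (Re (trace (mfun (\<lambda>x. x powr q * ln x) Z))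
    - 1 / q * Re (trace (mpow Z q ** mfun ln (sigmaTr P)))
    - 1 / q * Re (trace (mpow Z q ** mfun ln (condexpN P (mpow (sigmaTr P) (- 1 / 2) ** mpow Z q ** mpow (sigmaTr P) (- 1 / 2))))))"
proof -
  interpret tracial_expectation "dfa P" "condexpN P" "sigmaTr P" by (rule te)
  have ZG: "Z = Gam (1 / q) Y" by (simp add: Z_def GammaS_def Gam_def)
  have Z: "pos_def Z" unfolding ZG by (rule Gam_pos_def[OF Y])
  have hZ: "herm Z" using Z by (rule pos_def_herm)
  define V where "V = mpow Z q"
  have V: "pos_def V" and hV: "herm V" using pos_def_mpow[OF Z] pos_def_herm by (auto simp: V_def)
  define y where "y = condexpN P (mpow (sigmaTr P) (- 1 / 2) ** V ** mpow (sigmaTr P) (- 1 / 2))"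
  have hy: "herm y"
    using optimal_weight(1)[OF V refl _ y_def refl] trace_mpow_pos[OF Z, of q] by (simp add: V_def pos_def_herm)
  have "V ** mfun ln V = q *\<^sub>R mfun (\<lambda>x. x powr q * ln x) Z"
  proof -
    have "mfun ln V = mfun (\<lambda>x. ln (x powr q)) Z" by (simp add: V_def mpow_def mfun_mfun[OF hZ])
    then have "V ** mfun ln V = mfun (\<lambda>x. x powr q * ln (x powr q)) Z" by (simp add: V_def mpow_def mfun_mult[OF hZ])
    also have "\<dots> = mfun (\<lambda>x. q * (x powr q * ln x)) Z"
      by (rule mfun_cong_pos_def[OF Z]) (simp add: ln_powr)
    finally show ?thesis by (simp add: mfun_scaleR[OF hZ])
  qed
  moreover have real: "trace (A ** B) = complex_of_real (Re (trace (A ** B)))" if "herm A" "herm B" for A B :: "'a cmat"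
    using Im_trace_herm_mult[OF that] by (simp add: complex_eq_iff)
  moreover have "trace (mfun (\<lambda>x. x powr q * ln x) Z) = complex_of_real (Re (trace (mfun (\<lambda>x. x powr q * ln x) Z)))"
    using real[OF herm_simps(4) herm_mfun[OF hZ], of "\<lambda>x. x powr q * ln x"] by simp
  ultimately have "trace (V ** (mfun ln V - mfun ln (sigmaTr P) - mfun ln y))
    = complex_of_real (q * Re (trace (mfun (\<lambda>x. x powr q * ln x) Z)) - Re (trace (V ** mfun ln (sigmaTr P))) - Re (trace (V ** mfun ln y)))"
    using real[OF hV herm_mfun[OF hermS], of ln] real[OF hV herm_mfun[OF hy], of ln]
    by (simp add: mat_diff_distrib trace_sub trace_scaleR)
  then have "EntN P q Y = complex_of_real (1 / q * (q * Re (trace (mfun (\<lambda>x. x powr q * ln x) Z)) - Re (trace (V ** mfun ln (sigmaTr P))) - Re (trace (V ** mfun ln y))))"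
    by (simp only: EntN_def Let_def Z_def[symmetric] V_def[symmetric] y_def[symmetric] of_real_mult)
  then show ?thesis using q by (simp only: V_def y_def right_diff_distrib) simp
qed

theorem theorem3p4:
  fixes P :: "real \<Rightarrow> complex^'n::finite^'n \<Rightarrow> complex^'n^'n"
    and p p' p'' :: "real \<Rightarrow> real"
    and Y Y' Y'' :: "real \<Rightarrow> complex^'n^'n"
    and q \<epsilon> :: real
  assumes "decohering P"
    and "\<epsilon> > 0"
    and "C2_on (ball 0 \<epsilon>) p p' p''"
    and "mono_on (ball 0 \<epsilon>) p"
    and "p' 0 \<noteq> 0"
    and "p 0 = q" and "q \<ge> 1"
    and "C2_on (ball 0 \<epsilon>) Y Y' Y''"
    and "\<forall>t\<in>ball 0 \<epsilon>. pos_def (Y t)"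
  shows "\<exists>D. ((\<lambda>t. amal_norm P q (p t) (Y t)) has_real_derivative D) (at 0) \<and>
    complex_of_real D =
      complex_of_real (p' 0 / (q * wnorm P (ereal q) (Y 0) powr (q - 1))) *
      (EntN P q (Y 0) + complex_of_real (q / p' 0) *
         trace (mpow (GammaS P (1 / q) (Y 0)) (q - 1) ** GammaS P (1 / q) (Y' 0)))"
proof -
  have te: "tracial_expectation (dfa P) (condexpN P) (sigmaTr P)"
    by (rule decohering_tracial_expectation[OF assms(1)])
  interpret tracial_expectation "dfa P" "condexpN P" "sigmaTr P" by (rule te)
  have q: "q > 0" using assms(7) by simp
  have b0: "0 \<in> ball 0 \<epsilon>" using assms(2) by simp
  have dp: "(p has_real_derivative p' 0) (at 0)"
    using assms(3) b0 by (auto simp: C2_on_def has_real_derivative_iff_has_vector_derivative)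
  have dY: "(Y has_vector_derivative Y' 0) (at 0)" using assms(8) b0 by (auto simp: C2_on_def)
  have Y0: "pos_def (Y 0)" using assms(9) b0 by blast
  \<comment> \<open>A negative derivative would make \<open>p\<close> smaller immediately to the
    right of 0, against monotonicity.\<close>
  have "p' 0 \<ge> 0"
  proof (rule ccontr)
    assume "\<not> p' 0 \<ge> 0"
    then obtain d where d: "d > 0" "\<forall>h>0. h < d \<longrightarrow> p (0 + h) < p 0" using DERIV_neg_dec_right[OF dp] by auto
    define h where "h = min d \<epsilon> / 2"
    have h: "h > 0" "h < d" "h < \<epsilon>" using d(1) assms(2) by (auto simp: h_def min_def)
    have "p 0 \<le> p h" using h b0 assms(4) by (intro mono_onD[of "ball 0 \<epsilon>" p]) auto
    then show False using d h by auto
  qed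
  then have p'0: "p' 0 > 0" using assms(5) by simp
  have Gam: "GammaS P s X = Gam s X" for s X by (simp add: GammaS_def Gam_def)
  have wn: "wnorm P (ereal r) X = wn r X" for r X
    by (simp add: wnorm_def wn_def schatten_def sch_def Gam)
  \<comment> \<open>At infinity the weight exponent is 0, so no power of \<open>\<sigma>\<close>
    remains.\<close>
  have wnI: "wnorm P \<infinity> X = onorm ((*v) X)" for X
    by (simp add: wnorm_def schatten_def GammaS_def mpow_0[OF sigma])
  have f0: "amal_norm P q (p 0) (Y 0) = wn q (Y 0)"
    using inf_operator_norm[OF q, of "Y 0"] by (simp add: amal_norm_def assms(6) two_r_def wn wnI)
  have finf: "amal_norm P q (p t) (Y t) = inf_norm (2 / (1 / q - 1 / p t)) (p t) (Y t)" if "q < p t" for t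
    using that by (simp add: amal_norm_def inf_norm_def two_r_def wn)
  have fsup: "amal_norm P q (p t) (Y t) = sup_norm (2 / (1 / p t - 1 / q)) (p t) (Y t)" if "p t < q" for t
    using that by (simp add: amal_norm_def sup_norm_def two_r_def wn)
  have "eventually (\<lambda>t. t \<in> ball 0 \<epsilon>) (at 0)" using b0 by (intro eventually_at_in_open') auto
  then have Ynz: "eventually (\<lambda>t. Y t \<noteq> 0) (at 0)"
  proof eventually_elim
    case (elim t)
    then have "pos_def (Y t)" using assms(9) by blast
    then have "Re (trace (mpow (Y t) 1)) > 0" by (rule trace_mpow_pos)
    then show ?case using mpow_1[OF pos_def_psd[OF \<open>pos_def (Y t)\<close>]] by auto
  qed
  define Z where "Z = Gam (1 / q) (Y 0)"
  have Z: "pos_def Z" unfolding Z_def by (rule Gam_pos_def[OF Y0])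
  define G where "G = Re (trace (mpow Z q))"
  have G: "G > 0" unfolding G_def by (rule trace_mpow_pos[OF Z])
  define \<Phi> where "\<Phi> = wn q (Y 0)"
  have \<Phi>: "\<Phi> = G powr (1 / q)" using wn_pos_def[OF Y0 q] by (simp add: \<Phi>_def G_def Z_def)
  \<comment> \<open>Source of the power \<open>q - 1\<close> of the norm in the claimed
    denominator.\<close>
  have \<Phi>G: "\<Phi> powr (q - 1) = G / \<Phi>"
  proof -
    have "\<Phi> powr q = G" using G q by (simp add: \<Phi> powr_powr)
    then show ?thesis using G by (simp add: powr_diff) (simp add: \<Phi>)
  qed
  have \<Phi>0: "\<Phi> > 0" using G by (simp add: \<Phi>)
  define A where "A = Re (trace (mfun (\<lambda>x. x powr q * ln x) Z))"
  define B where "B = Re (trace (mpow Z q ** mfun ln (sigmaTr P)))"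
  define C where "C = Re (trace (mpow Z q ** mfun ln (condexpN P (mpow (sigmaTr P) (- 1 / 2) ** mpow Z q ** mpow (sigmaTr P) (- 1 / 2)))))"
  define T where "T = Re (trace (mpow Z (q - 1) ** Gam (1 / q) (Y' 0)))"
  define D where "D = \<Phi> * (- p' 0 / q\<^sup>2 * ln G + 1 / (q * G) * (p' 0 * A + q * (2 * (- p' 0 / (2 * q\<^sup>2)) * B + T)))
    + \<Phi> * (- p' 0 / (2 * q\<^sup>2)) / G * (2 * (C - G * ln G))"
  have der: "((\<lambda>t. amal_norm P q (p t) (Y t)) has_real_derivative D) (at 0)"
    using derivative_of_amalgamated_norm[where f = "\<lambda>t. amal_norm P q (p t) (Y t)", OF dp assms(6) p'0 q dY Y0 Ynz f0 finf fsup]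
    unfolding D_def A_def B_def C_def T_def G_def Z_def \<Phi>_def .
  \<comment> \<open>Makes the last trace real, so that the complex identity reduces to a real
    one.\<close>
  have hY': "herm (Y' 0)"
    using hermitian_derivative[OF dY _ assms(2)] assms(9) pos_def_herm by blast
  have "herm (Gam (1 / q) (Y' 0))"
    using herm_simps(9)[OF hY', of "mpow (sigmaTr P) (1 / q / 2)"] by (simp add: Gam_def adj_herm[OF herm_mpow[OF hermS]])
  then have T: "trace (mpow Z (q - 1) ** Gam (1 / q) (Y' 0)) = complex_of_real T"
    using Im_trace_herm_mult[OF herm_mpow[OF pos_def_herm[OF Z]], of "Gam (1 / q) (Y' 0)" "q - 1"] by (simp add: T_def complex_eq_iff)
  have Ent: "EntN P q (Y 0) = complex_of_real (A - 1 / q * B - 1 / q * C)"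
    using EntN_eq[OF te Y0 q] by (simp only: Gam Z_def[symmetric] A_def B_def C_def)
  \<comment> \<open>The two \<open>ln G\<close> terms in \<open>D\<close> cancel: one stems from the
    derivative of \<open>1 / p\<close>, the other from the normalization of the optimal
    weight.\<close>
  have "D = p' 0 / (q * \<Phi> powr (q - 1)) * (A - 1 / q * B - 1 / q * C + q / p' 0 * T)"
  proof -
    have "D = \<Phi> / (q * G) * (p' 0 * A - p' 0 / q * B + q * T - p' 0 / q * C)"
      using q G by (simp add: D_def field_simps power2_eq_square)
    moreover have "p' 0 / (q * \<Phi> powr (q - 1)) * (A - 1 / q * B - 1 / q * C + q / p' 0 * T)
      = \<Phi> / (q * G) * (p' 0 * A - p' 0 / q * B + q * T - p' 0 / q * C)"
      unfolding \<Phi>G using q G \<Phi>0 p'0 by (simp add: field_simps)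
    ultimately show ?thesis by simp
  qed
  then have "complex_of_real D = complex_of_real (p' 0 / (q * wnorm P (ereal q) (Y 0) powr (q - 1))) *
      (EntN P q (Y 0) + complex_of_real (q / p' 0) *
         trace (mpow (GammaS P (1 / q) (Y 0)) (q - 1) ** GammaS P (1 / q) (Y' 0)))"
    unfolding wn Gam Z_def[symmetric] T Ent \<Phi>_def[symmetric] by (simp only: of_real_mult of_real_add)
  with der show ?thesis by blast
qed

end
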